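(* Any closed homology $3$-manifold $M$ satisfies $$\mu_1(M)-\mu_0(M)\;\leq\;-1+\frac{1}{10}g_2(M).$$ Equality holds here if and only if $M$ is locally $1$-stacked.
   Context: All simplicial complexes are finite and abstract, and the empty set is a face (of dimension $-1$) of every simplicial complex. A field $\mathbb{F}$ is fixed and all homology is simplicial homology with coefficients in $\mathbb{F}$. $V(X)$ is the vertex set of $X$; for any set $A$, $X[A]=\{\alpha\in X:\alpha\subseteq A\}$. For $x\in V(X)$, $\mathrm{lk}(x,X)=\{\alpha: x\notin\alpha,\ \alpha\sqcup\{x\}\in X\}$. $g$-vector. For a $d$-dimensional complex $X$, $f_i(X)$ is the number of $i$-dimensional faces ($-1\le i\le d$), and $g_j(X)=\sum_{i=-1}^{j-1}(-1)^{j-i-1}\binom{d-i+1}{j-i-1}f_i(X)$ for $0\le j\le d+1$. Sigma- and mu-vectors. $\beta_i(X)=\dim_{\mathbb F}H_i(X)$ (unreduced). Reduced Betti numbers: $\tilde\beta_0(X)=\beta_0(X)-1$ (so $\tilde\beta_0(\{\emptyset\})=-1$) and $\tilde\beta_i(X)=\beta_i(X)$ for $i\ge1$. Put $\sigma_i(X)=\sum_{A\subseteq V(X)}\tilde\beta_i(X[A])\big/\binom{f_0(X)}{\#(A)}$ for $i\ge 0$ (the sum includes $A=\emptyset$). The mu-vector $(\mu_0,\dots,\mu_d)$ of a $d$-dimensional simplicial complex $X$ is $$\mu_0(X)=\sum_{x\in V(X)}\frac{1}{1+f_0(\mathrm{lk}(x,X))},\qquad \mu_i(X)=\sum_{x\in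 V(X)}\frac{\delta_{i1}+\sigma_{i-1}(\mathrm{lk}(x,X))}{1+f_0(\mathrm{lk}(x,X))}\quad(1\le i\le d),$$ where $\delta_{ij}$ is the Kronecker symbol. Homology manifolds (over $\mathbb{F}$). A homology $d$-manifold is a pure $d$-dimensional simplicial complex $\Delta$ in which the link of each non-empty face $\alpha$ has the $\mathbb{F}$-homology either of a sphere of dimension $d-\#(\alpha)$ (where $\{\emptyset\}$ counts as the $(-1)$-sphere) or of a point; its boundary $\partial\Delta$ consists of $\emptyset$ and the faces whose links have the homology of a point. It is closed if $\partial\Delta=\{\emptyset\}$; otherwise $\partial\Delta$ is required to be a closed homology $(d-1)$-manifold. A homology $d$-sphere is a closed homology $d$-manifold with the $\mathbb{F}$-homology of the $d$-sphere. A homology $d$-ball is a homology $d$-manifold with the $\mathbb{F}$-homology of a point whose boundary is a homology $(d-1)$-sphere. Stackedness. $\mathrm{Skel}_k(X)$ is the subcomplex of faces of $X$ of dimension $\le k$. A homology $d$-sphere $S$ is $k$-stacked ($0\le k\le d$) if there is a homology $(d+1)$-ball $\Delta$ with $\partial\Delta=S$ and $\mathrm{Skel}_{d-k}(\Delta)=\mathrm{Skel}_{d-k}(S)$. A homology manifold is locally $\ell$-stacked if all its vertex links are $\ell$-stacked homology spheres. *)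

theory Defs
  imports Complex_Main "HOL-Library.Function_Algebras"
begin

section \<open>Finite abstract simplicial complexes\<close>

definition simplicial_complex :: "'a set set \<Rightarrow> bool" where
  "simplicial_complex X \<longleftrightarrow>
     finite X \<and> {} \<in> X \<and> (\<forall>\<alpha>\<in>X. finite \<alpha> \<and> (\<forall>\<beta>. \<beta> \<subseteq> \<alpha> \<longrightarrow> \<beta> \<in> X))"

definition verts :: "'a set set \<Rightarrow> 'a set" where
  "verts X = {x. {x} \<in> X}"

definition face_dim :: "'a set \<Rightarrow> int" where
  "face_dim \<alpha> = int (card \<alpha>) - 1"

definition complex_dim :: "'a set set \<Rightarrow> int" where
  "complex_dim X = Max (face_dim ` X)"

definition pure :: "int \<Rightarrow> 'a set set \<Rightarrow> bool" where
  "pure d X \<longleftrightarrow> complex_dim X = d \<and>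
     (\<forall>\<alpha>\<in>X. (\<forall>\<beta>\<in>X. \<alpha> \<subseteq> \<beta> \<longrightarrow> \<beta> = \<alpha>) \<longrightarrow> face_dim \<alpha> = d)"

definition induced :: "'a set set \<Rightarrow> 'a set \<Rightarrow> 'a set set" where
  "induced X A = {\<alpha>\<in>X. \<alpha> \<subseteq> A}"

definition link :: "'a set \<Rightarrow> 'a set set \<Rightarrow> 'a set set" where
  "link \<alpha> X = {\<beta>. \<alpha> \<inter> \<beta> = {} \<and> \<alpha> \<union> \<beta> \<in> X}"

definition skel :: "int \<Rightarrow> 'a set set \<Rightarrow> 'a set set" where
  "skel k X = {\<alpha>\<in>X. face_dim \<alpha> \<le> k}"

definition face_num :: "int \<Rightarrow> 'a set set \<Rightarrow> nat" where
  "face_num i X = card {\<alpha>\<in>X. face_dim \<alpha> = i}"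

definition g_num :: "nat \<Rightarrow> 'a set set \<Rightarrow> int" where
  "g_num j X = (\<Sum>i\<in>{-1..int j - 1}.
     (-1) ^ nat (int j - i - 1)
       * int (nat (complex_dim X - i + 1) choose nat (int j - i - 1))
       * int (face_num i X))"


section \<open>Simplicial homology with field coefficients\<close>

text \<open>
  Oriented \<open>i\<close>-chains, written without choosing an order of the vertices: a chain assigns a
  coefficient to each ordering \<open>[v\<^sub>0, \<dots>, v\<^sub>i]\<close> of the vertices of an \<open>i\<close>-face, and interchanging
  two neighbouring vertices (hence any odd permutation) changes the sign. In these terms
  \<open>\<partial>[v\<^sub>0, \<dots>, v\<^sub>i] = (\<Sum>j. (-1)^j [v\<^sub>0, \<dots>, v\<^sub>j omitted, \<dots>, v\<^sub>i])\<close> becomes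
  \<open>(\<partial>c) l = (\<Sum>v. c (v # l))\<close>. The value at the empty list is set to \<open>0\<close> because
  the homology is unreduced.
\<close>

definition oriented_chains :: "'a set set \<Rightarrow> nat \<Rightarrow> ('a list \<Rightarrow> 'f::field) set" where
  "oriented_chains X i = {c.
     (\<forall>l. c l \<noteq> 0 \<longrightarrow> distinct l \<and> length l = Suc i \<and> set l \<in> X) \<and>
     (\<forall>xs x y ys. c (xs @ x # y # ys) = - c (xs @ y # x # ys))}"

definition bd :: "'a set set \<Rightarrow> ('a list \<Rightarrow> 'f::field) \<Rightarrow> 'a list \<Rightarrow> 'f" where
  "bd X c l = (if l = [] then 0 else \<Sum>v\<in>verts X. c (v # l))"

definition cycles :: "'a set set \<Rightarrow> nat \<Rightarrow> ('a list \<Rightarrow> 'f::field) set" where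
  "cycles X i = {c \<in> oriented_chains X i. \<forall>l. bd X c l = 0}"

definition boundaries :: "'a set set \<Rightarrow> nat \<Rightarrow> ('a list \<Rightarrow> 'f::field) set" where
  "boundaries X i = bd X ` oriented_chains X (Suc i)"

lemma bd_in_chains:
  assumes "simplicial_complex X" "c \<in> oriented_chains X (Suc i)"
  shows "bd X c \<in> oriented_chains X i"
proof -
  have supp: "distinct l \<and> length l = Suc (Suc i) \<and> set l \<in> X" if "c l \<noteq> 0" for l
    using assms(2) that unfolding oriented_chains_def by blast
  have alt: "c (xs @ x # y # ys) = - c (xs @ y # x # ys)" for xs x y ys
    using assms(2) unfolding oriented_chains_def by blast
  have 1: "distinct l \<and> length l = Suc i \<and> set l \<in> X" if "bd X c l \<noteq> 0" for l
  proof -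
    have "(\<Sum>v\<in>verts X. c (v # l)) \<noteq> 0"
      using that by (simp add: bd_def split: if_splits)
    then obtain v where "c (v # l) \<noteq> 0"
      by (rule sum.not_neutral_contains_not_neutral)
    from supp[OF this] have "distinct l" "length l = Suc i" "insert v (set l) \<in> X"
      by auto
    moreover from this(3) have "set l \<in> X"
      using assms(1) unfolding simplicial_complex_def by blast
    ultimately show ?thesis by blast
  qed
  have 2: "bd X c (xs @ x # y # ys) = - bd X c (xs @ y # x # ys)" for xs x y ys
  proof -
    have "c (v # xs @ x # y # ys) = - c (v # xs @ y # x # ys)" for v
      using alt[of "v # xs" x y ys] by simp
    then have "(\<Sum>v\<in>verts X. c (v # xs @ x # y # ys)) = - (\<Sum>v\<in>verts X. c (v # xs @ y # x # ys))"
      unfolding sum_negf [symmetric] by (rule sum.cong [OF refl])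
    then show ?thesis unfolding bd_def by simp
  qed
  show ?thesis
    unfolding oriented_chains_def using 1 2 by blast
qed

lemma bd_bd:
  assumes "c \<in> oriented_chains X i"
  shows "bd X (bd X c) l = 0"
proof -
  have supp: "distinct l" if "c l \<noteq> 0" for l
    using assms that unfolding oriented_chains_def by blast
  have alt: "c (xs @ x # y # ys) = - c (xs @ y # x # ys)" for xs x y ys
    using assms unfolding oriented_chains_def by blast
  have "(\<Sum>v\<in>V. \<Sum>w\<in>V. c (w # v # l)) = 0" if "finite V" for V
    using that
  proof (induction V)
    case (insert x V)
    have 1: "c (x # x # l) = 0" using supp[of "x # x # l"] by auto
    have "c (x # v # l) = - c (v # x # l)" for v
      using alt[of "[]" x v l] by simp
    then have 2: "(\<Sum>v\<in>V. c (x # v # l)) = - (\<Sum>v\<in>V. c (v # x # l))"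
      unfolding sum_negf [symmetric] by (rule sum.cong [OF refl])
    show ?case
      using insert 1 2 by (simp add: sum.distrib)
  qed simp
  then have "(\<Sum>v\<in>verts X. \<Sum>w\<in>verts X. c (w # v # l)) = 0"
    by (cases "finite (verts X)") auto
  then show ?thesis unfolding bd_def by simp
qed

lemma boundaries_subset_cycles:
  "simplicial_complex X \<Longrightarrow> boundaries X i \<subseteq> cycles X i"
  unfolding boundaries_def cycles_def using bd_in_chains bd_bd by blast

lemma vector_space_fun:
  "vector_space (\<lambda>(a::'f::field) (c::'b \<Rightarrow> 'f) l. a * c l)"
  by unfold_locales (auto simp: fun_eq_iff algebra_simps)

definition fun_dim :: "('b \<Rightarrow> 'f::field) set \<Rightarrow> nat" where
  "fun_dim = vector_space.dim (\<lambda>a c l. a * c l)"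

text \<open>
  The argument \<open>'f itself\<close> names the coefficient field. The Betti number is the dimension of
  \<open>H\<^sub>i = Z\<^sub>i / B\<^sub>i\<close>, i.e. \<open>dim Z\<^sub>i - dim B\<^sub>i\<close>; there is no truncation in
  the subtraction, as \<open>B\<^sub>i \<subseteq> Z\<^sub>i\<close> and both are finite-dimensional for finite \<open>X\<close>.
\<close>

definition betti :: "'f::field itself \<Rightarrow> nat \<Rightarrow> 'a set set \<Rightarrow> nat" where
  "betti F i X = fun_dim (cycles X i :: ('a list \<Rightarrow> 'f) set)
               - fun_dim (boundaries X i :: ('a list \<Rightarrow> 'f) set)"

definition red_betti :: "'f::field itself \<Rightarrow> nat \<Rightarrow> 'a set set \<Rightarrow> int" where
  "red_betti F i X = (if i = 0 then int (betti F 0 X) - 1 else int (betti F i X))"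

definition point_homology :: "'f::field itself \<Rightarrow> 'a set set \<Rightarrow> bool" where
  "point_homology F X \<longleftrightarrow> (\<forall>i. betti F i X = (if i = 0 then 1 else 0))"

text \<open>
  For \<open>n = 0\<close> both summands contribute in degree \<open>0\<close> (two points); for \<open>n = -1\<close> all Betti numbers
  vanish, as they do for \<open>{{}}\<close>.
\<close>

definition sphere_homology :: "'f::field itself \<Rightarrow> int \<Rightarrow> 'a set set \<Rightarrow> bool" where
  "sphere_homology F n X \<longleftrightarrow>
     (\<forall>i. betti F i X = (if i = 0 \<and> n \<ge> 0 then 1 else 0) + (if int i = n then 1 else 0))"


section \<open>Sigma- and mu-vectors\<close>

definition sigma :: "'f::field itself \<Rightarrow> nat \<Rightarrow> 'a set set \<Rightarrow> real" where
  "sigma F i X = (\<Sum>A\<in>Pow (verts X).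
     of_int (red_betti F i (induced X A)) / of_nat (face_num 0 X choose card A))"

definition mu :: "'f::field itself \<Rightarrow> nat \<Rightarrow> 'a set set \<Rightarrow> real" where
  "mu F i X =
     (if i = 0 then \<Sum>x\<in>verts X. 1 / (1 + of_nat (face_num 0 (link {x} X)))
      else \<Sum>x\<in>verts X. ((if i = 1 then 1 else 0) + sigma F (i - 1) (link {x} X))
                          / (1 + of_nat (face_num 0 (link {x} X))))"


section \<open>Homology manifolds, spheres and balls\<close>

text \<open>The condition on links alone, without the requirement on the boundary.\<close>

definition manifold_links :: "'f::field itself \<Rightarrow> int \<Rightarrow> 'a set set \<Rightarrow> bool" where
  "manifold_links F d X \<longleftrightarrow> simplicial_complex X \<and> pure d X \<and>
     (\<forall>\<alpha>\<in>X. \<alpha> \<noteq> {} \<longrightarrow>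
        sphere_homology F (d - int (card \<alpha>)) (link \<alpha> X) \<or> point_homology F (link \<alpha> X))"

definition manifold_boundary :: "'f::field itself \<Rightarrow> 'a set set \<Rightarrow> 'a set set" where
  "manifold_boundary F X = {{}} \<union> {\<alpha>\<in>X. \<alpha> \<noteq> {} \<and> point_homology F (link \<alpha> X)}"

definition closed_homology_manifold :: "'f::field itself \<Rightarrow> int \<Rightarrow> 'a set set \<Rightarrow> bool" where
  "closed_homology_manifold F d X \<longleftrightarrow> manifold_links F d X \<and> manifold_boundary F X = {{}}"

definition homology_manifold :: "'f::field itself \<Rightarrow> int \<Rightarrow> 'a set set \<Rightarrow> bool" where
  "homology_manifold F d X \<longleftrightarrow> manifold_links F d X \<and>
     (manifold_boundary F X = {{}} \<or> closed_homology_manifold F (d - 1) (manifold_boundary F X))"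

definition homology_sphere :: "'f::field itself \<Rightarrow> int \<Rightarrow> 'a set set \<Rightarrow> bool" where
  "homology_sphere F d X \<longleftrightarrow> closed_homology_manifold F d X \<and> sphere_homology F d X"

definition homology_ball :: "'f::field itself \<Rightarrow> int \<Rightarrow> 'a set set \<Rightarrow> bool" where
  "homology_ball F d X \<longleftrightarrow> homology_manifold F d X \<and> point_homology F X \<and>
     homology_sphere F (d - 1) (manifold_boundary F X)"


section \<open>Stackedness\<close>

text \<open>
  Letting the ball range over complexes on the same vertex type is no restriction: since
  \<open>d - k \<ge> 0\<close>, the condition on skeleta forces the ball to have the vertices of the sphere.
\<close>

definition stacked_sphere :: "'f::field itself \<Rightarrow> int \<Rightarrow> int \<Rightarrow> 'a set set \<Rightarrow> bool" where
  "stacked_sphere F d k S \<longleftrightarrow> homology_sphere F d S \<and> 0 \<le> k \<and> k \<le> d \<and>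
     (\<exists>D. homology_ball F (d + 1) D \<and> manifold_boundary F D = S \<and>
          skel (d - k) D = skel (d - k) S)"

definition locally_stacked :: "'f::field itself \<Rightarrow> int \<Rightarrow> int \<Rightarrow> 'a set set \<Rightarrow> bool" where
  "locally_stacked F d l X \<longleftrightarrow> homology_manifold F d X \<and>
     (\<forall>x\<in>verts X. stacked_sphere F (d - 1) l (link {x} X))"

end

theory Submission
  imports Defs "HOL-Library.Z2"
begin

text \<open>
  Each vertex link \<open>S\<close> of \<open>M\<close> is a homology 2-sphere, and everything is decided link by link.
  Write \<open>n\<close> for the number of vertices of \<open>S\<close>. Since \<open>g\<^sub>2(M) = f\<^sub>1 - 4 f\<^sub>0 + 10\<close> and the degrees of the
  vertices sum to \<open>2 f\<^sub>1\<close>, the right-hand side is the sum of \<open>(n - 8) / 20\<close> over all vertices, while the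
  left-hand side is the sum of \<open>\<sigma>\<^sub>0(S) / (n + 1)\<close>. So the theorem follows from:
  a homology 2-sphere satisfies \<open>\<sigma>\<^sub>0(S) / (n + 1) \<le> (n - 8) / 20\<close>, with equality iff it is 1-stacked.

  The number \<open>\<sigma>\<^sub>0(S) / (n + 1) + 1\<close> is the expected number of components of the subgraph induced on a
  random set of vertices, the size of the set being uniformly distributed (\<open>sigma_0_eq_avg\<close>). Random
  sets of this kind restrict to random sets of the same kind (\<open>avg_restrict\<close>), which makes the
  expectation behave well under local changes of the triangulation. Thus the claim is that the
  expectation is at most \<open>(n + 12) / 20\<close>.

  The upper bound (\<open>sphere_bound\<close>) is by induction on \<open>n\<close>. If three mutually adjacent vertices do not
  span a triangle, they separate the sphere into two spheres (\<open>Jordan_triangle\<close>, \<open>split_sphere\<close>), and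
  both sides of the inequality are additive. Otherwise, unless \<open>n = 4\<close>, there is a vertex \<open>x\<close> of degree 4
  or 5 whose link has no chords. Deleting \<open>x\<close> and triangulating the hole by diagonals from one vertex,
  which amounts to one or two edge flips followed by the removal of a vertex of degree 3, lowers the
  expectation by less than \<open>1/20\<close> (\<open>degree_4_bound\<close>, \<open>degree_5_bound\<close>). Topology enters only through
  the mod 2 homology of the surface: a closed surface has Euler characteristic at most 2, and if it is
  2 then every 1-cycle bounds.

  For equality, a 3-ball without interior edges has \<open>n - 3\<close> tetrahedra by an Euler characteristic count,
  and it is strongly connected, so its tetrahedra can be listed such that each is attached along a
  triangle of an earlier one, and then each must bring exactly one new vertex; this computes the
  expectation (\<open>stacked_attains_bound\<close>). Conversely, the induction yields a vertex of degree 3 in any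
  sphere with \<open>n \<ge> 5\<close> that attains the bound. Removing it leaves a sphere that attains the bound, and
  a ball filling the smaller sphere is extended by one tetrahedron, a cone over a boundary triangle;
  coning off a nonempty face does not increase Betti numbers (\<open>betti_cone_le\<close>), which keeps all links
  under control (\<open>extremal_sphere_filled\<close>).
\<close>

section \<open>Dimensions of function spaces\<close>

lemma (in vector_space_pair) rank_nullity:
  assumes lf: "Vector_Spaces.linear s1 s2 f" and S: "vs1.subspace S" "S \<subseteq> vs1.span Q" "finite Q"
  shows "vs1.dim S = vs1.dim {x\<in>S. f x = 0} + vs2.dim (f ` S)"
proof -
  interpret lf: Vector_Spaces.linear s1 s2 f by fact
  let ?N = "{x\<in>S. f x = 0}"
  have N_eq: "?N = S \<inter> {x. f x = 0}" by blast
  have N: "vs1.subspace ?N"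
    unfolding N_eq by (intro vs1.subspace_inter S lf.subspace_kernel)
  obtain B where B: "B \<subseteq> ?N" "vs1.independent B" "?N \<subseteq> vs1.span B" "card B = vs1.dim ?N"
    using vs1.basis_exists by blast
  obtain C where C: "B \<subseteq> C" "C \<subseteq> S" "vs1.independent C" "S \<subseteq> vs1.span C"
    using vs1.maximal_independent_subset_extend[of B S] B by blast
  have finC: "finite C"
    using vs1.independent_span_bound[OF S(3) C(3)] C(2) S(2) by blast
  have dimS: "vs1.dim S = card C"
    using vs1.basis_card_eq_dim[OF C(2,4,3)] by simp
  let ?D = "C - B"
  have iD: "vs1.independent ?D" using C(3) vs1.independent_mono by blast
  have spD: "vs1.span ?D \<subseteq> S" using C(2) S(1) by (meson Diff_subset subset_trans vs1.span_minimal)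
  have ker: "x = 0" if "x \<in> vs1.span ?D" "f x = 0" for x
  proof -
    have xB: "x \<in> vs1.span B" using that spD B(3) by blast
    have xC: "x \<in> vs1.span C" using xB C(1) vs1.span_mono by blast
    have 1: "vs1.representation C x = vs1.representation B x"
      by (rule vs1.representation_extend[OF C(3) xB C(1)])
    have 2: "vs1.representation C x = vs1.representation ?D x"
      by (rule vs1.representation_extend[OF C(3) that(1)]) auto
    have "vs1.representation C x b = 0" for b
      using vs1.representation_ne_zero[of B x b] vs1.representation_ne_zero[of ?D x b] 1 2
      by (metis DiffD2)
    then show "x = 0"
      using vs1.sum_nonzero_representation_eq[OF C(3) xC] by simp
  qed
  have inj: "inj_on f (vs1.span ?D)"
    using lf.inj_on_iff_eq_0[OF vs1.subspace_span] ker by blast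
  have ifD: "vs2.independent (f ` ?D)"
    by (rule lf.independent_injective_image[OF iD inj])
  have cD: "card (f ` ?D) = card ?D"
    by (rule card_image) (meson inj inj_on_subset vs1.span_superset)
  have "f ` C \<subseteq> insert 0 (f ` ?D)" using B(1) by auto
  then have "vs2.span (f ` C) \<subseteq> vs2.span (f ` ?D)"
    by (metis vs2.span_insert_0 vs2.span_mono)
  then have sp: "f ` S \<subseteq> vs2.span (f ` ?D)"
    using C(4) lf.span_image by blast
  have "vs2.dim (f ` S) = card ?D"
    using vs2.basis_card_eq_dim[OF _ sp ifD] cD C(2) by (metis Diff_subset image_mono subset_trans)
  moreover have "card C = card B + card ?D"
    using card_Un_disjoint[of B ?D] finite_subset[OF C(1) finC] finC C(1) by (simp add: Un_absorb1)
  ultimately show ?thesis using dimS B(4) by simp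
qed

interpretation fs: vector_space "\<lambda>(a::'f::field) (c::'b \<Rightarrow> 'f) l. a * c l"
  rewrites "vector_space.dim (\<lambda>(a::'f::field) (c::'b \<Rightarrow> 'f) l. a * c l) = fun_dim"
  by (rule vector_space_fun) (simp add: fun_dim_def)

interpretation fsp: vector_space_pair
  "\<lambda>(a::'f::field) (c::'b \<Rightarrow> 'f) l. a * c l" "\<lambda>(a::'f::field) (c::'c \<Rightarrow> 'f) l. a * c l"
  rewrites "vector_space.dim (\<lambda>(a::'f::field) (c::'b \<Rightarrow> 'f) l. a * c l) = fun_dim"
     and "vector_space.dim (\<lambda>(a::'f::field) (c::'c \<Rightarrow> 'f) l. a * c l) = fun_dim"
     by (auto simp: vector_space_pair_def vector_space_fun fun_dim_def)

lemma sum_apply: "(\<Sum>q\<in>Q. f q) l = (\<Sum>q\<in>Q. f q l)"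
  by (induction Q rule: infinite_finite_induct) auto

lemma fun_subspaceI:
  assumes "(\<lambda>l. 0) \<in> S" "\<And>c d. c \<in> S \<Longrightarrow> d \<in> S \<Longrightarrow> (\<lambda>l. c l + d l) \<in> S"
    "\<And>a c. c \<in> S \<Longrightarrow> (\<lambda>l. a * c l) \<in> S"
  shows "fs.subspace S"
  unfolding fs.subspace_def using assms by (auto simp: zero_fun_def plus_fun_def)

definition supported_on :: "'b set \<Rightarrow> ('b \<Rightarrow> 'f::field) set" where
  "supported_on Q = {c. \<forall>l. l \<notin> Q \<longrightarrow> c l = 0}"

definition unit_fun :: "'b \<Rightarrow> 'b \<Rightarrow> 'f::field" where
  "unit_fun q = (\<lambda>l. if l = q then 1 else 0)"

lemma supported_on_subspace: "fs.subspace (supported_on Q)"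
  by (rule fun_subspaceI) (auto simp: supported_on_def)

lemma supported_on_span:
  assumes "finite Q"
  shows "(supported_on Q :: ('b \<Rightarrow> 'f::field) set) = fs.span (unit_fun ` Q)"
proof
  show "supported_on Q \<subseteq> (fs.span (unit_fun ` Q) :: ('b \<Rightarrow> 'f::field) set)"
  proof
    fix c :: "'b \<Rightarrow> 'f" assume c: "c \<in> supported_on Q"
    have "c = (\<Sum>q\<in>Q. (\<lambda>l. c q * unit_fun q l))"
    proof
      fix l
      have "(\<Sum>q\<in>Q. (\<lambda>l. c q * unit_fun q l)) l = (\<Sum>q\<in>Q. if q = l then c q else 0)"
        unfolding sum_apply by (rule sum.cong) (auto simp: unit_fun_def)
      also have "\<dots> = c l" using assms c by (auto simp: supported_on_def)
      finally show "c l = (\<Sum>q\<in>Q. (\<lambda>l. c q * unit_fun q l)) l" by simp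
    qed
    also have "\<dots> \<in> fs.span (unit_fun ` Q)"
      by (intro fs.span_sum fs.span_scale fs.span_base imageI)
    finally show "c \<in> fs.span (unit_fun ` Q)" .
  qed
  show "(fs.span (unit_fun ` Q) :: ('b \<Rightarrow> 'f::field) set) \<subseteq> supported_on Q"
    by (rule fs.span_minimal[OF _ supported_on_subspace]) (auto simp: supported_on_def unit_fun_def)
qed

lemma independent_unit_funs:
  assumes "finite Q"
  shows "fs.independent ((unit_fun :: 'b \<Rightarrow> 'b \<Rightarrow> 'f::field) ` Q)"
  using assms
proof (induction Q)
  case (insert q Q)
  have "unit_fun q \<notin> (supported_on Q :: ('b \<Rightarrow> 'f) set)"
    using insert by (auto simp: supported_on_def unit_fun_def)
  then show ?case
    using insert by (simp add: fs.independent_insertI supported_on_span)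
qed (simp add: fs.independent_empty)

lemma dim_supported_on:
  assumes "finite Q"
  shows "fun_dim (supported_on Q :: ('b \<Rightarrow> 'f::field) set) = card Q"
proof -
  have "inj_on (unit_fun :: 'b \<Rightarrow> 'b \<Rightarrow> 'f) Q"
    by (auto simp: inj_on_def unit_fun_def fun_eq_iff split: if_splits)
  then have "card ((unit_fun :: 'b \<Rightarrow> 'b \<Rightarrow> 'f) ` Q) = card Q" by (rule card_image)
  then show ?thesis
    unfolding supported_on_span[OF assms]
    using fs.dim_span_eq_card_independent[OF independent_unit_funs[OF assms]] by (rule trans[rotated])
qed

text \<open>
  Every chain space below consists of functions supported on one fixed finite set. This makes all
  the dimensions finite, although the ambient space of functions is not.
\<close>

lemma finite_if_independent:
  assumes "fs.independent B" "B \<subseteq> supported_on Q" "finite Q"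
  shows "finite B"
  using fs.independent_span_bound[OF finite_imageI[OF assms(3)] assms(1)]
    assms(2)[unfolded supported_on_span[OF assms(3)]] by blast

lemma fun_dim_mono:
  fixes S T :: "('b \<Rightarrow> 'f::field) set"
  assumes "S \<subseteq> T" "T \<subseteq> supported_on Q" "finite Q"
  shows "fun_dim S \<le> fun_dim T"
proof -
  obtain B where B: "B \<subseteq> T" "fs.independent B" "T \<subseteq> fs.span B" "card B = fun_dim T"
    by (rule fs.basis_exists)
  have "finite B"
    by (rule finite_if_independent[OF B(2) _ assms(3)]) (use B(1) assms(2) in blast)
  then have "fun_dim S \<le> card B" by (intro fs.dim_le_card) (use B(3) assms(1) in blast)
  then show ?thesis using B(4) by simp
qed

text \<open>
  Vanishing of a Betti number is a statement about dimensions; this turns it into an equality of the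
  spaces of cycles and boundaries.
\<close>

lemma fun_dim_subset_eq:
  fixes S T :: "('b \<Rightarrow> 'f::field) set"
  assumes "S \<subseteq> T" "fs.subspace S" "T \<subseteq> supported_on Q" "finite Q" "fun_dim T \<le> fun_dim S"
  shows "S = T"
proof (rule ccontr)
  assume "S \<noteq> T"
  then obtain x where x: "x \<in> T" "x \<notin> S" using assms(1) by blast
  obtain B where B: "B \<subseteq> S" "fs.independent B" "S \<subseteq> fs.span B" "card B = fun_dim S"
    by (rule fs.basis_exists)
  have finB: "finite B"
    by (rule finite_if_independent[OF B(2) _ assms(4)]) (use B(1) assms(1,3) in blast)
  have nin: "x \<notin> fs.span B" using fs.span_minimal[OF B(1) assms(2)] x(2) by blast
  then have i: "fs.independent (insert x B)" using B(2) by (rule fs.independent_insertI)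
  have "card (insert x B) = fun_dim (insert x B)" using i by (rule fs.dim_eq_card_independent[symmetric])
  also have "\<dots> \<le> fun_dim T" by (rule fun_dim_mono[OF _ assms(3,4)]) (use B(1) assms(1) x(1) in blast)
  finally have "card (insert x B) \<le> fun_dim T" .
  moreover have "x \<notin> B" using nin fs.span_base[of x B] by argo
  ultimately show False using finB B(4) assms(5) by simp
qed

lemma fun_rank_nullity:
  fixes f :: "('b \<Rightarrow> 'f::field) \<Rightarrow> ('c \<Rightarrow> 'f)"
  assumes "\<And>c d. f (\<lambda>l. c l + d l) = (\<lambda>l. f c l + f d l)"
    and "\<And>a c. f (\<lambda>l. a * c l) = (\<lambda>l. a * f c l)"
    and "fs.subspace S" "S \<subseteq> supported_on Q" "finite Q"
  shows "fun_dim S = fun_dim {c\<in>S. \<forall>l. f c l = 0} + fun_dim (f ` S)"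
proof -
  have lin: "Vector_Spaces.linear (\<lambda>a (c::'b \<Rightarrow> 'f) l. a * c l) (\<lambda>a (c::'c \<Rightarrow> 'f) l. a * c l) f"
    unfolding Vector_Spaces.linear_iff plus_fun_def
    by (intro conjI vector_space_fun allI assms(1,2))
  have span: "S \<subseteq> fs.span (unit_fun ` Q)"
    using assms(4) unfolding supported_on_span[OF assms(5)] .
  have "{c\<in>S. f c = 0} = {c\<in>S. \<forall>l. f c l = 0}"
    by (auto simp: fun_eq_iff)
  then show ?thesis
    using fsp.rank_nullity[OF lin assms(3) span finite_imageI[OF assms(5)]] by argo
qed

text \<open>
  Evaluation at the points of \<open>P\<close> is a linear map into a space of dimension \<open>card P\<close>, so imposing that
  the values there are zero costs at most \<open>card P\<close> dimensions. All upper bounds for spaces of cycles come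
  from this.
\<close>

lemma fun_dim_le_vanishing:
  fixes S :: "('b \<Rightarrow> 'f::field) set"
  assumes "fs.subspace S" "S \<subseteq> supported_on Q" "finite Q" "finite P"
  shows "fun_dim S \<le> fun_dim {c\<in>S. \<forall>l\<in>P. c l = 0} + card P"
proof -
  let ?f = "\<lambda>(c::'b \<Rightarrow> 'f) l. if l \<in> P then c l else 0"
  have add: "?f (\<lambda>l. c l + d l) = (\<lambda>l. ?f c l + ?f d l)" for c d
    by (rule ext) simp
  have scale: "?f (\<lambda>l. a * c l) = (\<lambda>l. a * ?f c l)" for a c
    by (rule ext) simp
  have "fun_dim S = fun_dim {c\<in>S. \<forall>l. ?f c l = 0} + fun_dim (?f ` S)"
    by (rule fun_rank_nullity[OF add scale assms(1-3)])
  also have "{c\<in>S. \<forall>l. ?f c l = 0} = {c\<in>S. \<forall>l\<in>P. c l = 0}" by auto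
  finally have "fun_dim S = fun_dim {c\<in>S. \<forall>l\<in>P. c l = 0} + fun_dim (?f ` S)" .
  moreover have "fun_dim (?f ` S) \<le> fun_dim (supported_on P :: ('b \<Rightarrow> 'f) set)"
    by (rule fun_dim_mono[OF _ order_refl assms(4)]) (auto simp: supported_on_def)
  ultimately show ?thesis unfolding dim_supported_on[OF assms(4)] by linarith
qed

section \<open>Oriented chains and the Euler-Poincare formula\<close>

text \<open>
  Neighbouring transpositions generate all permutations: the first entry of \<open>l\<close> is moved to the front of
  \<open>l'\<close> step by step.
\<close>

lemma swap_invariant_distinct:
  assumes "\<And>xs x y ys. f (xs @ x # y # ys) = f (xs @ y # x # ys)"
    and "distinct l" "distinct l'" "set l = set l'"
  shows "f l = f l'"
  using assms
proof (induction l arbitrary: f l')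
  case (Cons a l)
  obtain us vs where l': "l' = us @ a # vs"
    using Cons.prems(4) by (metis list.set_intros(1) split_list)
  have same: "set l = set (us @ vs)"
    using Cons.prems(2-4) unfolding l' by (auto simp: insert_eq_iff)
  have front: "f (us @ a # vs) = f (a # us @ vs)"
  proof (induction us arbitrary: vs rule: rev_induct)
    case (snoc u us)
    show ?case using Cons.prems(1)[of us u a vs] snoc[of "u # vs"] by simp
  qed simp
  have "f (a # l) = f (a # us @ vs)"
    by (rule Cons.IH[where f = "\<lambda>l. f (a # l)"])
      (use Cons.prems(1)[of "a # _"] Cons.prems(2,3) same in \<open>auto simp: l'\<close>)
  then show ?case using front l' by simp
qed simp

text \<open>
  The sign of a list relative to an enumeration \<open>h\<close> of the vertices, by counting inversions. Multiplying
  an alternating function on lists by it gives a function of the underlying set.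
\<close>

fun order_sign :: "('a \<Rightarrow> nat) \<Rightarrow> 'a list \<Rightarrow> 'f::field" where
  "order_sign h [] = 1"
| "order_sign h (x # xs) = (-1) ^ card {y \<in> set xs. h y < h x} * order_sign h xs"

lemma order_sign_swap:
  assumes "inj_on h (set (xs @ x # y # ys))" "distinct (xs @ x # y # ys)"
  shows "(order_sign h (xs @ x # y # ys) :: 'f::field) = - order_sign h (xs @ y # x # ys)"
  using assms
proof (induction xs)
  case Nil
  have ne: "h x \<noteq> h y" and d: "x \<noteq> y" "x \<notin> set ys" "y \<notin> set ys"
    using Nil by (auto simp: inj_on_def)
  have ins: "{z. (z = w \<or> z \<in> set ys) \<and> h z < k} =
      (if h w < k then insert w {z \<in> set ys. h z < k} else {z \<in> set ys. h z < k})" for w k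
    by auto
  show ?case using ne d by (auto simp: ins)
next
  case (Cons z xs)
  have "{w. (w = x \<or> w = y \<or> w \<in> set xs \<or> w \<in> set ys) \<and> h w < h z} =
      {w. (w = y \<or> w = x \<or> w \<in> set xs \<or> w \<in> set ys) \<and> h w < h z}" by auto
  then show ?case using Cons by (simp add: disj_ac)
qed

lemma order_sign_nonzero: "(order_sign h l :: 'f::field) \<noteq> 0"
  by (induction l) auto

definition faces :: "nat \<Rightarrow> 'a set set \<Rightarrow> 'a set set" where
  "faces i X = {\<alpha>\<in>X. card \<alpha> = Suc i}"

lemma face_num_eq_card_faces: "face_num (int i) X = card (faces i X)"
proof -
  have "int n - 1 = int i \<longleftrightarrow> n = Suc i" for n by linarith
  then show ?thesis by (simp add: face_num_def faces_def face_dim_def)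
qed

lemma simplicial_complexD:
  assumes "simplicial_complex X"
  shows "finite X" "{} \<in> X" "\<alpha> \<in> X \<Longrightarrow> finite \<alpha>" "\<alpha> \<in> X \<Longrightarrow> \<beta> \<subseteq> \<alpha> \<Longrightarrow> \<beta> \<in> X"
  using assms unfolding simplicial_complex_def by blast+

lemma finite_verts:
  assumes "simplicial_complex X" shows "finite (verts X)"
proof -
  have "(\<lambda>x. {x}) ` verts X \<subseteq> X" by (auto simp: verts_def)
  then have "finite ((\<lambda>x. {x}) ` verts X)"
    using simplicial_complexD(1)[OF assms] finite_subset by blast
  then show ?thesis by (rule finite_imageD) simp
qed

lemma face_subset_verts:
  assumes "simplicial_complex X" "\<alpha> \<in> X" shows "\<alpha> \<subseteq> verts X"
proof
  fix x assume "x \<in> \<alpha>"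
  then show "x \<in> verts X" using simplicial_complexD(4)[OF assms(1,2), of "{x}"] by (simp add: verts_def)
qed

lemma oriented_chainsD:
  assumes "c \<in> oriented_chains X i"
  shows "c l \<noteq> 0 \<Longrightarrow> distinct l" "c l \<noteq> 0 \<Longrightarrow> length l = Suc i" "c l \<noteq> 0 \<Longrightarrow> set l \<in> X"
    "c (xs @ x # y # ys) = - c (xs @ y # x # ys)"
  using assms unfolding oriented_chains_def by blast+

definition face_lists :: "'a set set \<Rightarrow> nat \<Rightarrow> 'a list set" where
  "face_lists X i = {l. distinct l \<and> length l = Suc i \<and> set l \<in> X}"

lemma finite_face_lists:
  assumes "simplicial_complex X" shows "finite (face_lists X i)"
  by (rule finite_subset[OF _ finite_lists_length_eq[OF finite_verts[OF assms], of "Suc i"]])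
    (use face_subset_verts[OF assms] in \<open>auto simp: face_lists_def\<close>)

lemma oriented_chains_supported: "oriented_chains X i \<subseteq> supported_on (face_lists X i)"
  by (auto simp: supported_on_def face_lists_def dest: oriented_chainsD)

lemma oriented_chains_subspace: "fs.subspace (oriented_chains X i :: ('a list \<Rightarrow> 'f::field) set)"
proof (rule fun_subspaceI)
  show "(\<lambda>l. 0) \<in> oriented_chains X i" by (simp add: oriented_chains_def)
next
  fix c d :: "'a list \<Rightarrow> 'f" assume c: "c \<in> oriented_chains X i" "d \<in> oriented_chains X i"
  have 1: "c l \<noteq> 0 \<or> d l \<noteq> 0" if "c l + d l \<noteq> 0" for l using that by auto
  show "(\<lambda>l. c l + d l) \<in> oriented_chains X i"
    unfolding oriented_chains_def mem_Collect_eq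
  proof (intro conjI allI)
    show "c l + d l \<noteq> 0 \<longrightarrow> distinct l \<and> length l = Suc i \<and> set l \<in> X" for l
      using 1[of l] oriented_chainsD(1-3)[OF c(1), of l] oriented_chainsD(1-3)[OF c(2), of l] by blast
    show "c (xs @ x # y # ys) + d (xs @ x # y # ys) = - (c (xs @ y # x # ys) + d (xs @ y # x # ys))"
      for xs x y ys
      unfolding oriented_chainsD(4)[OF c(1), of xs x y ys] oriented_chainsD(4)[OF c(2), of xs x y ys] by simp
  qed
next
  fix a :: 'f and c :: "'a list \<Rightarrow> 'f" assume c: "c \<in> oriented_chains X i"
  show "(\<lambda>l. a * c l) \<in> oriented_chains X i"
    unfolding oriented_chains_def mem_Collect_eq
  proof (intro conjI allI)
    show "a * c l \<noteq> 0 \<longrightarrow> distinct l \<and> length l = Suc i \<and> set l \<in> X" for l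
      using oriented_chainsD(1-3)[OF c, of l] by auto
    show "a * c (xs @ x # y # ys) = - (a * c (xs @ y # x # ys))" for xs x y ys
      unfolding oriented_chainsD(4)[OF c, of xs x y ys] by simp
  qed
qed

text \<open>
  The values of a chain on the orderings of one face differ only by signs.
\<close>

lemma oriented_chain_vanish:
  fixes c :: "'a list \<Rightarrow> 'f::field"
  assumes c: "c \<in> oriented_chains X i" and "distinct l" "distinct l'" "set l = set l'" "c l = 0"
  shows "c l' = 0"
proof -
  have neg: "a = - b \<Longrightarrow> (a = 0) = (b = 0)" for a b :: "'f" by auto
  have "(c (xs @ x # y # ys) = 0) = (c (xs @ y # x # ys) = 0)" for xs x y ys
    by (rule neg[OF oriented_chainsD(4)[OF c]])
  from swap_invariant_distinct[of "\<lambda>l. c l = 0", OF this assms(2-4)] assms(5)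
  show ?thesis by simp
qed

definition chain_of :: "('a \<Rightarrow> nat) \<Rightarrow> 'a set set \<Rightarrow> nat \<Rightarrow> ('a set \<Rightarrow> 'f::field) \<Rightarrow> 'a list \<Rightarrow> 'f" where
  "chain_of h X i \<phi> l = (if l \<in> face_lists X i then order_sign h l * \<phi> (set l) else 0)"

lemma chain_of_oriented:
  fixes X :: "'a set set" and \<phi> :: "'a set \<Rightarrow> 'f::field"
  assumes "simplicial_complex X" "inj_on h (verts X)"
  shows "chain_of h X i \<phi> \<in> oriented_chains X i"
  unfolding oriented_chains_def mem_Collect_eq
proof (intro conjI allI)
  show "chain_of h X i \<phi> l \<noteq> 0 \<longrightarrow> distinct l \<and> length l = Suc i \<and> set l \<in> X" for l
    by (auto simp: chain_of_def face_lists_def)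
  fix xs ys :: "'a list" and x y
  let ?l = "xs @ x # y # ys" and ?m = "xs @ y # x # ys"
  have set: "set ?l = set ?m" by auto
  have iff: "?l \<in> face_lists X i \<longleftrightarrow> ?m \<in> face_lists X i"
    unfolding face_lists_def mem_Collect_eq set by auto
  show "chain_of h X i \<phi> ?l = - chain_of h X i \<phi> ?m"
  proof (cases "?l \<in> face_lists X i")
    case True
    then have l: "distinct ?l" "set ?l \<in> X" by (simp_all only: face_lists_def mem_Collect_eq)
    have "inj_on h (set ?l)"
      by (rule inj_on_subset[OF assms(2) face_subset_verts[OF assms(1) l(2)]])
    then have "(order_sign h ?l :: 'f) = - order_sign h ?m" using l(1) by (rule order_sign_swap)
    then show ?thesis using True iff unfolding chain_of_def set by simp
  next
    case False
    then show ?thesis using iff unfolding chain_of_def by simp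
  qed
qed

lemma faces_finite: "simplicial_complex X \<Longrightarrow> finite (faces i X)"
  by (simp add: faces_def simplicial_complexD(1))

lemma fun_dim_zero: "fun_dim {(\<lambda>l. 0) :: 'b \<Rightarrow> 'f::field} = 0"
proof -
  have "fun_dim {(\<lambda>l. 0) :: 'b \<Rightarrow> 'f} \<le> card ({} :: ('b \<Rightarrow> 'f) set)"
    by (rule fs.dim_le_card) (auto simp: fs.span_zero[unfolded zero_fun_def])
  then show ?thesis by simp
qed

text \<open>
  A chain is determined by its value on one ordering of each face, which bounds the dimension from
  above; conversely \<open>order_sign\<close> turns any function on the \<open>i\<close>-faces into a chain with these values.
\<close>

theorem dim_oriented_chains:
  assumes X: "simplicial_complex X"
  shows "fun_dim (oriented_chains X i :: ('a list \<Rightarrow> 'f::field) set) = card (faces i X)"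
proof (rule antisym)
  define rl where "rl \<alpha> = (SOME l. distinct l \<and> set l = \<alpha>)" for \<alpha> :: "'a set"
  have rl: "distinct (rl \<alpha>) \<and> set (rl \<alpha>) = \<alpha>" if "\<alpha> \<in> X" for \<alpha>
    unfolding rl_def by (rule someI_ex) (use finite_distinct_list[of \<alpha>] simplicial_complexD(3)[OF X that] in blast)
  have rlF: "rl \<alpha> \<in> face_lists X i" if "\<alpha> \<in> faces i X" for \<alpha>
    using rl[of \<alpha>] that distinct_card[of "rl \<alpha>"] by (auto simp: face_lists_def faces_def)
  let ?C = "oriented_chains X i :: ('a list \<Rightarrow> 'f) set"
  have "{c \<in> ?C. \<forall>l\<in>rl ` faces i X. c l = 0} \<subseteq> {\<lambda>l. 0}"
  proof clarify
    fix c :: "'a list \<Rightarrow> 'f" assume c: "c \<in> ?C" "\<forall>l\<in>rl ` faces i X. c l = 0"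
    show "c = (\<lambda>l. 0)"
    proof
      fix l show "c l = 0"
      proof (cases "l \<in> face_lists X i")
        case True
        then have l: "distinct l" "set l \<in> faces i X" using distinct_card[of l]
          by (auto simp: face_lists_def faces_def)
        then show ?thesis using oriented_chain_vanish[OF c(1), of "rl (set l)" l] rl[of "set l"] c(2)
          by (auto simp: faces_def)
      next
        case False
        then show ?thesis using c(1) oriented_chains_supported by (auto simp: supported_on_def)
      qed
    qed
  qed
  then have "fun_dim {c \<in> ?C. \<forall>l\<in>rl ` faces i X. c l = 0} \<le> fun_dim {(\<lambda>l. 0) :: 'a list \<Rightarrow> 'f}"
    by (rule fun_dim_mono[of _ _ "{}"]) (auto simp: supported_on_def)
  then have "fun_dim {c \<in> ?C. \<forall>l\<in>rl ` faces i X. c l = 0} = 0"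
    by (simp add: fun_dim_zero)
  moreover have "fun_dim ?C \<le> fun_dim {c \<in> ?C. \<forall>l\<in>rl ` faces i X. c l = 0} + card (rl ` faces i X)"
    by (rule fun_dim_le_vanishing[OF oriented_chains_subspace oriented_chains_supported
          finite_face_lists[OF X] finite_imageI[OF faces_finite[OF X]]])
  moreover have "card (rl ` faces i X) \<le> card (faces i X)"
    by (rule card_image_le[OF faces_finite[OF X]])
  ultimately show "fun_dim ?C \<le> card (faces i X)" by linarith
  obtain h :: "'a \<Rightarrow> nat" where h: "inj_on h (verts X)"
    using finite_imp_inj_to_nat_seg[OF finite_verts[OF X]] by blast
  let ?S = "supported_on (faces i X) :: ('a set \<Rightarrow> 'f) set"
  have add: "chain_of h X i (\<lambda>l. c l + d l) = (\<lambda>l. chain_of h X i c l + chain_of h X i d l)"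
    and scale: "chain_of h X i (\<lambda>l. a * c l) = (\<lambda>l. a * chain_of h X i c l)"
    for c d :: "'a set \<Rightarrow> 'f" and a
    by (auto simp: chain_of_def fun_eq_iff algebra_simps)
  have "fun_dim ?S = fun_dim {c\<in>?S. \<forall>l. chain_of h X i c l = 0} + fun_dim (chain_of h X i ` ?S)"
    by (rule fun_rank_nullity[OF add scale supported_on_subspace order_refl faces_finite[OF X]])
  moreover have "{c\<in>?S. \<forall>l. chain_of h X i c l = 0} \<subseteq> {\<lambda>l. 0}"
  proof clarify
    fix c :: "'a set \<Rightarrow> 'f" assume c: "c \<in> ?S" "\<forall>l. chain_of h X i c l = 0"
    show "c = (\<lambda>l. 0)"
    proof
      fix \<alpha> show "c \<alpha> = 0"
      proof (cases "\<alpha> \<in> faces i X")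
        case True
        then have "chain_of h X i c (rl \<alpha>) = order_sign h (rl \<alpha>) * c \<alpha>"
          using rl[of \<alpha>] rlF by (auto simp: chain_of_def faces_def)
        then show ?thesis using c(2) order_sign_nonzero by (metis mult_eq_0_iff)
      qed (use c(1) in \<open>auto simp: supported_on_def\<close>)
    qed
  qed
  then have "fun_dim {c\<in>?S. \<forall>l. chain_of h X i c l = 0} \<le> fun_dim {(\<lambda>l. 0) :: 'a set \<Rightarrow> 'f}"
    by (rule fun_dim_mono[of _ _ "{}"]) (auto simp: supported_on_def)
  then have "fun_dim {c\<in>?S. \<forall>l. chain_of h X i c l = 0} = 0"
    by (simp add: fun_dim_zero)
  moreover have "fun_dim (chain_of h X i ` ?S) \<le> fun_dim ?C"
    by (rule fun_dim_mono[OF _ oriented_chains_supported finite_face_lists[OF X]])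
      (use chain_of_oriented[OF X h] in auto)
  moreover have "fun_dim ?S = card (faces i X)"
    by (rule dim_supported_on[OF faces_finite[OF X]])
  ultimately show "card (faces i X) \<le> fun_dim ?C" by linarith
qed

lemma bd_add: "bd X (\<lambda>l. c l + d l) = (\<lambda>l. bd X c l + bd X d l)"
  by (auto simp: bd_def sum.distrib)

lemma bd_scale: "bd X (\<lambda>l. a * c l) = (\<lambda>l. a * bd X c l)"
  by (auto simp: bd_def sum_distrib_left)

lemma bd_zero: "bd X (\<lambda>l. 0) = (\<lambda>l. 0)"
  by (auto simp: bd_def)

lemma cycles_subset: "cycles X i \<subseteq> oriented_chains X i"
  by (auto simp: cycles_def)

lemma cycles_subspace: "fs.subspace (cycles X i :: ('a list \<Rightarrow> 'f::field) set)"
proof -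
  have "(\<lambda>l. 0) \<in> (oriented_chains X i :: ('a list \<Rightarrow> 'f) set)"
    using fs.subspace_0[OF oriented_chains_subspace] by (simp add: zero_fun_def)
  moreover have "(\<lambda>l. c l + d l) \<in> oriented_chains X i"
    if "c \<in> oriented_chains X i" "d \<in> oriented_chains X i" for c d :: "'a list \<Rightarrow> 'f"
    using fs.subspace_add[OF oriented_chains_subspace that] by (simp add: plus_fun_def)
  moreover have "(\<lambda>l. a * c l) \<in> oriented_chains X i"
    if "c \<in> oriented_chains X i" for a and c :: "'a list \<Rightarrow> 'f"
    using fs.subspace_scale[OF oriented_chains_subspace that] .
  ultimately show ?thesis
    by (intro fun_subspaceI; unfold cycles_def mem_Collect_eq bd_add bd_scale bd_zero) simp_all
qed

lemma boundaries_subspace: "fs.subspace (boundaries X i :: ('a list \<Rightarrow> 'f::field) set)"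
proof -
  have "Vector_Spaces.linear (\<lambda>a (c::'a list \<Rightarrow> 'f) l. a * c l) (\<lambda>a (c::'a list \<Rightarrow> 'f) l. a * c l) (bd X)"
    unfolding Vector_Spaces.linear_iff plus_fun_def
    using bd_add[of X] bd_scale[of X] vector_space_fun by blast
  then show ?thesis unfolding boundaries_def
    by (rule fsp.linear_subspace_image[OF _ oriented_chains_subspace])
qed

lemma cycles_0: "cycles X 0 = (oriented_chains X 0 :: ('a list \<Rightarrow> 'f::field) set)"
proof -
  have "bd X c l = 0" if "c \<in> oriented_chains X 0" for c :: "'a list \<Rightarrow> 'f" and l
  proof -
    have "c (v # l) = 0" if "l \<noteq> []" for v
      using oriented_chainsD(2)[OF \<open>c \<in> oriented_chains X 0\<close>, of "v # l"] that by fastforce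
    then show ?thesis by (simp add: bd_def)
  qed
  then show ?thesis unfolding cycles_def by blast
qed

lemma cycles_supported: "cycles X i \<subseteq> supported_on (face_lists X i)"
  using cycles_subset oriented_chains_supported by blast

lemma dim_cycles_Suc:
  assumes "simplicial_complex X"
  shows "fun_dim (cycles X (Suc i) :: ('a list \<Rightarrow> 'f::field) set) +
         fun_dim (boundaries X i :: ('a list \<Rightarrow> 'f::field) set) = card (faces (Suc i) X)"
  using fun_rank_nullity[where f = "bd X :: ('a list \<Rightarrow> 'f) \<Rightarrow> _", OF bd_add bd_scale oriented_chains_subspace[of X "Suc i"] oriented_chains_supported
    finite_face_lists[OF assms]]
  unfolding cycles_def boundaries_def dim_oriented_chains[OF assms] by simp

lemma dim_cycles_0:
  assumes "simplicial_complex X"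
  shows "fun_dim (cycles X 0 :: ('a list \<Rightarrow> 'f::field) set) = card (faces 0 X)"
  unfolding cycles_0 dim_oriented_chains[OF assms] ..

lemma betti_plus_dim_boundaries:
  assumes "simplicial_complex X"
  shows "betti TYPE('f::field) i X + fun_dim (boundaries X i :: ('a list \<Rightarrow> 'f) set) =
    fun_dim (cycles X i :: ('a list \<Rightarrow> 'f) set)"
proof -
  have "fun_dim (boundaries X i :: ('a list \<Rightarrow> 'f) set) \<le> fun_dim (cycles X i :: ('a list \<Rightarrow> 'f) set)"
    by (rule fun_dim_mono[OF boundaries_subset_cycles[OF assms] cycles_supported finite_face_lists[OF assms]])
  then show ?thesis by (simp add: betti_def)
qed

text \<open>
  Rank-nullity for each boundary map expresses the number of \<open>i\<close>-faces as the \<open>i\<close>-th Betti number plus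
  the dimensions of the boundaries in degrees \<open>i\<close> and \<open>i - 1\<close>; the latter telescope.
\<close>

theorem Euler_Poincare:
  assumes X: "simplicial_complex X" and N: "faces (Suc N) X = {}"
  shows "(\<Sum>i\<le>N. (-1) ^ i * int (card (faces i X))) = (\<Sum>i\<le>N. (-1) ^ i * int (betti TYPE('f::field) i X))"
proof -
  let ?B = "\<lambda>i. int (fun_dim (boundaries X i :: ('a list \<Rightarrow> 'f) set))"
  have "(\<Sum>i\<le>N. (-1) ^ i * int (card (faces i X))) =
      (\<Sum>i\<le>N. (-1) ^ i * int (betti TYPE('f) i X)) + (-1) ^ N * ?B N" for N
  proof (induction N)
    case 0
    show ?case using betti_plus_dim_boundaries[OF X, of 0, where 'f = 'f]
      by (simp add: dim_cycles_0[OF X])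
  next
    case (Suc N)
    have "int (card (faces (Suc N) X)) = int (betti TYPE('f) (Suc N) X) + ?B (Suc N) + ?B N"
      using betti_plus_dim_boundaries[OF X, of "Suc N", where 'f = 'f] dim_cycles_Suc[OF X, of N, where 'f = 'f] by linarith
    then show ?case using Suc by (simp add: algebra_simps)
  qed
  moreover have "?B N = 0" using dim_cycles_Suc[OF X, of N, where 'f = 'f] N by simp
  ultimately show ?thesis by simp
qed

lemma betti_eq_0:
  assumes "simplicial_complex X" "faces i X = {}"
  shows "betti TYPE('f::field) i X = 0"
proof (cases i)
  case 0
  then show ?thesis using betti_plus_dim_boundaries[OF assms(1), of i, where 'f = 'f]
    dim_cycles_0[OF assms(1), where 'f = 'f] assms(2) by simp
next
  case (Suc j)
  then show ?thesis using betti_plus_dim_boundaries[OF assms(1), of i, where 'f = 'f]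
    dim_cycles_Suc[OF assms(1), of j, where 'f = 'f] assms(2) by simp
qed

section \<open>Connected components of graphs\<close>

definition reach :: "('a \<Rightarrow> 'a \<Rightarrow> bool) \<Rightarrow> 'a set \<Rightarrow> 'a \<Rightarrow> 'a \<Rightarrow> bool" where
  "reach E A = (\<lambda>x y. x \<in> A \<and> y \<in> A \<and> E x y)\<^sup>*\<^sup>*"

definition component :: "('a \<Rightarrow> 'a \<Rightarrow> bool) \<Rightarrow> 'a set \<Rightarrow> 'a \<Rightarrow> 'a set" where
  "component E A x = {y \<in> A. reach E A x y}"

definition ncomp :: "('a \<Rightarrow> 'a \<Rightarrow> bool) \<Rightarrow> 'a set \<Rightarrow> nat" where
  "ncomp E A = card (component E A ` A)"

lemma reach_refl [simp]: "reach E A x x"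
  by (simp add: reach_def)

lemma reach_trans: "reach E A x y \<Longrightarrow> reach E A y z \<Longrightarrow> reach E A x z"
  unfolding reach_def by (rule rtranclp_trans)

lemma reach_edge: "x \<in> A \<Longrightarrow> y \<in> A \<Longrightarrow> E x y \<Longrightarrow> reach E A x y"
  unfolding reach_def by (rule r_into_rtranclp) simp

lemma reach_induct [consumes 1, case_names refl step]:
  assumes "reach E A x y" "P x"
    "\<And>y z. reach E A x y \<Longrightarrow> P y \<Longrightarrow> y \<in> A \<Longrightarrow> z \<in> A \<Longrightarrow> E y z \<Longrightarrow> P z"
  shows "P y"
  using assms(1)[unfolded reach_def] assms(2)
  by (induction rule: rtranclp_induct) (use assms(3)[unfolded reach_def] in blast)+

lemma reach_sym:
  assumes "symp E" "reach E A x y" shows "reach E A y x"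
  using assms(2)
proof (induction rule: reach_induct)
  case (step y z)
  then show ?case using reach_edge[of z A y E] sympD[OF assms(1)] reach_trans by metis
qed simp

lemma reach_map:
  assumes "reach E A x y" "\<And>u v. u \<in> A \<Longrightarrow> v \<in> A \<Longrightarrow> E u v \<Longrightarrow> reach E' A' u v"
  shows "reach E' A' x y"
  using assms(1)
proof (induction rule: reach_induct)
  case (step y z)
  then show ?case using assms(2) reach_trans by metis
qed simp

lemma reach_closed:
  assumes "reach E A x y" "x \<in> W" "\<And>u v. u \<in> W \<Longrightarrow> u \<in> A \<Longrightarrow> v \<in> A \<Longrightarrow> E u v \<Longrightarrow> v \<in> W"
  shows "y \<in> W"
  using assms(1,2) by (induction rule: reach_induct) (use assms(3) in blast)+

lemma component_eq_iff:
  assumes "symp E" "x \<in> A" "y \<in> A"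
  shows "component E A x = component E A y \<longleftrightarrow> reach E A x y"
proof
  assume "component E A x = component E A y"
  moreover have "y \<in> component E A y" using assms(3) by (simp add: component_def)
  ultimately show "reach E A x y" unfolding component_def by blast
next
  assume r: "reach E A x y"
  have "reach E A x z \<longleftrightarrow> reach E A y z" for z
    using reach_trans[OF r] reach_trans[OF reach_sym[OF assms(1) r]] by blast
  then show "component E A x = component E A y" by (simp add: component_def)
qed

definition comp_image :: "('a \<Rightarrow> 'a \<Rightarrow> bool) \<Rightarrow> 'a set \<Rightarrow> 'a set \<Rightarrow> 'a set" where
  "comp_image E A K = (\<Union>u\<in>K. component E A u)"

lemma comp_image_comp:
  assumes "symp E2" "A1 \<subseteq> A2" "\<And>u v. u \<in> A1 \<Longrightarrow> v \<in> A1 \<Longrightarrow> E1 u v \<Longrightarrow> reach E2 A2 u v" "x \<in> A1"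
  shows "comp_image E2 A2 (component E1 A1 x) = component E2 A2 x"
proof
  show "component E2 A2 x \<subseteq> comp_image E2 A2 (component E1 A1 x)"
    using assms(4) by (auto simp: comp_image_def component_def)
  show "comp_image E2 A2 (component E1 A1 x) \<subseteq> component E2 A2 x"
    unfolding comp_image_def component_def using reach_map[OF _ assms(3)] reach_trans[of E2 A2] by blast
qed

text \<open>
  Inclusions that respect adjacency induce maps of components. Here all components of the larger graph
  are hit, except possibly the one of \<open>y0\<close>.
\<close>

lemma ncomp_le_Suc:
  assumes "finite A2" "symp E2" "A1 \<subseteq> A2" "y0 \<in> A2"
    and "\<And>u v. u \<in> A1 \<Longrightarrow> v \<in> A1 \<Longrightarrow> E1 u v \<Longrightarrow> reach E2 A2 u v"
    and "\<And>y. y \<in> A2 \<Longrightarrow> reach E2 A2 y y0 \<or> (\<exists>u\<in>A1. reach E2 A2 y u)"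
  shows "ncomp E2 A2 \<le> ncomp E1 A1 + 1"
proof -
  let ?C1 = "component E1 A1 ` A1" and ?C2 = "component E2 A2 ` A2"
  have fin: "finite ?C1" using assms(1,3) finite_subset by blast
  have "component E2 A2 y \<in> insert (component E2 A2 y0) (comp_image E2 A2 ` ?C1)" if y: "y \<in> A2" for y
  proof (cases "reach E2 A2 y y0")
    case True
    then show ?thesis using component_eq_iff[OF assms(2) y assms(4)] by simp
  next
    case False
    then obtain u where u: "u \<in> A1" "reach E2 A2 y u" using assms(6) y by blast
    then have "component E2 A2 y = component E2 A2 u" using component_eq_iff[OF assms(2) y] assms(3) by blast
    then show ?thesis using comp_image_comp[OF assms(2,3,5) u(1)] u(1) by blast
  qed
  then have "?C2 \<subseteq> insert (component E2 A2 y0) (comp_image E2 A2 ` ?C1)" by blast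
  then have "card ?C2 \<le> card (insert (component E2 A2 y0) (comp_image E2 A2 ` ?C1))"
    by (rule card_mono[rotated]) (use fin in simp)
  also have "\<dots> \<le> card (comp_image E2 A2 ` ?C1) + 1"
    using fin by (simp add: card_insert_if)
  also have "\<dots> \<le> card ?C1 + 1" using card_image_le[OF fin] by simp
  finally show ?thesis unfolding ncomp_def .
qed

lemma comps_eq_image:
  assumes "symp E2" "A1 \<subseteq> A2"
    and "\<And>u v. u \<in> A1 \<Longrightarrow> v \<in> A1 \<Longrightarrow> E1 u v \<Longrightarrow> reach E2 A2 u v"
    and "\<And>y. y \<in> A2 \<Longrightarrow> \<exists>u\<in>A1. reach E2 A2 y u"
  shows "component E2 A2 ` A2 = comp_image E2 A2 ` (component E1 A1 ` A1)"
proof -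
  have "component E2 A2 y \<in> component E2 A2 ` A1" if y: "y \<in> A2" for y
    using assms(4)[OF y] component_eq_iff[OF assms(1) y] assms(2) by blast
  then have "component E2 A2 ` A2 = component E2 A2 ` A1" using assms(2) by blast
  also have "\<dots> = (\<lambda>x. comp_image E2 A2 (component E1 A1 x)) ` A1"
    using comp_image_comp[OF assms(1-3)] by (intro image_cong) auto
  finally show ?thesis by (simp add: image_image)
qed

lemma ncomp_le:
  assumes "finite A2" "symp E2" "A1 \<subseteq> A2"
    and "\<And>u v. u \<in> A1 \<Longrightarrow> v \<in> A1 \<Longrightarrow> E1 u v \<Longrightarrow> reach E2 A2 u v"
    and "\<And>y. y \<in> A2 \<Longrightarrow> \<exists>u\<in>A1. reach E2 A2 y u"
  shows "ncomp E2 A2 \<le> ncomp E1 A1"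
proof -
  have "finite A1" using assms(1,3) by (rule rev_finite_subset)
  then have "card (comp_image E2 A2 ` component E1 A1 ` A1) \<le> card (component E1 A1 ` A1)"
    by (intro card_image_le finite_imageI)
  moreover have "component E2 A2 ` A2 = comp_image E2 A2 ` (component E1 A1 ` A1)"
    by (rule comps_eq_image[OF assms(2,3)]) (use assms(4,5) in blast)+
  ultimately show ?thesis unfolding ncomp_def by simp
qed

text \<open>
  If the induced map of components is onto and merges two of them, the number drops.
\<close>

lemma ncomp_less:
  assumes "finite A2" "symp E2" "symp E1" "A1 \<subseteq> A2"
    and "\<And>u v. u \<in> A1 \<Longrightarrow> v \<in> A1 \<Longrightarrow> E1 u v \<Longrightarrow> reach E2 A2 u v"
    and "\<And>y. y \<in> A2 \<Longrightarrow> \<exists>u\<in>A1. reach E2 A2 y u"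
    and "a \<in> A1" "b \<in> A1" "\<not> reach E1 A1 a b" "reach E2 A2 a b"
  shows "ncomp E2 A2 + 1 \<le> ncomp E1 A1"
proof -
  let ?C = "component E1 A1 ` A1"
  have fin: "finite ?C" using assms(1,4) finite_subset by blast
  have img: "comp_image E2 A2 (component E1 A1 x) = component E2 A2 x" if "x \<in> A1" for x
    by (rule comp_image_comp[OF assms(2,4) _ that]) (rule assms(5))
  have "component E1 A1 a \<noteq> component E1 A1 b" using component_eq_iff[OF assms(3,7,8)] assms(9) by blast
  moreover have "comp_image E2 A2 (component E1 A1 a) = comp_image E2 A2 (component E1 A1 b)"
    unfolding img[OF assms(7)] img[OF assms(8)]
    using component_eq_iff[OF assms(2), of a A2 b] assms(4,7,8,10) by blast
  ultimately have "\<not> inj_on (comp_image E2 A2) ?C"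
    using assms(7,8) unfolding inj_on_def by blast
  then have "card (comp_image E2 A2 ` ?C) < card ?C"
    using card_image_le[OF fin] eq_card_imp_inj_on[OF fin] nat_less_le by blast
  moreover have "component E2 A2 ` A2 = comp_image E2 A2 ` ?C"
    by (rule comps_eq_image[OF assms(2,4)]) (use assms(5,6) in blast)+
  ultimately show ?thesis by (simp add: ncomp_def)
qed

lemma ncomp_cong:
  assumes "\<And>u v. u \<in> A \<Longrightarrow> v \<in> A \<Longrightarrow> E u v \<longleftrightarrow> E' u v"
  shows "ncomp E A = ncomp E' A"
proof -
  have "reach E A = reach E' A" unfolding reach_def using assms by (intro arg_cong[of _ _ rtranclp] ext) blast
  then show ?thesis by (simp add: ncomp_def component_def[abs_def])
qed

text \<open>
  Joining \<open>u\<close> to \<open>v\<close> can only merge the component of \<open>u\<close> with that of \<open>v\<close>, so on the components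
  other than that of \<open>u\<close> the map to the components of the larger graph is injective.
\<close>

lemma reach_add_edge:
  assumes "reach (\<lambda>x y. E x y \<or> {x, y} = {u, v}) A x y" "symp E"
  shows "reach E A x y \<or> (reach E A x u \<or> reach E A x v) \<and> (reach E A y u \<or> reach E A y v)"
  using assms(1)
proof (induction rule: reach_induct)
  case (step y z)
  show ?case
  proof (cases "E y z")
    case True
    then have "reach E A y z" "reach E A z y"
      using step reach_edge[of y A z E] reach_sym[OF assms(2)] by blast+
    then show ?thesis using step.IH reach_trans[of E A x y z] reach_trans[of E A z y u]
        reach_trans[of E A z y v] by blast
  next
    case False
    then have "(y = u \<and> z = v) \<or> (y = v \<and> z = u)" using step.hyps(4) by (auto simp: doubleton_eq_iff)
    then show ?thesis using step.IH by auto
  qed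
qed simp

lemma ncomp_add_edge:
  assumes "finite A" "symp E" "u \<in> A"
  shows "ncomp E A \<le> ncomp (\<lambda>x y. E x y \<or> {x, y} = {u, v}) A + 1"
proof -
  let ?F = "\<lambda>x y. E x y \<or> {x, y} = {u, v}"
  have sF: "symp ?F" using assms(2) by (auto simp: symp_def insert_commute)
  let ?C = "component E A ` A - {component E A u}"
  have fin: "finite ?C" using assms(1) by blast
  have img: "comp_image ?F A (component E A x) = component ?F A x" if "x \<in> A" for x
    by (rule comp_image_comp[OF sF order_refl _ that]) (simp add: reach_edge)
  have "inj_on (comp_image ?F A) ?C"
  proof
    fix K L assume K: "K \<in> ?C" and L: "L \<in> ?C" and eq: "comp_image ?F A K = comp_image ?F A L"
    obtain x y where xy: "x \<in> A" "K = component E A x" "y \<in> A" "L = component E A y" using K L by blast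
    then have "reach ?F A x y" using eq img component_eq_iff[OF sF, of x A y] by simp
    from reach_add_edge[OF this assms(2)]
    have "reach E A x y \<or> (reach E A x v \<and> reach E A y v)"
      using K L xy component_eq_iff[OF assms(2) _ assms(3)] by blast
    then have "reach E A x y" using reach_sym[OF assms(2), of A y v] reach_trans[of E A x v y] by blast
    then show "K = L" using xy component_eq_iff[OF assms(2) xy(1,3)] by simp
  qed
  then have "card ?C = card (comp_image ?F A ` ?C)" by (simp add: card_image)
  also have "\<dots> \<le> card (component ?F A ` A)"
    by (rule card_mono) (use img assms(1) in auto)
  finally have "card ?C \<le> ncomp ?F A" unfolding ncomp_def .
  moreover have "ncomp E A = card ?C + 1"
    unfolding ncomp_def using card_Suc_Diff1[of "component E A ` A" "component E A u"] assms(1,3) by simp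
  ultimately show ?thesis by simp
qed

text \<open>
  Along a clique separator: a path that leaves \<open>A\<^sub>1\<close> returns through the clique, where it can be
  short-cut. So no components of \<open>A\<^sub>1\<close> get merged, none of \<open>A\<^sub>2\<close> either, and the two sides share
  exactly the component that contains the clique.
\<close>

lemma reach_glue:
  assumes clique: "\<And>u v. u \<in> A1 \<inter> A2 \<Longrightarrow> v \<in> A1 \<inter> A2 \<Longrightarrow> u \<noteq> v \<Longrightarrow> E u v"
    and sep: "\<And>u v. u \<in> A1 \<union> A2 \<Longrightarrow> v \<in> A1 \<union> A2 \<Longrightarrow> E u v \<Longrightarrow> u \<in> A1 \<and> v \<in> A1 \<or> u \<in> A2 \<and> v \<in> A2"
    and "reach E (A1 \<union> A2) x y" "x \<in> A1"
  shows "(y \<in> A1 \<and> reach E A1 x y) \<or> (\<exists>k\<in>A1 \<inter> A2. reach E A1 x k \<and> y \<in> A2 \<and> reach E A2 k y)"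
  using assms(3)
proof (induction rule: reach_induct)
  case refl
  then show ?case using assms(4) by simp
next
  case (step y z)
  have cl: "reach E A1 u v \<and> reach E A2 u v" if "u \<in> A1 \<inter> A2" "v \<in> A1 \<inter> A2" for u v
    using clique[OF that] reach_edge[of u A1 v E] reach_edge[of u A2 v E] that by (cases "u = v") auto
  from step.IH show ?case
  proof
    assume y: "y \<in> A1 \<and> reach E A1 x y"
    from sep[OF step.hyps(2-4)] show ?thesis
    proof
      assume "y \<in> A1 \<and> z \<in> A1"
      then show ?thesis using y reach_edge[of y A1 z E] step.hyps(4) reach_trans[of E A1 x y z] by blast
    next
      assume "y \<in> A2 \<and> z \<in> A2"
      then show ?thesis using y reach_edge[of y A2 z E] step.hyps(4) by blast
    qed
  next
    assume "\<exists>k\<in>A1 \<inter> A2. reach E A1 x k \<and> y \<in> A2 \<and> reach E A2 k y"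
    then obtain k where k: "k \<in> A1 \<inter> A2" "reach E A1 x k" "y \<in> A2" "reach E A2 k y" by blast
    from sep[OF step.hyps(2-4)] show ?thesis
    proof
      assume yz: "y \<in> A1 \<and> z \<in> A1"
      then have "reach E A1 k y" using cl[of k y] k by blast
      then have "reach E A1 x z" using reach_edge[of y A1 z E] yz step.hyps(4) k(2) reach_trans[of E A1 x k y] reach_trans[of E A1 x y z] by blast
      then show ?thesis using yz by blast
    next
      assume yz: "y \<in> A2 \<and> z \<in> A2"
      then have "reach E A2 k z" using reach_edge[of y A2 z E] step.hyps(4) k(4) reach_trans[of E A2 k y z] by blast
      then show ?thesis using yz k by blast
    qed
  qed
qed

lemma reach_glue_same:
  assumes "\<And>u v. u \<in> A1 \<inter> A2 \<Longrightarrow> v \<in> A1 \<inter> A2 \<Longrightarrow> u \<noteq> v \<Longrightarrow> E u v"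
    and "\<And>u v. u \<in> A1 \<union> A2 \<Longrightarrow> v \<in> A1 \<union> A2 \<Longrightarrow> E u v \<Longrightarrow> u \<in> A1 \<and> v \<in> A1 \<or> u \<in> A2 \<and> v \<in> A2"
    and "reach E (A1 \<union> A2) x y" "x \<in> A1" "y \<in> A1"
  shows "reach E A1 x y"
proof (cases "reach E A1 x y")
  case False
  have "(y \<in> A1 \<and> reach E A1 x y) \<or> (\<exists>k\<in>A1 \<inter> A2. reach E A1 x k \<and> y \<in> A2 \<and> reach E A2 k y)"
    by (rule reach_glue[OF _ _ assms(3,4)]) (use assms(1,2) in blast)+
  then obtain k where k: "k \<in> A1 \<inter> A2" "reach E A1 x k" "y \<in> A2" using False by blast
  then have "reach E A1 k y"
    using assms(1)[of k y] reach_edge[of k A1 y E] assms(5) by (cases "k = y") auto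
  then show ?thesis using k(2) reach_trans[of E A1 x k y] by blast
qed

theorem ncomp_glue:
  assumes fin: "finite A1" "finite A2" and sym: "symp E"
    and clique: "\<And>u v. u \<in> A1 \<inter> A2 \<Longrightarrow> v \<in> A1 \<inter> A2 \<Longrightarrow> u \<noteq> v \<Longrightarrow> E u v"
    and sep: "\<And>u v. u \<in> A1 \<union> A2 \<Longrightarrow> v \<in> A1 \<union> A2 \<Longrightarrow> E u v \<Longrightarrow> u \<in> A1 \<and> v \<in> A1 \<or> u \<in> A2 \<and> v \<in> A2"
  shows "ncomp E (A1 \<union> A2) + (if A1 \<inter> A2 = {} then 0 else 1) = ncomp E A1 + ncomp E A2"
proof -
  let ?A = "A1 \<union> A2"
  let ?c = "component E ?A"
  have card_part: "card (?c ` B) = ncomp E B"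
    if B: "B \<subseteq> ?A" and same: "\<And>x y. reach E ?A x y \<Longrightarrow> x \<in> B \<Longrightarrow> y \<in> B \<Longrightarrow> reach E B x y" for B
  proof -
    have img: "comp_image E ?A (component E B x) = ?c x" if "x \<in> B" for x
      by (rule comp_image_comp[OF sym B _ that]) (use B in \<open>auto intro!: reach_edge\<close>)
    have "inj_on (comp_image E ?A) (component E B ` B)"
    proof
      fix K L assume "K \<in> component E B ` B" "L \<in> component E B ` B" and eq: "comp_image E ?A K = comp_image E ?A L"
      then obtain x y where xy: "x \<in> B" "K = component E B x" "y \<in> B" "L = component E B y" by blast
      then have "reach E ?A x y" using eq img component_eq_iff[OF sym, of x ?A y] B by auto
      then show "K = L" using same xy component_eq_iff[OF sym xy(1,3)] by simp
    qed
    then have "card (comp_image E ?A ` (component E B ` B)) = ncomp E B"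
      unfolding ncomp_def by (rule card_image)
    moreover have "comp_image E ?A ` (component E B ` B) = ?c ` B" using img by (simp add: image_image)
    ultimately show ?thesis by simp
  qed
  have 1: "card (?c ` A1) = ncomp E A1"
  proof (rule card_part)
    fix x y assume "reach E ?A x y" "x \<in> A1" "y \<in> A1"
    then show "reach E A1 x y"
      by (intro reach_glue_same[of A1 A2 E x y]) (use clique sep in blast)+
  qed simp
  have 2: "card (?c ` A2) = ncomp E A2"
  proof (rule card_part)
    fix x y assume "reach E ?A x y" "x \<in> A2" "y \<in> A2"
    then show "reach E A2 x y"
      by (intro reach_glue_same[of A2 A1 E x y]) (use clique sep in \<open>simp_all add: Un_commute Int_commute, blast\<close>)
  qed simp
  have int: "card (?c ` A1 \<inter> ?c ` A2) = (if A1 \<inter> A2 = {} then 0 else 1)"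
  proof -
    have meet: "\<exists>k\<in>A1 \<inter> A2. K = ?c k" if "K \<in> ?c ` A1 \<inter> ?c ` A2" for K
    proof -
      from that obtain x y where xy: "x \<in> A1" "K = ?c x" "y \<in> A2" "K = ?c y" by blast
      then have r: "reach E ?A x y" using component_eq_iff[OF sym, of x ?A y] by auto
      have "\<exists>k\<in>A1 \<inter> A2. reach E A1 x k"
        using reach_glue[of A1 A2 E x y, OF _ _ r xy(1)] clique sep xy(3)
          clique[of y] by blast
      then obtain k where k: "k \<in> A1 \<inter> A2" "reach E A1 x k" by blast
      then have "reach E ?A x k" using reach_map[OF k(2), of E ?A] reach_edge[of _ ?A _ E] by blast
      then show ?thesis using k(1) xy component_eq_iff[OF sym, of x ?A k] by blast
    qed
    show ?thesis
    proof (cases "A1 \<inter> A2 = {}")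
      case True
      then have "?c ` A1 \<inter> ?c ` A2 = {}" using meet by blast
      then show ?thesis using True by simp
    next
      case False
      then obtain k where k: "k \<in> A1 \<inter> A2" by blast
      have same: "?c j = ?c k" if "j \<in> A1 \<inter> A2" for j
      proof (cases "j = k")
        case False
        then have "reach E ?A j k" using clique[OF that k] reach_edge[of j ?A k E] that k by blast
        then show ?thesis using component_eq_iff[OF sym, of j ?A k] that k by blast
      qed simp
      have "K = ?c k" if K: "K \<in> ?c ` A1 \<inter> ?c ` A2" for K
      proof -
        obtain j where "j \<in> A1 \<inter> A2" "K = ?c j" using meet[OF K] by blast
        then show ?thesis using same[of j] by argo
      qed
      then have "?c ` A1 \<inter> ?c ` A2 \<subseteq> {?c k}" by (intro subsetI) (simp only: singleton_iff)
      moreover have "{?c k} \<subseteq> ?c ` A1 \<inter> ?c ` A2"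
        by (intro subsetI IntI; drule singletonD; hypsubst; rule imageI) (use k in blast)+
      ultimately have "?c ` A1 \<inter> ?c ` A2 = {?c k}" by (rule equalityI)
      then have "card (?c ` A1 \<inter> ?c ` A2) = card {?c k}" by (rule arg_cong)
      then show ?thesis using False by simp
    qed
  qed
  have "card (?c ` A1) + card (?c ` A2) = card (?c ` A1 \<union> ?c ` A2) + card (?c ` A1 \<inter> ?c ` A2)"
    using fin by (intro card_Un_Int) auto
  then show ?thesis using 1 2 int by (simp add: ncomp_def image_Un)
qed

lemma ncomp_clique:
  assumes "symp E" "\<And>u v. u \<in> A \<Longrightarrow> v \<in> A \<Longrightarrow> u \<noteq> v \<Longrightarrow> E u v"
  shows "ncomp E A = (if A = {} then 0 else 1)"
proof (cases "A = {}")
  case False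
  then obtain a where a: "a \<in> A" by blast
  have "component E A x = component E A a" if "x \<in> A" for x
    using component_eq_iff[OF assms(1) that a] reach_edge[OF that a, of E] assms(2)[OF that a] by (cases "x = a") auto
  then have "component E A ` A = {component E A a}" using a by blast
  then show ?thesis using False by (simp add: ncomp_def)
qed (simp add: ncomp_def)

section \<open>Components and the zeroth Betti number\<close>

definition adj :: "'a set set \<Rightarrow> 'a \<Rightarrow> 'a \<Rightarrow> bool" where
  "adj T x y \<longleftrightarrow> x \<noteq> y \<and> (\<exists>t\<in>T. x \<in> t \<and> y \<in> t)"

lemma symp_adj: "symp (adj T)"
  by (auto simp: symp_def adj_def)

lemma face_lists_0: "face_lists X 0 = (\<lambda>v. [v]) ` verts X"
  by (auto simp: face_lists_def verts_def length_Suc_conv)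

lemma oriented_chains_0: "oriented_chains X 0 = (supported_on ((\<lambda>v. [v]) ` verts X) :: ('a list \<Rightarrow> 'f::field) set)"
proof
  show "oriented_chains X 0 \<subseteq> (supported_on ((\<lambda>v. [v]) ` verts X) :: ('a list \<Rightarrow> 'f) set)"
    using oriented_chains_supported[of X 0] by (simp add: face_lists_0)
  show "supported_on ((\<lambda>v. [v]) ` verts X) \<subseteq> (oriented_chains X 0 :: ('a list \<Rightarrow> 'f) set)"
  proof
    fix c :: "'a list \<Rightarrow> 'f" assume c: "c \<in> supported_on ((\<lambda>v. [v]) ` verts X)"
    have "c l \<noteq> 0 \<longrightarrow> distinct l \<and> length l = Suc 0 \<and> set l \<in> X" for l
    proof
      assume "c l \<noteq> 0"
      then have "l \<in> face_lists X 0" using c unfolding supported_on_def face_lists_0 by blast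
      then show "distinct l \<and> length l = Suc 0 \<and> set l \<in> X" by (simp add: face_lists_def)
    qed
    moreover have "c (xs @ x # y # ys) = 0" for xs x y ys
    proof -
      have "xs @ x # y # ys \<notin> (\<lambda>v. [v]) ` verts X" by (auto simp: append_eq_Cons_conv)
      then show ?thesis using c unfolding supported_on_def by blast
    qed
    ultimately show "c \<in> oriented_chains X 0" unfolding oriented_chains_def by simp
  qed
qed

text \<open>
  The alternating 1-chain of a single edge, with the sign convention of \<open>bd\<close>.
\<close>

lemma edge_boundary:
  assumes X: "simplicial_complex X" and uv: "u \<noteq> v" "{u, v} \<in> X"
  shows "(\<lambda>l. unit_fun [u] l - unit_fun [v] l) \<in> (boundaries X 0 :: ('a list \<Rightarrow> 'f::field) set)"
proof -
  define c :: "'a list \<Rightarrow> 'f" where "c l = (if l = [v, u] then 1 else if l = [u, v] then - 1 else 0)" for l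
  have V: "u \<in> verts X" "v \<in> verts X" using face_subset_verts[OF X uv(2)] by auto
  have "c \<in> oriented_chains X (Suc 0)"
    unfolding oriented_chains_def mem_Collect_eq
  proof (intro conjI allI)
    show "c l \<noteq> 0 \<longrightarrow> distinct l \<and> length l = Suc (Suc 0) \<and> set l \<in> X" for l
      using uv by (auto simp: c_def insert_commute)
    fix xs ys :: "'a list" and x y
    have "(xs @ x # y # ys = [p, q]) \<longleftrightarrow> xs = [] \<and> ys = [] \<and> x = p \<and> y = q" for p q x y
      by (cases xs) (auto simp: append_eq_Cons_conv)
    then show "c (xs @ x # y # ys) = - c (xs @ y # x # ys)"
      using uv(1) by (auto simp: c_def)
  qed
  moreover have "bd X c = (\<lambda>l. unit_fun [u] l - unit_fun [v] l)"
  proof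
    fix l
    have "(\<Sum>w\<in>verts X. c (w # l)) =
        (\<Sum>w\<in>verts X. (if w = v then if l = [u] then 1 else 0 else 0) - (if w = u then if l = [v] then 1 else 0 else 0))"
      using uv(1) by (intro sum.cong) (auto simp: c_def)
    also have "\<dots> = unit_fun [u] l - unit_fun [v] l"
      using V finite_verts[OF X] uv(1) by (simp add: sum_subtractf unit_fun_def)
    finally show "bd X c l = unit_fun [u] l - unit_fun [v] l"
      by (auto simp: bd_def unit_fun_def)
  qed
  ultimately show ?thesis unfolding boundaries_def by (metis imageI)
qed

lemma antisymmetric_sum_zero:
  fixes f :: "'a \<Rightarrow> 'a \<Rightarrow> 'f::field"
  assumes "finite K" "\<And>x. f x x = 0" "\<And>x y. f x y = - f y x"
  shows "(\<Sum>v\<in>K. \<Sum>w\<in>K. f w v) = 0"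
  using assms(1)
proof (induction K)
  case (insert x K)
  have "(\<Sum>v\<in>K. f x v) = - (\<Sum>v\<in>K. f v x)"
    unfolding sum_negf[symmetric] by (rule sum.cong[OF refl]) (rule assms(3))
  then show ?case using insert assms(2) by (simp add: sum.distrib)
qed simp

text \<open>
  Summing the coefficients over each component maps the 0-chains onto the functions on the set of
  components. The kernel consists of the boundaries: a chain \<open>c\<close> with zero sums is the combination of
  the differences \<open>[v] - [r]\<close> with coefficients \<open>c [v]\<close>, where \<open>r\<close> represents the component of \<open>v\<close>, and
  \<open>[v] - [r]\<close> bounds a path.
\<close>

theorem betti_0_eq_ncomp:
  assumes X: "simplicial_complex X"
  shows "betti TYPE('f::field) 0 X = ncomp (adj X) (verts X)"
proof -
  let ?V = "verts X" and ?E = "adj X"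
  let ?K = "component ?E ?V ` ?V"
  let ?C = "oriented_chains X 0 :: ('a list \<Rightarrow> 'f) set"
  let ?B = "boundaries X 0 :: ('a list \<Rightarrow> 'f) set"
  note finV = finite_verts[OF X]
  have edge: "{u, v} \<in> X \<longleftrightarrow> ?E u v" if "u \<noteq> v" for u v
    using that simplicial_complexD(4)[OF X, of _ "{u, v}"] by (auto simp: adj_def)
  have mem: "v \<in> component ?E ?V v" "component ?E ?V v \<in> ?K" "component ?E ?V v \<subseteq> ?V" if "v \<in> ?V" for v
    using that by (auto simp: component_def)
  have comp_unique: "v \<in> L \<longleftrightarrow> component ?E ?V v = L" if L: "L \<in> ?K" and v: "v \<in> ?V" for v L
  proof -
    obtain u where u: "u \<in> ?V" "L = component ?E ?V u" using L by blast
    have "v \<in> component ?E ?V u \<longleftrightarrow> component ?E ?V u = component ?E ?V v"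
      using component_eq_iff[OF symp_adj u(1) v] v by (simp add: component_def)
    then show ?thesis using u(2) by blast
  qed
  have K_sub: "L \<subseteq> ?V" if "L \<in> ?K" for L using that by (auto simp: component_def)
  define rep where "rep L = (SOME x. x \<in> L)" for L :: "'a set"
  have rep: "rep L \<in> L" if "L \<in> ?K" for L
    unfolding rep_def by (rule someI_ex) (use that mem in blast)
  define s :: "('a list \<Rightarrow> 'f) \<Rightarrow> 'a set \<Rightarrow> 'f" where
    "s c L = (if L \<in> ?K then \<Sum>v\<in>L. c [v] else 0)" for c L
  have add: "s (\<lambda>l. c l + d l) = (\<lambda>L. s c L + s d L)"
    and scale: "s (\<lambda>l. a * c l) = (\<lambda>L. a * s c L)" for c d a
    by (auto simp: s_def sum.distrib sum_distrib_left)
  have rn: "fun_dim ?C = fun_dim {c \<in> ?C. \<forall>L. s c L = 0} + fun_dim (s ` ?C)"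
    by (rule fun_rank_nullity[OF add scale oriented_chains_subspace oriented_chains_supported
          finite_face_lists[OF X]])
  have ker: "{c \<in> ?C. \<forall>L. s c L = 0} = ?B"
  proof
    show "{c \<in> ?C. \<forall>L. s c L = 0} \<subseteq> ?B"
    proof clarify
      fix c assume c: "c \<in> ?C" and s0: "\<forall>L. s c L = 0"
      let ?r = "\<lambda>v. rep (component ?E ?V v)"
      let ?d = "\<lambda>v l. (unit_fun [v] l - unit_fun [?r v] l) :: 'f"
      have step: "(\<lambda>l. unit_fun [x] l - unit_fun [y] l) \<in> ?B" if "reach ?E ?V x y" for x y
        using that
      proof (induction rule: reach_induct)
        case refl
        then show ?case using fs.subspace_0[OF boundaries_subspace, of X 0] by (simp add: zero_fun_def)
      next
        case (step y z)
        have "(\<lambda>l. unit_fun [y] l - unit_fun [z] l) \<in> ?B"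
          by (rule edge_boundary[OF X]) (use step.hyps edge in \<open>auto simp: adj_def\<close>)
        then have "(\<lambda>l. unit_fun [x] l - unit_fun [y] l) + (\<lambda>l. unit_fun [y] l - unit_fun [z] l) \<in> ?B"
          by (rule fs.subspace_add[OF boundaries_subspace step.IH])
        then show ?case by (simp add: plus_fun_def)
      qed
      have d: "?d v \<in> ?B" if "v \<in> ?V" for v
        using step[of v "?r v"] rep[OF mem(2)[OF that]] by (simp add: component_def)
      have "c = (\<Sum>v\<in>?V. (\<lambda>l. c [v] * ?d v l))"
      proof
        fix l
        have "(\<Sum>v\<in>?V. (\<lambda>l. c [v] * ?d v l)) l = (\<Sum>v\<in>?V. c [v] * unit_fun [v] l) - (\<Sum>v\<in>?V. c [v] * unit_fun [?r v] l)"
          by (simp add: sum_apply right_diff_distrib sum_subtractf)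
        moreover have "(\<Sum>v\<in>?V. c [v] * unit_fun [?r v] l) = 0"
        proof (cases "\<exists>L\<in>?K. l = [rep L]")
          case True
          then obtain L where L: "L \<in> ?K" "l = [rep L]" by blast
          have rL: "rep L = ?r v \<longleftrightarrow> v \<in> L" if v: "v \<in> ?V" for v
          proof
            assume "rep L = ?r v"
            then have "rep L \<in> component ?E ?V v" using rep[OF mem(2)[OF v]] by simp
            moreover have "rep L \<in> ?V" using rep[OF L(1)] K_sub[OF L(1)] by blast
            ultimately have "component ?E ?V v = L"
              using comp_unique[OF mem(2)[OF v], of "rep L"] comp_unique[OF L(1), of "rep L"] rep[OF L(1)] by simp
            then show "v \<in> L" using mem(1)[OF v] by simp
          qed (use comp_unique[OF L(1) v] in simp)
          then have "(\<Sum>v\<in>?V. c [v] * unit_fun [?r v] l) = (\<Sum>v\<in>?V. if v \<in> L then c [v] else 0)"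
            by (intro sum.cong[OF refl]) (simp add: unit_fun_def L(2) rL)
          also have "\<dots> = (\<Sum>v\<in>L. c [v])"
            using finV K_sub[OF L(1)] by (simp add: sum.inter_restrict[symmetric] Int_absorb1)
          also have "\<dots> = 0" using s0 L(1) by (auto simp: s_def dest: spec[of _ L])
          finally show ?thesis .
        next
          case False
          then show ?thesis using mem(2) by (intro sum.neutral) (auto simp: unit_fun_def)
        qed
        moreover have "(\<Sum>v\<in>?V. c [v] * unit_fun [v] l) = c l"
        proof (cases "\<exists>v\<in>?V. l = [v]")
          case True
          then obtain w where "w \<in> ?V" "l = [w]" by blast
          then have "(\<Sum>v\<in>?V. c [v] * unit_fun [v] l) = (\<Sum>v\<in>?V. if v = w then c [v] else 0)"
            by (intro sum.cong) (auto simp: unit_fun_def)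
          then show ?thesis using finV \<open>w \<in> ?V\<close> \<open>l = [w]\<close> by simp
        next
          case False
          then have "c l = 0" using c unfolding oriented_chains_0 by (auto simp: supported_on_def)
          moreover have "(\<Sum>v\<in>?V. c [v] * unit_fun [v] l) = 0"
            using False by (intro sum.neutral) (auto simp: unit_fun_def)
          ultimately show ?thesis by simp
        qed
        ultimately show "c l = (\<Sum>v\<in>?V. (\<lambda>l. c [v] * ?d v l)) l" by simp
      qed
      also have "\<dots> \<in> ?B"
        by (intro fs.subspace_sum[OF boundaries_subspace] fs.subspace_scale[OF boundaries_subspace] d)
      finally show "c \<in> ?B" .
    qed
    show "?B \<subseteq> {c \<in> ?C. \<forall>L. s c L = 0}"
    proof
      fix b assume "b \<in> ?B"
      then obtain c where b: "b = bd X c" and c: "c \<in> oriented_chains X (Suc 0)"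
        unfolding boundaries_def by blast
      have "s b L = 0" for L
      proof (cases "L \<in> ?K")
        case True
        have "(\<Sum>w\<in>?V. c [w, v]) = (\<Sum>w\<in>L. c [w, v])" if "v \<in> L" for v
        proof (rule sum.mono_neutral_right[OF finV K_sub[OF True]], clarify)
          fix w assume w: "w \<in> ?V" "w \<notin> L"
          show "c [w, v] = 0"
          proof (rule ccontr)
            assume "c [w, v] \<noteq> 0"
            from oriented_chainsD(1,3)[OF c this] have "?E v w" using edge[of v w] by (auto simp: insert_commute)
            moreover have v: "v \<in> ?V" using that K_sub[OF True] by blast
            ultimately have "component ?E ?V v = component ?E ?V w"
              using component_eq_iff[OF symp_adj v w(1)] reach_edge[of v ?V w ?E] w(1) by blast
            then show False using comp_unique[OF True] v w that by blast
          qed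
        qed
        then have "s b L = (\<Sum>v\<in>L. \<Sum>w\<in>L. c [w, v])"
          using True by (simp add: s_def b bd_def)
        also have "\<dots> = 0"
        proof (rule antisymmetric_sum_zero)
          show "finite L" using K_sub[OF True] finV finite_subset by blast
          show "c [x, x] = 0" for x using oriented_chainsD(1)[OF c, of "[x, x]"] by auto
          show "c [x, y] = - c [y, x]" for x y using oriented_chainsD(4)[OF c, of "[]" x y "[]"] by simp
        qed
        finally show ?thesis .
      qed (simp add: s_def)
      moreover have "b \<in> ?C" unfolding b by (rule bd_in_chains[OF X c])
      ultimately show "b \<in> {c \<in> ?C. \<forall>L. s c L = 0}" by blast
    qed
  qed
  have im: "s ` ?C = supported_on ?K"
  proof
    show "s ` ?C \<subseteq> supported_on ?K" by (auto simp: s_def supported_on_def)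
    show "supported_on ?K \<subseteq> s ` ?C"
    proof
      fix \<phi> :: "'a set \<Rightarrow> 'f" assume \<phi>: "\<phi> \<in> supported_on ?K"
      define c where "c l = (\<Sum>L\<in>?K. \<phi> L * unit_fun [rep L] l)" for l
      have "c \<in> ?C"
        unfolding oriented_chains_0 supported_on_def c_def
      proof clarify
        fix l assume l: "l \<notin> (\<lambda>v. [v]) ` ?V"
        have "unit_fun [rep L] l = (0::'f)" if "L \<in> ?K" for L
          using rep[OF that] K_sub[OF that] l by (auto simp: unit_fun_def)
        then show "(\<Sum>L\<in>?K. \<phi> L * unit_fun [rep L] l) = 0"
          by (intro sum.neutral) simp
      qed
      moreover have "s c = \<phi>"
      proof
        fix M show "s c M = \<phi> M"
        proof (cases "M \<in> ?K")
          case True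
          have fM: "finite M" using K_sub[OF True] finV finite_subset by blast
          have "s c M = (\<Sum>L\<in>?K. \<Sum>v\<in>M. \<phi> L * unit_fun [rep L] [v])"
            unfolding s_def c_def using True by (simp add: sum.swap[of _ M])
          also have "\<dots> = (\<Sum>L\<in>?K. if L = M then \<phi> L else 0)"
          proof (rule sum.cong[OF refl])
            fix L assume L: "L \<in> ?K"
            have "rep L \<in> M \<longleftrightarrow> L = M"
              using comp_unique[OF L, of "rep L"] comp_unique[OF True, of "rep L"] rep[OF L] K_sub[OF L] by blast
            moreover have "(\<Sum>v\<in>M. \<phi> L * unit_fun [rep L] [v]) = (\<Sum>v\<in>M. if v = rep L then \<phi> L else 0)"
              by (rule sum.cong) (auto simp: unit_fun_def)
            ultimately show "(\<Sum>v\<in>M. \<phi> L * unit_fun [rep L] [v]) = (if L = M then \<phi> L else 0)"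
              using fM by simp
          qed
          also have "\<dots> = \<phi> M" using True finV by simp
          finally show ?thesis .
        qed (use \<phi> in \<open>auto simp: s_def supported_on_def\<close>)
      qed
      ultimately show "\<phi> \<in> s ` ?C" by blast
    qed
  qed
  have "fun_dim (s ` ?C) = card ?K" unfolding im by (rule dim_supported_on) (use finV in simp)
  moreover have "betti TYPE('f) 0 X + fun_dim ?B = fun_dim ?C"
    using betti_plus_dim_boundaries[OF X, of 0, where 'f = 'f] unfolding cycles_0 .
  ultimately show ?thesis using rn unfolding ker ncomp_def by linarith
qed

section \<open>Averages over random vertex sets\<close>

text \<open>
  The mean of \<open>f\<close> over a random subset of \<open>V\<close> whose size is uniform on \<open>{0..card V}\<close> and which is uniform
  among the sets of its size. Equivalently, choose \<open>p\<close> uniformly in the unit interval and put each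
  element into the set independently with probability \<open>p\<close>.
\<close>

definition avg :: "'a set \<Rightarrow> ('a set \<Rightarrow> real) \<Rightarrow> real" where
  "avg V f = (\<Sum>A\<in>Pow V. f A / (real (card V + 1) * real (card V choose card A)))"

lemma binomial_reciprocal_sum:
  assumes "k \<le> n"
  shows "1 / (real (n + 2) * real (Suc n choose k)) + 1 / (real (n + 2) * real (Suc n choose Suc k)) =
    1 / (real (n + 1) * real (n choose k))"
proof -
  define C where "C = real (n choose k)"
  have C: "C > 0" using assms by (simp add: C_def)
  have 1: "real (Suc k) * real (Suc n choose Suc k) = real (Suc n) * C"
    unfolding C_def using Suc_times_binomial_eq[of n k] by (metis of_nat_mult mult.commute)
  have "(Suc n - k) * (Suc n choose k) = Suc n * (n choose k)"
    using binomial_absorb_comp[of "Suc n" k] by simp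
  then have 2: "real (Suc n - k) * real (Suc n choose k) = real (Suc n) * C"
    unfolding C_def by (metis of_nat_mult)
  have p: "real (Suc n choose k) > 0" "real (Suc n choose Suc k) > 0"
    using assms by (simp_all del: binomial_Suc_Suc)
  have nz: "real (Suc n) * C \<noteq> 0" "real (Suc n choose k) \<noteq> 0" "real (Suc n choose Suc k) \<noteq> 0"
    using C p by (simp_all del: binomial_Suc_Suc of_nat_Suc)
  have a: "1 / real (Suc n choose k) = real (Suc n - k) / (real (Suc n) * C)"
    unfolding frac_eq_eq[OF nz(2,1)] using 2 by (simp only: mult_1)
  have b: "1 / real (Suc n choose Suc k) = real (Suc k) / (real (Suc n) * C)"
    unfolding frac_eq_eq[OF nz(3,1)] using 1 by (simp only: mult_1)
  have "1 / real (Suc n choose k) + 1 / real (Suc n choose Suc k) = real (n + 2) / (real (Suc n) * C)"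
    unfolding a b add_divide_distrib[symmetric] using assms by (simp add: of_nat_diff)
  moreover have "p + q = m / d \<Longrightarrow> m \<noteq> 0 \<Longrightarrow> p / m + q / m = 1 / d" for p q m d :: real
    by (simp add: add_divide_distrib[symmetric])
  ultimately have "1 / real (Suc n choose k) / real (n + 2) + 1 / real (Suc n choose Suc k) / real (n + 2) =
      1 / (real (Suc n) * C)"
    by (metis add_2_eq_Suc' of_nat_0_eq_iff old.nat.distinct(2))
  then show ?thesis unfolding C_def divide_divide_eq_left by (simp only: mult.commute Suc_eq_plus1)
qed

lemma avg_insert:
  assumes "finite V" "x \<notin> V"
  shows "avg (insert x V) (\<lambda>A. f (A - {x})) = avg V f"
proof -
  let ?n = "card V"
  have *: "Pow (insert x V) = Pow V \<union> insert x ` Pow V" by (rule Pow_insert)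
  have inj: "inj_on (insert x) (Pow V)" using assms(2) by (auto simp: inj_on_def)
  have dis: "Pow V \<inter> insert x ` Pow V = {}" using assms(2) by auto
  let ?w = "\<lambda>n k. 1 / (real (n + 1) * real (n choose k))"
  have "avg (insert x V) (\<lambda>A. f (A - {x})) =
      (\<Sum>A\<in>Pow V. f (A - {x}) * ?w (Suc ?n) (card A)) + (\<Sum>A\<in>insert x ` Pow V. f (A - {x}) * ?w (Suc ?n) (card A))"
    unfolding avg_def * using assms dis by (subst sum.union_disjoint) auto
  also have "(\<Sum>A\<in>insert x ` Pow V. f (A - {x}) * ?w (Suc ?n) (card A)) = (\<Sum>A\<in>Pow V. f A * ?w (Suc ?n) (Suc (card A)))"
    unfolding sum.reindex[OF inj] o_def
  proof (rule sum.cong[OF refl])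
    fix A assume "A \<in> Pow V"
    then have "finite A" "x \<notin> A" using assms finite_subset by blast+
    then show "f (insert x A - {x}) * ?w (Suc ?n) (card (insert x A)) = f A * ?w (Suc ?n) (Suc (card A))" by simp
  qed
  also have "(\<Sum>A\<in>Pow V. f (A - {x}) * ?w (Suc ?n) (card A)) = (\<Sum>A\<in>Pow V. f A * ?w (Suc ?n) (card A))"
  proof (rule sum.cong[OF refl])
    fix A assume "A \<in> Pow V"
    then have "A - {x} = A" using assms(2) by blast
    then show "f (A - {x}) * ?w (Suc ?n) (card A) = f A * ?w (Suc ?n) (card A)" by simp
  qed
  also have "(\<Sum>A\<in>Pow V. f A * ?w (Suc ?n) (card A)) + (\<Sum>A\<in>Pow V. f A * ?w (Suc ?n) (Suc (card A))) =
      (\<Sum>A\<in>Pow V. f A * ?w ?n (card A))"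
    unfolding sum.distrib[symmetric] distrib_left[symmetric]
  proof (rule sum.cong[OF refl])
    fix A assume "A \<in> Pow V"
    then have "card A \<le> ?n" using assms(1) card_mono by blast
    from binomial_reciprocal_sum[OF this]
    show "f A * (?w (Suc ?n) (card A) + ?w (Suc ?n) (Suc (card A))) = f A * ?w ?n (card A)" by (simp add: add.commute)
  qed
  finally show ?thesis by (simp add: avg_def)
qed

text \<open>
  Evident from the description by independent choices with a common random probability: the
  restriction of such a random set to \<open>W\<close> is a random subset of \<open>W\<close> of the same kind. On the level of
  weights this is \<open>binomial_reciprocal_sum\<close>.
\<close>

lemma avg_restrict:
  assumes "finite V" "W \<subseteq> V"
  shows "avg V (\<lambda>A. f (A \<inter> W)) = avg W f"
proof -
  have "finite W" using assms finite_subset by blast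
  moreover have "finite D \<Longrightarrow> D \<inter> W = {} \<Longrightarrow> avg (W \<union> D) (\<lambda>A. f (A \<inter> W)) = avg W f" for D
  proof (induction D rule: finite_induct)
    case empty
    have "(\<Sum>A\<in>Pow W. f (A \<inter> W) / w A) = (\<Sum>A\<in>Pow W. f A / w A)" for w
      by (rule sum.cong) (auto simp: Int_absorb2)
    then show ?case by (simp add: avg_def)
  next
    case (insert x D)
    have eq: "(A - {x}) \<inter> W = A \<inter> W" for A using insert.prems by blast
    have "avg (insert x (W \<union> D)) (\<lambda>A. (\<lambda>A. f (A \<inter> W)) (A - {x})) = avg (W \<union> D) (\<lambda>A. f (A \<inter> W))"
      by (rule avg_insert) (use insert \<open>finite W\<close> in auto)
    then show ?case using insert eq by simp
  qed
  moreover have "W \<union> (V - W) = V" using assms(2) by blast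
  ultimately show ?thesis using assms(1) by (metis Diff_disjoint Int_commute finite_Diff)
qed

lemma avg_add: "avg V (\<lambda>A. f A + g A) = avg V f + avg V g"
  by (simp add: avg_def add_divide_distrib sum.distrib)

lemma avg_diff: "avg V (\<lambda>A. f A - g A) = avg V f - avg V g"
  by (simp add: avg_def diff_divide_distrib sum_subtractf)

lemma avg_cong: "(\<And>A. A \<subseteq> V \<Longrightarrow> f A = g A) \<Longrightarrow> avg V f = avg V g"
  unfolding avg_def by (intro sum.cong) auto

lemma avg_strict_mono:
  assumes "finite V" "\<And>A. A \<subseteq> V \<Longrightarrow> f A \<le> g A" "B \<subseteq> V" "f B < g B"
  shows "avg V f < avg V g"
  unfolding avg_def
proof (rule sum_strict_mono_ex1)
  show "\<forall>A\<in>Pow V. f A / (real (card V + 1) * real (card V choose card A)) \<le> g A / (real (card V + 1) * real (card V choose card A))"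
    using assms(2) by (auto intro!: divide_right_mono)
  have "(card V choose card B) > 0" using card_mono[OF assms(1,3)] by simp
  then show "\<exists>A\<in>Pow V. f A / (real (card V + 1) * real (card V choose card A)) < g A / (real (card V + 1) * real (card V choose card A))"
    using assms(3,4) by (intro bexI[of _ B] divide_strict_right_mono) auto
qed (use assms(1) in simp)

lemma avg_const: "finite V \<Longrightarrow> avg V (\<lambda>A. c) = c"
  using avg_restrict[of V "{}" "\<lambda>A. c"] by (simp add: avg_def)

lemma avg_indicator:
  assumes "finite V" "B \<subseteq> V"
  shows "avg V (\<lambda>A. if A = B then 1 else 0) = 1 / (real (card V + 1) * real (card V choose card B))"
proof -
  have "avg V (\<lambda>A. if A = B then 1 else 0) =
     (\<Sum>A\<in>Pow V. if A = B then 1 / (real (card V + 1) * real (card V choose card A)) else 0)"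
    unfolding avg_def by (rule sum.cong) auto
  then show ?thesis using assms by simp
qed

section \<open>Triangulated surfaces\<close>

text \<open>
  The triangles through \<open>\<alpha>\<close> lie all inside or all outside \<open>U\<close>. If every edge is in two triangles, then
  \<open>U\<close> is coherent at an edge iff this edge does not occur in the mod 2 boundary of \<open>U\<close>.
\<close>

definition coherent :: "'a set set \<Rightarrow> 'a set set \<Rightarrow> 'a set \<Rightarrow> bool" where
  "coherent T U \<alpha> \<longleftrightarrow> (\<forall>t\<in>T. \<alpha> \<subseteq> t \<longrightarrow> t \<in> U) \<or> (\<forall>t\<in>T. \<alpha> \<subseteq> t \<longrightarrow> t \<notin> U)"

text \<open>
  A surface is given by its triangles. The last two clauses are connectedness conditions: edges at \<open>x\<close>
  correspond to vertices of the link of \<open>x\<close>, so coherence at these edges forcing coherence at \<open>x\<close> says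
  that the link, a 2-regular graph, is one cycle; and coherence at all vertices forcing coherence at the
  empty set says that the surface is connected.
\<close>

definition closed_surface :: "'a set set \<Rightarrow> bool" where
  "closed_surface T \<longleftrightarrow> finite T \<and> T \<noteq> {} \<and> (\<forall>t\<in>T. card t = 3) \<and>
     (\<forall>x y. x \<noteq> y \<longrightarrow> card {t\<in>T. {x, y} \<subseteq> t} = 0 \<or> card {t\<in>T. {x, y} \<subseteq> t} = 2) \<and>
     (\<forall>U x. (\<forall>y. y \<noteq> x \<longrightarrow> coherent T U {x, y}) \<longrightarrow> coherent T U {x}) \<and>
     (\<forall>U. (\<forall>x. coherent T U {x}) \<longrightarrow> coherent T U {})"

text \<open>
  As each triangle has three edges and each edge is in two triangles, this is Euler characteristic 2.
\<close>

definition two_sphere :: "'a set set \<Rightarrow> bool" where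
  "two_sphere T \<longleftrightarrow> closed_surface T \<and> card T + 4 = 2 * card (\<Union>T)"

definition faces_of :: "'a set set \<Rightarrow> 'a set set" where
  "faces_of T = {\<alpha>. \<exists>t\<in>T. \<alpha> \<subseteq> t}"

lemma coherent_compl: "coherent T (- U) \<alpha> \<longleftrightarrow> coherent T U \<alpha>"
  by (auto simp: coherent_def)

lemma coherent_relative_compl: "coherent T (T - U) \<alpha> \<longleftrightarrow> coherent T U \<alpha>"
  by (auto simp: coherent_def)

lemma closed_surfaceD:
  assumes "closed_surface T"
  shows "finite T" "T \<noteq> {}" "t \<in> T \<Longrightarrow> card t = 3"
    "x \<noteq> y \<Longrightarrow> card {t\<in>T. {x, y} \<subseteq> t} = 0 \<or> card {t\<in>T. {x, y} \<subseteq> t} = 2"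
    "(\<And>y. y \<noteq> x \<Longrightarrow> coherent T U {x, y}) \<Longrightarrow> coherent T U {x}"
    "(\<And>x. coherent T U {x}) \<Longrightarrow> coherent T U {}"
  using assms unfolding closed_surface_def by meson+

lemma triangle_finite: "closed_surface T \<Longrightarrow> t \<in> T \<Longrightarrow> finite t"
  using closed_surfaceD(3) by (metis card.infinite zero_neq_numeral)

lemma all_or_none:
  assumes "closed_surface T" "\<And>x. coherent T U {x}"
  shows "T \<subseteq> U \<or> T \<inter> U = {}"
  using closed_surfaceD(6)[OF assms] unfolding coherent_def by blast

lemma surface_finite_verts: "closed_surface T \<Longrightarrow> finite (\<Union>T)"
  using closed_surfaceD(1) triangle_finite by blast

lemma edge_two_triangles:
  assumes T: "closed_surface T" and xy: "x \<noteq> y" "adj T x y"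
  obtains s t where "s \<noteq> t" "{r\<in>T. {x, y} \<subseteq> r} = {s, t}"
proof -
  have "{r\<in>T. {x, y} \<subseteq> r} \<noteq> {}" using xy by (auto simp: adj_def)
  moreover have "finite {r\<in>T. {x, y} \<subseteq> r}" using closed_surfaceD(1)[OF T] by simp
  ultimately have "card {r\<in>T. {x, y} \<subseteq> r} \<noteq> 0" by (simp only: card_0_eq not_False_eq_True)
  then have "card {r\<in>T. {x, y} \<subseteq> r} = 2"
    using closed_surfaceD(4)[OF T xy(1)] by argo
  then show thesis using that unfolding card_2_iff by blast
qed

lemma other_triangle:
  assumes T: "closed_surface T" and t: "t \<in> T" "{x, y} \<subseteq> t" "x \<noteq> y"
  obtains s where "s \<in> T" "{x, y} \<subseteq> s" "s \<noteq> t" "\<forall>r\<in>T. {x, y} \<subseteq> r \<longrightarrow> r = s \<or> r = t"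
proof -
  have "adj T x y" using t by (auto simp: adj_def)
  from edge_two_triangles[OF T t(3) this] obtain p q where
    pq: "p \<noteq> q" "{r\<in>T. {x, y} \<subseteq> r} = {p, q}" .
  have p: "p \<in> T" "{x, y} \<subseteq> p" and q: "q \<in> T" "{x, y} \<subseteq> q"
    using pq(2) by blast+
  have all: "r = p \<or> r = q" if "r \<in> T" "{x, y} \<subseteq> r" for r
    using that pq(2) by blast
  show thesis
  proof (cases "t = p")
    case True then show ?thesis using that[of q] pq(1) q all by blast
  next
    case False then show ?thesis using that[of p] pq(1) p all all[OF t(1,2)] by blast
  qed
qed

lemma two_triangles:
  assumes T: "closed_surface T" and "x \<noteq> y"
    and "s \<in> T" "{x, y} \<subseteq> s" "t \<in> T" "{x, y} \<subseteq> t" "s \<noteq> t" "r \<in> T" "{x, y} \<subseteq> r"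
  shows "r = s \<or> r = t"
proof -
  obtain s' where "s' \<in> T" "{x, y} \<subseteq> s'" "s' \<noteq> t"
    and s': "\<forall>r\<in>T. {x, y} \<subseteq> r \<longrightarrow> r = s' \<or> r = t"
    by (rule other_triangle[OF T assms(5,6,2)])
  from s'[rule_format, OF assms(3,4)] s'[rule_format, OF assms(8,9)] assms(7) show ?thesis by argo
qed

lemma triangle_third:
  assumes "card t = 3" "x \<in> t" "y \<in> t" "x \<noteq> y"
  obtains z where "t = {x, y, z}" "z \<noteq> x" "z \<noteq> y"
proof -
  obtain p q r where "t = {p, q, r}" "p \<noteq> q" "q \<noteq> r" "p \<noteq> r"
    using assms(1) by (auto simp: card_3_iff)
  then show thesis using that[of p] that[of q] that[of r] assms(2-4) by auto
qed

lemma faces_of_complex: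
  assumes "finite T" "T \<noteq> {}" "\<And>t. t \<in> T \<Longrightarrow> finite t"
  shows "simplicial_complex (faces_of T)"
proof -
  have "faces_of T = (\<Union>t\<in>T. Pow t)" by (auto simp: faces_of_def)
  then have "finite (faces_of T)" using assms by simp
  moreover have "{} \<in> faces_of T" using assms(2) by (auto simp: faces_of_def)
  moreover have "finite \<alpha> \<and> (\<forall>\<beta>. \<beta> \<subseteq> \<alpha> \<longrightarrow> \<beta> \<in> faces_of T)" if "\<alpha> \<in> faces_of T" for \<alpha>
  proof -
    have "\<exists>t\<in>T. \<alpha> \<subseteq> t" using that by (simp add: faces_of_def)
    then obtain t where "t \<in> T" "\<alpha> \<subseteq> t" by blast
    then show ?thesis using assms(3)[of t] finite_subset[of \<alpha> t] by (auto simp: faces_of_def)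
  qed
  ultimately show ?thesis unfolding simplicial_complex_def by blast
qed

lemma surface_complex: "closed_surface T \<Longrightarrow> simplicial_complex (faces_of T)"
  by (rule faces_of_complex[OF closed_surfaceD(1,2) triangle_finite])

lemma verts_faces_of: "verts (faces_of T) = \<Union>T"
  by (auto simp: verts_def faces_of_def)

lemma adj_faces_of: "adj (faces_of T) = adj T"
  by (auto simp: adj_def faces_of_def fun_eq_iff)

lemma card_faces_0: "card (faces 0 X) = card (verts X)"
proof -
  have "faces 0 X = (\<lambda>x. {x}) ` verts X"
    by (auto simp: faces_def verts_def card_1_singleton_iff)
  then show ?thesis by (simp add: card_image)
qed

lemma faces_2_faces_of:
  assumes "\<And>t. t \<in> T \<Longrightarrow> card t = 3" shows "faces 2 (faces_of T) = T"
proof -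
  have "\<alpha> = t" if "t \<in> T" "\<alpha> \<subseteq> t" "card \<alpha> = 3" for \<alpha> t
    using that assms[OF that(1)] by (metis card.infinite card_subset_eq zero_neq_numeral)
  then show ?thesis using assms by (auto simp: faces_def faces_of_def numeral_3_eq_3[symmetric])
qed

lemma faces_3_faces_of:
  assumes "\<And>t. t \<in> T \<Longrightarrow> card t = 3" shows "faces 3 (faces_of T) = {}"
proof -
  have False if "t \<in> T" "\<alpha> \<subseteq> t" "card \<alpha> = 4" for \<alpha> t
    using that assms[OF that(1)] card_mono[of t \<alpha>] by (cases "finite t") auto
  then show ?thesis by (auto simp: faces_def faces_of_def)
qed

lemma card_edges_in_triangle:
  assumes "card t = 3" shows "card {e. e \<subseteq> t \<and> card e = 2} = 3"
  using assms n_subsets[of t 2] by (cases "finite t") (auto simp: numeral_3_eq_3 numeral_2_eq_2)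

lemma double_count_edges:
  assumes T: "closed_surface T"
  shows "2 * card (faces 1 (faces_of T)) = 3 * card T"
proof -
  let ?E = "faces 1 (faces_of T)"
  have finE: "finite ?E" by (rule faces_finite[OF surface_complex[OF T]])
  have "(\<Sum>e\<in>?E. card {t\<in>T. e \<subseteq> t}) = (\<Sum>t\<in>T. card {e\<in>?E. e \<subseteq> t})"
    by (rule sum_multicount_gen) (use finE closed_surfaceD(1)[OF T] in auto)
  moreover have "card {t\<in>T. e \<subseteq> t} = 2" if "e \<in> ?E" for e
  proof -
    have "card e = 2" using that by (simp add: faces_def)
    then obtain x y where e: "e = {x, y}" "x \<noteq> y" unfolding card_2_iff by blast
    have "adj T x y" using that e by (auto simp: faces_def faces_of_def adj_def)
    from edge_two_triangles[OF T e(2) this] obtain s t where "s \<noteq> t" "{r\<in>T. {x, y} \<subseteq> r} = {s, t}" .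
    then show ?thesis unfolding e(1) by simp
  qed
  moreover have "card {e\<in>?E. e \<subseteq> t} = 3" if "t \<in> T" for t
  proof -
    have "{e\<in>?E. e \<subseteq> t} = {e. e \<subseteq> t \<and> card e = 2}" using that by (auto simp: faces_def faces_of_def)
    then show ?thesis using card_edges_in_triangle closed_surfaceD(3)[OF T that] by simp
  qed
  ultimately show ?thesis by (simp add: mult.commute)
qed

text \<open>
  If \<open>W\<close> is closed under adjacency, the triangles that meet \<open>W\<close> form a set that is coherent everywhere.
\<close>

lemma surface_connected:
  assumes T: "closed_surface T" and W: "w \<in> W" "w \<in> \<Union>T"
    and closed: "\<And>u v. u \<in> W \<Longrightarrow> adj T u v \<Longrightarrow> v \<in> W"
  shows "\<Union>T \<subseteq> W"
proof -
  let ?U = "{t\<in>T. t \<inter> W \<noteq> {}}"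
  have in_W: "t \<subseteq> W" if "t \<in> ?U" for t
  proof
    fix v assume v: "v \<in> t"
    obtain u where u: "u \<in> t" "u \<in> W" using \<open>t \<in> ?U\<close> by blast
    then show "v \<in> W" using closed[OF u(2), of v] v \<open>t \<in> ?U\<close> by (cases "u = v") (auto simp: adj_def)
  qed
  have "coherent T ?U {x}" for x
    using in_W unfolding coherent_def by blast
  then have "T \<subseteq> ?U \<or> T \<inter> ?U = {}" by (rule all_or_none[OF T])
  then show ?thesis using W in_W by blast
qed

lemma surface_ncomp:
  assumes T: "closed_surface T" shows "ncomp (adj T) (\<Union>T) = 1"
proof -
  obtain t where t: "t \<in> T" using closed_surfaceD(2)[OF T] by blast
  then have "t \<noteq> {}" using closed_surfaceD(3)[OF T t] by auto
  then obtain x where x: "x \<in> \<Union>T" using t by blast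
  have all: "reach (adj T) (\<Union>T) x y" if "y \<in> \<Union>T" for y
  proof -
    have "\<Union>T \<subseteq> {y\<in>\<Union>T. reach (adj T) (\<Union>T) x y}"
    proof (rule surface_connected[OF T, of x])
      fix u v assume u: "u \<in> {y\<in>\<Union>T. reach (adj T) (\<Union>T) x y}" and "adj T u v"
      moreover then have "v \<in> \<Union>T" by (auto simp: adj_def)
      ultimately show "v \<in> {y\<in>\<Union>T. reach (adj T) (\<Union>T) x y}"
        using reach_edge[of u "\<Union>T" v "adj T"] reach_trans[of "adj T" "\<Union>T" x u v] by blast
    qed (use x in auto)
    then show ?thesis using that by blast
  qed
  have "component (adj T) (\<Union>T) y = component (adj T) (\<Union>T) x" if "y \<in> \<Union>T" for y
    using component_eq_iff[OF symp_adj x that, of T] all[OF that] by simp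
  then have "component (adj T) (\<Union>T) ` (\<Union>T) = {component (adj T) (\<Union>T) x}" using x by blast
  then show ?thesis by (simp add: ncomp_def)
qed

lemma triangle_boundary:
  fixes c :: "'a list \<Rightarrow> 'f::field"
  assumes T: "closed_surface T" and c: "c \<in> oriented_chains (faces_of T) 2"
    and xy: "x \<noteq> y" and pq: "p \<noteq> q" "{r\<in>T. {x, y} \<subseteq> r} = {{x, y, p}, {x, y, q}}"
  shows "bd (faces_of T) c [x, y] = c [p, x, y] + c [q, x, y]"
proof -
  have V: "p \<in> \<Union>T" "q \<in> \<Union>T" using pq(2) by blast+
  have "(\<Sum>v\<in>\<Union>T. c [v, x, y]) = (\<Sum>v\<in>{p, q}. c [v, x, y])"
  proof (rule sum.mono_neutral_right)
    show "finite (\<Union>T)" by (rule surface_finite_verts[OF T])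
    show "\<forall>v\<in>\<Union>T - {p, q}. c [v, x, y] = 0"
    proof (rule ballI, rule ccontr)
      fix v assume "v \<in> \<Union>T - {p, q}" and v2: "c [v, x, y] \<noteq> 0"
      then have v: "v \<notin> {p, q}" "c [v, x, y] \<noteq> 0" by blast+
      from oriented_chainsD(1,3)[OF c v(2)] have d: "v \<noteq> x" "v \<noteq> y" and "{v, x, y} \<in> faces_of T" by auto
      then obtain t where t: "t \<in> T" "{v, x, y} \<subseteq> t" by (auto simp: faces_of_def)
      then have "t \<in> {{x, y, p}, {x, y, q}}" using pq(2) by blast
      then show False using t(2) d v(1) by blast
    qed
  qed (use V in auto)
  then show ?thesis using pq(1) by (simp add: bd_def verts_faces_of)
qed

lemma coherent_two:
  assumes "{r\<in>T. \<alpha> \<subseteq> r} = {s, t}"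
  shows "coherent T U \<alpha> \<longleftrightarrow> (s \<in> U \<longleftrightarrow> t \<in> U)"
proof -
  have "coherent T U \<alpha> \<longleftrightarrow> (\<forall>r\<in>{r\<in>T. \<alpha> \<subseteq> r}. r \<in> U) \<or> (\<forall>r\<in>{r\<in>T. \<alpha> \<subseteq> r}. r \<notin> U)"
    unfolding coherent_def by blast
  then show ?thesis unfolding assms by blast
qed

lemma coherentD:
  "coherent A V \<alpha> \<Longrightarrow> s \<in> A \<Longrightarrow> t \<in> A \<Longrightarrow> \<alpha> \<subseteq> s \<Longrightarrow> \<alpha> \<subseteq> t \<Longrightarrow> s \<in> V \<longleftrightarrow> t \<in> V"
  unfolding coherent_def by blast

lemma coherent_transfer:
  assumes "coherent A V \<alpha>" "\<And>r. r \<in> B \<Longrightarrow> \<alpha> \<subseteq> r \<Longrightarrow> \<exists>t\<in>A. \<alpha> \<subseteq> t \<and> (t \<in> V \<longleftrightarrow> r \<in> W)"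
  shows "coherent B W \<alpha>"
proof (cases "\<forall>t\<in>A. \<alpha> \<subseteq> t \<longrightarrow> t \<in> V")
  case True
  then show ?thesis using assms(2) unfolding coherent_def by blast
next
  case False
  then have "\<forall>t\<in>A. \<alpha> \<subseteq> t \<longrightarrow> t \<notin> V" using assms(1) unfolding coherent_def by blast
  then show ?thesis using assms(2) unfolding coherent_def by blast
qed

lemma edge_two_points:
  assumes T: "closed_surface T" and xy: "x \<noteq> y" "adj T x y"
  obtains p q where "p \<noteq> q" "{r\<in>T. {x, y} \<subseteq> r} = {{x, y, p}, {x, y, q}}" "p \<notin> {x, y}" "q \<notin> {x, y}"
proof -
  obtain s t where st: "s \<noteq> t" "{r\<in>T. {x, y} \<subseteq> r} = {s, t}" using edge_two_triangles[OF T xy] .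
  then have s: "s \<in> T" "{x, y} \<subseteq> s" and t: "t \<in> T" "{x, y} \<subseteq> t" by blast+
  obtain p where p: "s = {x, y, p}" "p \<noteq> x" "p \<noteq> y"
    using triangle_third[OF closed_surfaceD(3)[OF T s(1)]] s(2) xy(1) by blast
  obtain q where q: "t = {x, y, q}" "q \<noteq> x" "q \<noteq> y"
    using triangle_third[OF closed_surfaceD(3)[OF T t(1)]] t(2) xy(1) by blast
  show thesis using that[of p q] st p q by blast
qed

definition chain_support :: "('a list \<Rightarrow> 'f::field) \<Rightarrow> 'a set set" where
  "chain_support c = {t. \<exists>l. set l = t \<and> c l \<noteq> 0}"

lemma chain_support_iff:
  assumes "c \<in> oriented_chains X i" "distinct l"
  shows "set l \<in> chain_support c \<longleftrightarrow> c l \<noteq> 0"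
proof
  assume "set l \<in> chain_support c"
  then obtain m where m: "set m = set l" "c m \<noteq> 0" by (auto simp: chain_support_def)
  then show "c l \<noteq> 0"
    using oriented_chain_vanish[OF assms(1,2), of m] oriented_chainsD(1)[OF assms(1) m(2)] by auto
qed (auto simp: chain_support_def)

text \<open>
  The two triangles at an edge have coefficients that cancel, so the support of a 2-cycle is coherent
  at every edge, hence empty or everything. A 2-cycle that vanishes on one triangle is therefore zero.
\<close>

lemma dim_top_cycles_le_1:
  assumes T: "closed_surface T"
  shows "fun_dim (cycles (faces_of T) 2 :: ('a list \<Rightarrow> 'f::field) set) \<le> 1"
proof -
  let ?X = "faces_of T"
  let ?Z = "cycles ?X 2 :: ('a list \<Rightarrow> 'f::field) set"
  note X = surface_complex[OF T]
  obtain t0 where t0: "t0 \<in> T" using closed_surfaceD(2)[OF T] by blast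
  obtain l0 where l0: "distinct l0" "set l0 = t0"
    using finite_distinct_list[OF triangle_finite[OF T t0]] by blast
  have "{c\<in>?Z. \<forall>l\<in>{l0}. c l = 0} \<subseteq> {\<lambda>l. 0}"
  proof clarify
    fix c :: "'a list \<Rightarrow> 'f" assume c: "c \<in> ?Z" and c0: "\<forall>l\<in>{l0}. c l = 0"
    have co: "c \<in> oriented_chains ?X 2" using c cycles_subset by blast
    have "coherent T (chain_support c) {x, y}" if xy: "x \<noteq> y" for x y
    proof (cases "adj T x y")
      case True
      obtain p q where pq: "p \<noteq> q" "{r\<in>T. {x, y} \<subseteq> r} = {{x, y, p}, {x, y, q}}" "p \<notin> {x, y}" "q \<notin> {x, y}"
        using edge_two_points[OF T xy True] .
      have "c [p, x, y] + c [q, x, y] = 0"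
        using triangle_boundary[OF T co xy pq(1,2)] c by (simp add: cycles_def)
      then have "c [p, x, y] = 0 \<longleftrightarrow> c [q, x, y] = 0" by auto
      moreover have "{x, y, p} = set [p, x, y]" "{x, y, q} = set [q, x, y]" by auto
      ultimately have "{x, y, p} \<in> chain_support c \<longleftrightarrow> {x, y, q} \<in> chain_support c"
        using chain_support_iff[OF co, of "[p, x, y]"] chain_support_iff[OF co, of "[q, x, y]"] pq(3,4) xy by simp
      then show ?thesis unfolding coherent_two[OF pq(2)] .
    next
      case False
      then show ?thesis using xy by (auto simp: coherent_def adj_def)
    qed
    then have "T \<subseteq> chain_support c \<or> T \<inter> chain_support c = {}"
      by (intro all_or_none[OF T] closed_surfaceD(5)[OF T]) auto
    moreover have "t0 \<notin> chain_support c" using chain_support_iff[OF co l0(1)] l0(2) c0 by simp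
    ultimately have dis: "T \<inter> chain_support c = {}" using t0 by blast
    show "c = (\<lambda>l. 0)"
    proof
      fix l show "c l = 0"
      proof (rule ccontr)
        assume n: "c l \<noteq> 0"
        then have "set l \<in> faces 2 ?X"
          using oriented_chainsD(1-3)[OF co n] distinct_card[of l] by (simp add: faces_def)
        then have "set l \<in> T" using faces_2_faces_of[of T] closed_surfaceD(3)[OF T] by simp
        then show False using dis n by (auto simp: chain_support_def)
      qed
    qed
  qed
  then have "fun_dim {c\<in>?Z. \<forall>l\<in>{l0}. c l = 0} \<le> fun_dim {(\<lambda>l. 0) :: 'a list \<Rightarrow> 'f}"
    by (rule fun_dim_mono[of _ _ "{}"]) (auto simp: supported_on_def)
  then show ?thesis
    using fun_dim_le_vanishing[OF cycles_subspace cycles_supported finite_face_lists[OF X], of "{l0}" 2, where 'f = 'f]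
    by (simp add: fun_dim_zero)
qed

lemma surface_Euler:
  assumes T: "closed_surface T"
  shows "int (2 * card (\<Union>T)) = int (card T) + 2 + 2 * int (betti TYPE(bit) 2 (faces_of T)) - 2 * int (betti TYPE(bit) 1 (faces_of T))"
    and "betti TYPE(bit) 2 (faces_of T) \<le> 1"
proof -
  let ?X = "faces_of T"
  note X = surface_complex[OF T] and T3 = closed_surfaceD(3)[OF T]
  have "(\<Sum>i\<le>2. (-1) ^ i * int (card (faces i ?X))) = (\<Sum>i\<le>2. (-1) ^ i * int (betti TYPE(bit) i ?X))"
    by (rule Euler_Poincare[OF X]) (use faces_3_faces_of[of T] T3 in \<open>simp add: numeral_3_eq_3 numeral_2_eq_2\<close>)
  moreover have "betti TYPE(bit) 0 ?X = 1"
    using betti_0_eq_ncomp[OF X] surface_ncomp[OF T] by (simp add: verts_faces_of adj_faces_of)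
  moreover have "card (faces 0 ?X) = card (\<Union>T)" by (simp add: card_faces_0 verts_faces_of)
  moreover have "faces 2 ?X = T" using faces_2_faces_of T3 by blast
  moreover have "{..2::nat} = {0, 1, 2}" by auto
  ultimately show "int (2 * card (\<Union>T)) = int (card T) + 2 + 2 * int (betti TYPE(bit) 2 ?X) - 2 * int (betti TYPE(bit) 1 ?X)"
    using double_count_edges[OF T] by simp
  have "betti TYPE(bit) 2 ?X \<le> fun_dim (cycles ?X 2 :: ('a list \<Rightarrow> bit) set)"
    by (simp add: betti_def)
  also have "\<dots> \<le> 1" by (rule dim_top_cycles_le_1[OF T])
  finally show "betti TYPE(bit) 2 ?X \<le> 1" .
qed

text \<open>
  The Euler characteristic of a connected closed surface is \<open>1 - \<beta>\<^sub>1 + \<beta>\<^sub>2 \<le> 2\<close>.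
\<close>

lemma surface_Euler_le:
  assumes "closed_surface T" shows "2 * card (\<Union>T) \<le> card T + 4"
  using surface_Euler[OF assms] by linarith

text \<open>
  Characteristic 2 means \<open>\<beta>\<^sub>1 = \<beta>\<^sub>2 - 1 \<le> 0\<close>.
\<close>

lemma two_sphere_betti_1:
  assumes "two_sphere T" shows "betti TYPE(bit) 1 (faces_of T) = 0"
  using surface_Euler[of T] assms unfolding two_sphere_def by linarith

text \<open>
  The three edges form a 1-cycle mod 2. It is the boundary of a 2-chain as \<open>\<beta>\<^sub>1 = 0\<close>, and \<open>U\<close> is the
  support of this 2-chain: one side of the closed curve.
\<close>

theorem Jordan_triangle:
  assumes T: "two_sphere T" and abc: "a \<noteq> b" "b \<noteq> c" "c \<noteq> a" "adj T a b" "adj T b c" "adj T c a"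
  obtains U where "U \<subseteq> T" "\<And>x y. x \<noteq> y \<Longrightarrow> coherent T U {x, y} \<longleftrightarrow> \<not> {x, y} \<subseteq> {a, b, c}"
proof -
  let ?X = "faces_of T"
  have S: "closed_surface T" using T by (simp add: two_sphere_def)
  note X = surface_complex[OF S]
  define e :: "'a list \<Rightarrow> bit" where "e l = (if distinct l \<and> length l = 2 \<and> set l \<subseteq> {a, b, c} then 1 else 0)" for l
  have e2: "e [x, y] = (if x \<noteq> y \<and> {x, y} \<subseteq> {a, b, c} then 1 else 0)" for x y
    by (auto simp: e_def)
  have abcX: "{x, y} \<in> ?X" if "x \<noteq> y" "{x, y} \<subseteq> {a, b, c}" for x y
  proof -
    have "adj T x y" using that abc sympD[OF symp_adj, of T] by blast
    then show ?thesis by (auto simp: adj_def faces_of_def)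
  qed
  have eo: "e \<in> oriented_chains ?X 1"
    unfolding oriented_chains_def mem_Collect_eq
  proof (intro conjI allI impI)
    fix l assume "e l \<noteq> 0"
    then have l: "distinct l" "length l = 2" "set l \<subseteq> {a, b, c}" by (auto simp: e_def split: if_splits)
    then obtain x y where "l = [x, y]" by (auto simp: length_Suc_conv numeral_2_eq_2)
    then show "distinct l" "length l = Suc 1" "set l \<in> ?X" using l abcX[of x y] by auto
  next
    fix xs x y ys
    have "e (xs @ x # y # ys) = e (xs @ y # x # ys)" by (auto simp: e_def)
    then show "e (xs @ x # y # ys) = - e (xs @ y # x # ys)" by simp
  qed
  have "bd ?X e l = 0" for l
  proof (cases "\<exists>w. l = [w]")
    case True
    then obtain w where w: "l = [w]" by blast
    have V: "a \<in> \<Union>T" "b \<in> \<Union>T" "c \<in> \<Union>T" using abc by (auto simp: adj_def)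
    have "(\<Sum>v\<in>\<Union>T. e [v, w]) = (\<Sum>v\<in>{a, b, c}. e [v, w])"
      by (rule sum.mono_neutral_right) (use surface_finite_verts[OF S] V in \<open>auto simp: e2\<close>)
    also have "\<dots> = 0" using abc by (auto simp: e2)
    finally show ?thesis by (simp add: bd_def verts_faces_of w)
  next
    case False
    have "e (v # l) = 0" if "l \<noteq> []" for v using False that by (auto simp: e_def length_Suc_conv)
    then show ?thesis by (simp add: bd_def)
  qed
  then have "e \<in> cycles ?X 1" using eo by (simp add: cycles_def)
  moreover have "boundaries ?X 1 = (cycles ?X 1 :: ('a list \<Rightarrow> bit) set)"
  proof (rule fun_dim_subset_eq[OF boundaries_subset_cycles[OF X] boundaries_subspace cycles_supported finite_face_lists[OF X]])
    show "fun_dim (cycles ?X 1 :: ('a list \<Rightarrow> bit) set) \<le> fun_dim (boundaries ?X 1 :: ('a list \<Rightarrow> bit) set)"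
      using two_sphere_betti_1[OF T] unfolding betti_def by simp
  qed
  ultimately obtain z where z: "z \<in> oriented_chains ?X 2" "e = bd ?X z"
    unfolding boundaries_def numeral_2_eq_2 One_nat_def by (metis imageE)
  let ?U = "T \<inter> chain_support z"
  have "coherent T ?U {x, y} \<longleftrightarrow> \<not> {x, y} \<subseteq> {a, b, c}" if xy: "x \<noteq> y" for x y
  proof (cases "adj T x y")
    case True
    obtain p q where pq: "p \<noteq> q" "{r\<in>T. {x, y} \<subseteq> r} = {{x, y, p}, {x, y, q}}" "p \<notin> {x, y}" "q \<notin> {x, y}"
      using edge_two_points[OF S xy True] .
    have sum: "z [p, x, y] + z [q, x, y] = e [x, y]"
      using triangle_boundary[OF S z(1) xy pq(1,2)] z(2) by simp
    have "{x, y, p} = set [p, x, y]" "{x, y, q} = set [q, x, y]" by auto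
    then have P: "{x, y, p} \<in> chain_support z \<longleftrightarrow> z [p, x, y] = 1" and Q: "{x, y, q} \<in> chain_support z \<longleftrightarrow> z [q, x, y] = 1"
      using chain_support_iff[OF z(1), of "[p, x, y]"] chain_support_iff[OF z(1), of "[q, x, y]"] pq(3,4) xy by simp_all
    have "coherent T ?U {x, y} \<longleftrightarrow> ({x, y, p} \<in> chain_support z \<longleftrightarrow> {x, y, q} \<in> chain_support z)"
      using pq(2) unfolding coherent_two[OF pq(2)] by blast
    also have "\<dots> \<longleftrightarrow> e [x, y] = 0" unfolding P Q sum[symmetric]
      by (cases "z [p, x, y]"; cases "z [q, x, y]") auto
    also have "\<dots> \<longleftrightarrow> \<not> {x, y} \<subseteq> {a, b, c}" using xy by (simp add: e2)
    finally show ?thesis .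
  next
    case False
    then have "coherent T ?U {x, y}" using xy by (auto simp: coherent_def adj_def)
    moreover have "\<not> {x, y} \<subseteq> {a, b, c}" using False abc xy sympD[OF symp_adj, of T] by blast
    ultimately show ?thesis by blast
  qed
  then show thesis using that[of ?U] by blast
qed

lemma adjI: "t \<in> T \<Longrightarrow> u \<in> t \<Longrightarrow> v \<in> t \<Longrightarrow> u \<noteq> v \<Longrightarrow> adj T u v"
  by (auto simp: adj_def)

section \<open>Cutting a sphere along a triangle\<close>

text \<open>
  The curve \<open>t0\<close> bounds \<open>U\<close>, so adding the triangle \<open>t0\<close> to \<open>U\<close> closes it up.
\<close>

theorem cap_surface:
  assumes T: "closed_surface T" and t0: "card t0 = 3" "t0 \<notin> T"
    and U: "U \<subseteq> T" "\<And>x y. x \<noteq> y \<Longrightarrow> coherent T U {x, y} \<longleftrightarrow> \<not> {x, y} \<subseteq> t0"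
  shows "closed_surface (insert t0 U)"
proof -
  let ?T1 = "insert t0 U"
  have fin: "finite ?T1" using U(1) closed_surfaceD(1)[OF T] finite_subset by blast
  have other: "\<exists>y\<in>t0. y \<noteq> x" for x
  proof (rule ccontr)
    assume "\<not> (\<exists>y\<in>t0. y \<noteq> x)"
    then have "t0 \<subseteq> {x}" by blast
    then show False using card_mono[of "{x}" t0] t0(1) by simp
  qed
  have edge: "card {t\<in>?T1. {x, y} \<subseteq> t} = 0 \<or> card {t\<in>?T1. {x, y} \<subseteq> t} = 2" if xy: "x \<noteq> y" for x y
  proof (cases "adj T x y")
    case False
    then have "coherent T U {x, y}" using xy by (auto simp: coherent_def adj_def)
    then have "\<not> {x, y} \<subseteq> t0" using U(2)[OF xy] by blast
    moreover have "\<not> {x, y} \<subseteq> t" if "t \<in> U" for t using that U(1) False xy by (auto simp: adj_def)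
    ultimately have "{t\<in>?T1. {x, y} \<subseteq> t} = {}" by blast
    then have "card {t\<in>?T1. {x, y} \<subseteq> t} = 0" by (simp only: card.empty)
    then show ?thesis by argo
  next
    case True
    obtain s t where st: "s \<noteq> t" "{r\<in>T. {x, y} \<subseteq> r} = {s, t}" using edge_two_triangles[OF T xy True] .
    have iff: "(s \<in> U \<longleftrightarrow> t \<in> U) \<longleftrightarrow> \<not> {x, y} \<subseteq> t0"
      using U(2)[OF xy] unfolding coherent_two[OF st(2)] .
    have "{r\<in>?T1. {x, y} \<subseteq> r} = {r. (r \<in> U \<and> r \<in> {r\<in>T. {x, y} \<subseteq> r}) \<or> (r = t0 \<and> {x, y} \<subseteq> t0)}"
      using U(1) by blast
    also have "\<dots> = {r. (r \<in> U \<and> (r = s \<or> r = t)) \<or> (r = t0 \<and> {x, y} \<subseteq> t0)}"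
      unfolding st(2) by blast
    finally have eq: "{r\<in>?T1. {x, y} \<subseteq> r} = {r. (r \<in> U \<and> (r = s \<or> r = t)) \<or> (r = t0 \<and> {x, y} \<subseteq> t0)}" .
    consider "s \<in> U" "t \<in> U" "\<not> {x, y} \<subseteq> t0" | "s \<notin> U" "t \<notin> U" "\<not> {x, y} \<subseteq> t0"
      | "s \<in> U" "t \<notin> U" "{x, y} \<subseteq> t0" | "s \<notin> U" "t \<in> U" "{x, y} \<subseteq> t0"
      using iff by argo
    moreover have "s \<noteq> t0" "t \<noteq> t0" using st(2) t0(2) by blast+
    ultimately show ?thesis
    proof cases
      case 1
      then have "{r\<in>?T1. {x, y} \<subseteq> r} = {s, t}" unfolding eq by blast
      then have "card {r\<in>?T1. {x, y} \<subseteq> r} = card {s, t}" by (rule arg_cong)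
      then show ?thesis using st(1) by simp
    next
      case 2
      then have "{r\<in>?T1. {x, y} \<subseteq> r} = {}" unfolding eq by blast
      then have "card {r\<in>?T1. {x, y} \<subseteq> r} = 0" by (simp only: card.empty)
      then show ?thesis by argo
    next
      case 3
      then have "{r\<in>?T1. {x, y} \<subseteq> r} = {s, t0}" unfolding eq by blast
      then have "card {r\<in>?T1. {x, y} \<subseteq> r} = card {s, t0}" by (rule arg_cong)
      then show ?thesis using \<open>s \<noteq> t0\<close> by simp
    next
      case 4
      then have "{r\<in>?T1. {x, y} \<subseteq> r} = {t, t0}" unfolding eq by blast
      then have "card {r\<in>?T1. {x, y} \<subseteq> r} = card {t, t0}" by (rule arg_cong)
      then show ?thesis using \<open>t \<noteq> t0\<close> by simp
    qed
  qed
  (* Both sides of the coherence conditions are invariant under complementing W, so W may be taken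
     to avoid the cap t0; such a W is compared with W \<inter> U in the original surface. *)
  have sub: "coherent T (W \<inter> U) {x, y}"
    if W: "t0 \<notin> W" and xy: "x \<noteq> y" and c: "coherent ?T1 W {x, y}" for W x y
  proof (cases "{x, y} \<subseteq> t0")
    case True
    then have "\<forall>t\<in>?T1. {x, y} \<subseteq> t \<longrightarrow> t \<notin> W" using c W unfolding coherent_def by blast
    then show ?thesis unfolding coherent_def by blast
  next
    case False
    then have "coherent T U {x, y}" using U(2)[OF xy] by blast
    then show ?thesis using c U(1) unfolding coherent_def by blast
  qed
  have local0: "coherent ?T1 W {x}"
    if W: "t0 \<notin> W" and c: "\<And>y. y \<noteq> x \<Longrightarrow> coherent ?T1 W {x, y}" for W x
  proof -
    have "coherent T (W \<inter> U) {x}"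
      by (rule closed_surfaceD(5)[OF T]) (use sub[OF W] c in metis)
    then consider "\<forall>t\<in>T. x \<in> t \<longrightarrow> t \<in> W \<inter> U" | "\<forall>t\<in>T. x \<in> t \<longrightarrow> t \<notin> W \<inter> U"
      unfolding coherent_def by blast
    then show ?thesis
    proof cases
      case 1
      have "x \<notin> t0"
      proof
        assume x: "x \<in> t0"
        obtain y where y: "y \<in> t0" "y \<noteq> x" using other by blast
        have "coherent T U {x, y}" using 1 unfolding coherent_def by blast
        then show False using U(2)[of x y] x y by blast
      qed
      then show ?thesis using 1 U(1) unfolding coherent_def by blast
    next
      case 2
      then show ?thesis using W U(1) unfolding coherent_def by blast
    qed
  qed
  have global0: "coherent ?T1 W {}"
    if W: "t0 \<notin> W" and c: "\<And>x. coherent ?T1 W {x}" for W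
  proof -
    have "coherent T (W \<inter> U) {x}" for x
    proof (rule closed_surfaceD(5)[OF T])
      fix y assume "y \<noteq> x"
      moreover have "coherent ?T1 W {x, y}" using c[of x] unfolding coherent_def by blast
      ultimately show "coherent T (W \<inter> U) {x, y}" using sub[OF W, of x y] by blast
    qed
    then have "T \<subseteq> W \<inter> U \<or> T \<inter> (W \<inter> U) = {}" by (rule all_or_none[OF T])
    moreover have "\<not> T \<subseteq> U"
    proof
      assume TU: "T \<subseteq> U"
      obtain x where x: "x \<in> t0" using t0(1) by fastforce
      obtain y where y: "y \<in> t0" "y \<noteq> x" using other by blast
      have "coherent T U {x, y}" using TU unfolding coherent_def by blast
      then show False using U(2)[of x y] x y by blast
    qed
    ultimately have "T \<inter> (W \<inter> U) = {}" by blast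
    then show ?thesis using W U(1) unfolding coherent_def by blast
  qed
  have local: "coherent ?T1 W {x}" if c: "\<forall>y. y \<noteq> x \<longrightarrow> coherent ?T1 W {x, y}" for W x
  proof (cases "t0 \<in> W")
    case True
    have "coherent ?T1 (- W) {x}"
      by (rule local0) (use True c coherent_compl in blast)+
    then show ?thesis unfolding coherent_compl .
  qed (use local0 c in blast)
  have global: "coherent ?T1 W {}" if c: "\<forall>x. coherent ?T1 W {x}" for W
  proof (cases "t0 \<in> W")
    case True
    have "coherent ?T1 (- W) {}"
      by (rule global0) (use True c coherent_compl in blast)+
    then show ?thesis unfolding coherent_compl .
  qed (use global0 c in blast)
  have "\<forall>t\<in>?T1. card t = 3" using U(1) t0(1) closed_surfaceD(3)[OF T] by blast
  then show ?thesis unfolding closed_surface_def using fin edge local global by blast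
qed

text \<open>
  The Euler characteristics of the two capped sides add up to 4 and neither exceeds 2. So both
  sides are spheres.
\<close>

theorem split_sphere:
  assumes T: "two_sphere T" and t0: "card t0 = 3" "t0 \<notin> T"
    and U0: "U \<subseteq> T" "\<forall>x y. x \<noteq> y \<longrightarrow> coherent T U {x, y} \<longleftrightarrow> \<not> {x, y} \<subseteq> t0"
  defines "T1 \<equiv> insert t0 U" and "T2 \<equiv> insert t0 (T - U)"
  shows "two_sphere T1" "two_sphere T2" "\<Union>T1 \<inter> \<Union>T2 = t0" "\<Union>T1 \<union> \<Union>T2 = \<Union>T"
    "\<And>x. x \<notin> t0 \<Longrightarrow> x \<in> \<Union>T1 \<Longrightarrow> {t\<in>T1. x \<in> t} = {t\<in>T. x \<in> t}"
    "\<And>x. x \<notin> t0 \<Longrightarrow> x \<in> \<Union>T2 \<Longrightarrow> {t\<in>T2. x \<in> t} = {t\<in>T. x \<in> t}"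
    "\<And>x y. x \<in> \<Union>T1 \<Longrightarrow> y \<in> \<Union>T1 \<Longrightarrow> adj T x y \<longleftrightarrow> adj T1 x y"
    "\<And>x y. x \<in> \<Union>T2 \<Longrightarrow> y \<in> \<Union>T2 \<Longrightarrow> adj T x y \<longleftrightarrow> adj T2 x y"
    "\<And>x y. adj T x y \<Longrightarrow> x \<in> \<Union>T1 \<and> y \<in> \<Union>T1 \<or> x \<in> \<Union>T2 \<and> y \<in> \<Union>T2"
    "\<And>x y. x \<in> t0 \<Longrightarrow> y \<in> t0 \<Longrightarrow> x \<noteq> y \<Longrightarrow> adj T x y"
proof -
  note U = U0(1) U0(2)[rule_format]
  have S: "closed_surface T" and Eu: "card T + 4 = 2 * card (\<Union>T)" using T by (auto simp: two_sphere_def)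
  have S1: "closed_surface T1" unfolding T1_def by (rule cap_surface[OF S t0 U])
  have S2: "closed_surface T2" unfolding T2_def
  proof (rule cap_surface[OF S t0])
    show "coherent T (T - U) {x, y} \<longleftrightarrow> \<not> {x, y} \<subseteq> t0" if "x \<noteq> y" for x y
      unfolding coherent_relative_compl by (rule U(2)[OF that])
  qed blast
  have adj0: "adj T x y" if "x \<in> t0" "y \<in> t0" "x \<noteq> y" for x y
  proof (rule ccontr)
    assume "\<not> adj T x y"
    then have "coherent T U {x, y}" using that(3) by (auto simp: coherent_def adj_def)
    then show False using U(2)[OF that(3)] that(1,2) by simp
  qed
  have star: "(\<forall>t\<in>T. x \<in> t \<longrightarrow> t \<in> U) \<or> (\<forall>t\<in>T. x \<in> t \<longrightarrow> t \<notin> U)" if "x \<notin> t0" for x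
  proof -
    have "coherent T U {x}"
    proof (rule closed_surfaceD(5)[OF S])
      fix y assume "y \<noteq> x"
      then show "coherent T U {x, y}" using U(2)[of x y] that by simp
    qed
    then show ?thesis unfolding coherent_def by blast
  qed
  have t0V: "t0 \<subseteq> \<Union>T"
  proof
    fix x assume x: "x \<in> t0"
    have "\<not> t0 \<subseteq> {x}" using card_mono[of "{x}" t0] t0(1) by auto
    then obtain y where "y \<in> t0" "y \<noteq> x" by blast
    then show "x \<in> \<Union>T" using adj0[OF x, of y] by (auto simp: adj_def)
  qed
  show int: "\<Union>T1 \<inter> \<Union>T2 = t0"
  proof
    show "\<Union>T1 \<inter> \<Union>T2 \<subseteq> t0"
    proof
      fix x assume x: "x \<in> \<Union>T1 \<inter> \<Union>T2"
      show "x \<in> t0"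
      proof (rule ccontr)
        assume n: "x \<notin> t0"
        then obtain s t where "s \<in> U" "x \<in> s" "t \<in> T" "t \<notin> U" "x \<in> t" using x by (auto simp: T1_def T2_def)
        then show False using star[OF n] U(1) by blast
      qed
    qed
  qed (auto simp: T1_def T2_def)
  show un: "\<Union>T1 \<union> \<Union>T2 = \<Union>T" using t0V U(1) by (auto simp: T1_def T2_def)
  show "{t\<in>T1. x \<in> t} = {t\<in>T. x \<in> t}" if "x \<notin> t0" "x \<in> \<Union>T1" for x
  proof -
    obtain t where "t \<in> U" "x \<in> t" using \<open>x \<in> \<Union>T1\<close> \<open>x \<notin> t0\<close> unfolding T1_def by blast
    then show ?thesis using star[OF that(1)] that(1) U(1) unfolding T1_def by blast
  qed
  show "{t\<in>T2. x \<in> t} = {t\<in>T. x \<in> t}" if "x \<notin> t0" "x \<in> \<Union>T2" for x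
  proof -
    obtain t where "t \<in> T - U" "x \<in> t" using \<open>x \<in> \<Union>T2\<close> \<open>x \<notin> t0\<close> unfolding T2_def by blast
    then show ?thesis using star[OF that(1)] that(1) U(1) unfolding T2_def by blast
  qed
  show "adj T x y \<longleftrightarrow> adj T1 x y" if xy: "x \<in> \<Union>T1" "y \<in> \<Union>T1" for x y
  proof
    assume a: "adj T x y"
    then obtain t where t: "t \<in> T" "x \<in> t" "y \<in> t" and ne: "x \<noteq> y" by (auto simp: adj_def)
    show "adj T1 x y"
    proof (cases "t \<in> U")
      case False
      then have "t \<in> T2" using t by (simp add: T2_def)
      then have "x \<in> t0" "y \<in> t0" using t xy int by blast+
      then show ?thesis using ne by (auto simp: adj_def T1_def)
    qed (use t ne in \<open>auto simp: adj_def T1_def\<close>)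
  next
    assume "adj T1 x y"
    then show "adj T x y" using adj0[of x y] U(1) by (auto simp: adj_def T1_def)
  qed
  show "adj T x y \<longleftrightarrow> adj T2 x y" if xy: "x \<in> \<Union>T2" "y \<in> \<Union>T2" for x y
  proof
    assume a: "adj T x y"
    then obtain t where t: "t \<in> T" "x \<in> t" "y \<in> t" and ne: "x \<noteq> y" by (auto simp: adj_def)
    show "adj T2 x y"
    proof (cases "t \<in> U")
      case True
      then have "t \<in> T1" using t by (simp add: T1_def)
      then have "x \<in> t0" "y \<in> t0" using t xy int by blast+
      then show ?thesis using ne by (auto simp: adj_def T2_def)
    qed (use t ne in \<open>auto simp: adj_def T2_def\<close>)
  next
    assume "adj T2 x y"
    then show "adj T x y" using adj0[of x y] by (auto simp: adj_def T2_def)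
  qed
  show "x \<in> \<Union>T1 \<and> y \<in> \<Union>T1 \<or> x \<in> \<Union>T2 \<and> y \<in> \<Union>T2" if "adj T x y" for x y
    using that by (auto simp: adj_def T1_def T2_def)
  show "x \<in> t0 \<Longrightarrow> y \<in> t0 \<Longrightarrow> x \<noteq> y \<Longrightarrow> adj T x y" for x y by (rule adj0)
  have finV: "finite (\<Union>T1)" "finite (\<Union>T2)" using surface_finite_verts S1 S2 by blast+
  have V: "card (\<Union>T1) + card (\<Union>T2) = card (\<Union>T) + 3"
    using card_Un_Int[OF finV] un int t0(1) by simp
  have finU: "finite U" "finite (T - U)" using closed_surfaceD(1)[OF S] U(1) finite_subset by blast+
  have "card U + card (T - U) = card T"
    using U(1) closed_surfaceD(1)[OF S] finU by (simp add: card_Diff_subset card_mono)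
  moreover have notU: "t0 \<notin> U" "t0 \<notin> T - U" using t0(2) U(1) by blast+
  moreover have "card T1 = card U + 1" "card T2 = card (T - U) + 1"
    using finU notU card_insert_disjoint[of U t0] card_insert_disjoint[of "T - U" t0] t0(2) U(1)
    unfolding T1_def T2_def by auto
  ultimately have F: "card T1 + card T2 = card T + 2" by simp
  have "card T1 + 4 = 2 * card (\<Union>T1) \<and> card T2 + 4 = 2 * card (\<Union>T2)"
    using surface_Euler_le[OF S1] surface_Euler_le[OF S2] V F Eu by linarith
  then show "two_sphere T1" "two_sphere T2" using S1 S2 by (simp_all add: two_sphere_def)
qed

lemma surface_card_verts:
  assumes T: "closed_surface T" shows "4 \<le> card (\<Union>T)"
proof -
  obtain t where t: "t \<in> T" using closed_surfaceD(2)[OF T] by blast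
  obtain x y z where xyz: "t = {x, y, z}" "x \<noteq> y" "y \<noteq> z" "x \<noteq> z"
    using closed_surfaceD(3)[OF T t] by (auto simp: card_3_iff)
  obtain s where s: "s \<in> T" "{x, y} \<subseteq> s" "s \<noteq> t"
    by (rule other_triangle[OF T t, of x y]) (use xyz in auto)
  obtain w where w: "s = {x, y, w}" "w \<noteq> x" "w \<noteq> y"
    using triangle_third[OF closed_surfaceD(3)[OF T s(1)], of x y] s(2) xyz(2) by blast
  have "w \<noteq> z" using w s(3) xyz(1) by blast
  then have "card {x, y, z, w} = 4" using xyz w by simp
  moreover have "{x, y, z, w} \<subseteq> \<Union>T" using t s(1) xyz(1) w(1) by blast
  ultimately show ?thesis using card_mono[OF surface_finite_verts[OF T], of "{x, y, z, w}"] by simp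
qed

section \<open>Flipping an edge\<close>

text \<open>
  The edge \<open>xc\<close>, shared by the triangles \<open>xbc\<close> and \<open>xcd\<close>, is to be replaced by the other diagonal \<open>bd\<close> of
  the quadrilateral \<open>xbcd\<close>.
\<close>

locale edge_flip =
  fixes T :: "'a set set" and x b c d :: 'a
  assumes T: "closed_surface T"
    and tri: "{x, b, c} \<in> T" "{x, c, d} \<in> T"
    and distinct: "x \<noteq> b" "x \<noteq> c" "x \<noteq> d" "b \<noteq> c" "b \<noteq> d" "c \<noteq> d"
    and nonadj: "\<not> adj T b d"
begin

definition flipped :: "'a set set" where
  "flipped = T - {{x, b, c}, {x, c, d}} \<union> {{x, b, d}, {b, c, d}}"

lemma new_notin: "{x, b, d} \<notin> T" "{b, c, d} \<notin> T"
  using nonadj adjI[of "{x, b, d}" T b d] adjI[of "{b, c, d}" T b d] distinct(5) by auto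

lemma old_sets: "{x, b, c} \<noteq> {x, c, d}" "{x, b, d} \<noteq> {b, c, d}"
proof -
  have "b \<in> {x, b, c}" "b \<notin> {x, c, d}" "x \<in> {x, b, d}" "x \<notin> {b, c, d}" using distinct by auto
  then show "{x, b, c} \<noteq> {x, c, d}" "{x, b, d} \<noteq> {b, c, d}" by metis+
qed

lemma old_edge: "t \<in> T \<Longrightarrow> x \<in> t \<Longrightarrow> c \<in> t \<Longrightarrow> t = {x, b, c} \<or> t = {x, c, d}"
  by (rule two_triangles[OF T distinct(2) tri(1) _ tri(2) _ old_sets(1)]) simp_all

text \<open>
  The situation is symmetric in the two ends of the old diagonal and in the two ends of the new one.
\<close>

lemma swap: "edge_flip T c b x d" "edge_flip T x d c b"
  using T tri distinct nonadj symp_adj[of T, THEN sympD] by unfold_locales (auto simp: insert_commute)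

lemma flipped_cases:
  "t \<in> flipped \<longleftrightarrow> t = {x, b, d} \<or> t = {b, c, d} \<or> (t \<in> T \<and> t \<noteq> {x, b, c} \<and> t \<noteq> {x, c, d})"
  by (auto simp: flipped_def)

lemma adj_flipped: "adj flipped u v \<longleftrightarrow> (adj T u v \<and> {u, v} \<noteq> {x, c}) \<or> {u, v} = {b, d}"
proof
  assume "adj flipped u v"
  then obtain t where ne: "u \<noteq> v" and t: "t \<in> flipped" "u \<in> t" "v \<in> t" by (auto simp: adj_def)
  have A: "adj T x b" "adj T b x" "adj T x d" "adj T d x" "adj T b c" "adj T c b" "adj T c d" "adj T d c"
    using adjI[OF tri(1)] adjI[OF tri(2)] distinct by simp_all
  from t(1) consider "t = {x, b, d}" | "t = {b, c, d}" | "t \<in> T" "t \<noteq> {x, b, c}" "t \<noteq> {x, c, d}"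
    unfolding flipped_cases by blast
  then show "(adj T u v \<and> {u, v} \<noteq> {x, c}) \<or> {u, v} = {b, d}"
  proof cases
    case 1 then show ?thesis using t ne A distinct by (auto simp: doubleton_eq_iff)
  next
    case 2 then show ?thesis using t ne A distinct by (auto simp: doubleton_eq_iff)
  next
    case 3
    then have "adj T u v" using t ne by (auto simp: adj_def)
    moreover have "{u, v} \<noteq> {x, c}" using old_edge[OF 3(1)] 3 t by (auto simp: doubleton_eq_iff)
    ultimately show ?thesis by blast
  qed
next
  have N: "adj flipped x b" "adj flipped b x" "adj flipped x d" "adj flipped d x" "adj flipped b c"
    "adj flipped c b" "adj flipped c d" "adj flipped d c" "adj flipped b d" "adj flipped d b"
    using adjI[of "{x, b, d}" flipped] adjI[of "{b, c, d}" flipped] distinct by (simp_all add: flipped_cases)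
  assume "(adj T u v \<and> {u, v} \<noteq> {x, c}) \<or> {u, v} = {b, d}"
  then show "adj flipped u v"
  proof
    assume a: "adj T u v \<and> {u, v} \<noteq> {x, c}"
    then obtain t where t: "t \<in> T" "u \<in> t" "v \<in> t" "u \<noteq> v" by (auto simp: adj_def)
    show ?thesis
    proof (cases "t = {x, b, c} \<or> t = {x, c, d}")
      case True
      then show ?thesis using t(2-4) a N by (auto simp: doubleton_eq_iff)
    next
      case False
      then have "t \<in> flipped" using t(1) by (simp add: flipped_cases)
      then show ?thesis using t by (auto simp: adj_def)
    qed
  next
    assume "{u, v} = {b, d}"
    then show ?thesis using N(9,10) by (auto simp: doubleton_eq_iff)
  qed
qed

lemma Union_flipped: "\<Union>flipped = \<Union>T"
proof -
  have "\<Union>T = {u. \<exists>v. adj T u v}" if "closed_surface T" for T :: "'a set set"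
  proof -
    have "\<exists>v. adj T u v" if "t \<in> T" "u \<in> t" for t u
    proof -
      have "\<not> t \<subseteq> {u}" using card_mono[of "{u}" t] closed_surfaceD(3)[OF \<open>closed_surface T\<close> that(1)] by auto
      then show ?thesis using that by (auto simp: adj_def)
    qed
    then show ?thesis by (auto simp: adj_def)
  qed
  show ?thesis
  proof
    show "\<Union>flipped \<subseteq> \<Union>T" using tri unfolding flipped_def by blast
    show "\<Union>T \<subseteq> \<Union>flipped"
    proof
      fix u assume "u \<in> \<Union>T"
      then obtain t where t: "t \<in> T" "u \<in> t" by blast
      show "u \<in> \<Union>flipped"
      proof (cases "t = {x, b, c} \<or> t = {x, c, d}")
        case True then show ?thesis using t(2) unfolding flipped_def by blast
      next
        case False then show ?thesis using t unfolding flipped_def by blast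
      qed
    qed
  qed
qed

lemma card_flipped: "card flipped = card T"
proof -
  have f: "finite T" by (rule closed_surfaceD(1)[OF T])
  have "card (T - {{x, b, c}, {x, c, d}}) = card T - 2"
    using tri old_sets f by (subst card_Diff_subset) auto
  moreover have "card T \<ge> 2" using card_mono[OF f, of "{{x, b, c}, {x, c, d}}"] tri old_sets by simp
  moreover have "card flipped = card (T - {{x, b, c}, {x, c, d}}) + card {{x, b, d}, {b, c, d}}"
    unfolding flipped_def using f new_notin by (intro card_Un_disjoint) auto
  ultimately show ?thesis using old_sets by simp
qed

lemma swap_one_card:
  assumes "u \<noteq> v" "S \<in> T" "N \<in> flipped" "N \<notin> T" "{u, v} \<subseteq> S" "{u, v} \<subseteq> N"
    and "\<And>t. {u, v} \<subseteq> t \<Longrightarrow> t \<in> flipped \<longleftrightarrow> t = N \<or> (t \<in> T \<and> t \<noteq> S)"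
  shows "card {t\<in>flipped. {u, v} \<subseteq> t} = 2"
proof -
  obtain R where R: "R \<in> T" "{u, v} \<subseteq> R" "R \<noteq> S" "\<forall>r\<in>T. {u, v} \<subseteq> r \<longrightarrow> r = R \<or> r = S"
    using other_triangle[OF T assms(2,5,1)] .
  have "{t\<in>flipped. {u, v} \<subseteq> t} = {N, R}"
  proof (intro set_eqI iffI)
    fix t assume "t \<in> {t\<in>flipped. {u, v} \<subseteq> t}"
    then have t: "t \<in> flipped" "{u, v} \<subseteq> t" by simp_all
    then have "t = N \<or> (t \<in> T \<and> t \<noteq> S)" using assms(7) by blast
    then show "t \<in> {N, R}" using R(4) t(2) by blast
  next
    fix t assume "t \<in> {N, R}"
    then show "t \<in> {t\<in>flipped. {u, v} \<subseteq> t}" using assms(3,6) assms(7)[OF R(2)] R(1-3) by blast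
  qed
  moreover have "N \<noteq> R" using assms(4) R(1) by blast
  ultimately show ?thesis by simp
qed

lemma flipped_edge:
  assumes uv: "u \<noteq> v"
  shows "card {t\<in>flipped. {u, v} \<subseteq> t} = 0 \<or> card {t\<in>flipped. {u, v} \<subseteq> t} = 2"
proof -
  have "{u, v} = {b, d} \<or> {u, v} = {x, c} \<or> {u, v} = {x, b} \<or> {u, v} = {x, d} \<or> {u, v} = {b, c} \<or> {u, v} = {c, d}"
    if "{u, v} \<subseteq> {x, b, c, d}"
  proof -
    have "u = x \<or> u = b \<or> u = c \<or> u = d" "v = x \<or> v = b \<or> v = c \<or> v = d" using that by simp_all
    then show ?thesis using uv by (elim disjE) (simp_all add: insert_commute)
  qed
  then consider "{u, v} = {b, d}" | "{u, v} = {x, c}" | "{u, v} = {x, b}" | "{u, v} = {x, d}" | "{u, v} = {b, c}"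
    | "{u, v} = {c, d}" | "\<not> {u, v} \<subseteq> {x, b, c, d}"
    by meson
  then show ?thesis
  proof cases
    case 1
    have "{t\<in>flipped. {b, d} \<subseteq> t} = {{x, b, d}, {b, c, d}}"
    proof (intro set_eqI iffI)
      fix t assume "t \<in> {t\<in>flipped. {b, d} \<subseteq> t}"
      then have t: "t \<in> flipped" "b \<in> t" "d \<in> t" by simp_all
      then have "t \<notin> T" using nonadj adjI[of t T b d] distinct(5) by blast
      then show "t \<in> {{x, b, d}, {b, c, d}}" using t(1) unfolding flipped_cases by blast
    next
      fix t assume "t \<in> {{x, b, d}, {b, c, d}}"
      then have tt: "t = {x, b, d} \<or> t = {b, c, d}" by simp
      then have "t \<in> flipped" using flipped_cases[of t] by argo
      moreover have "{b, d} \<subseteq> t" using tt by (elim disjE) simp_all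
      ultimately show "t \<in> {t\<in>flipped. {b, d} \<subseteq> t}" by blast
    qed
    then show ?thesis unfolding 1 using old_sets(2) by simp
  next
    case 2
    have "\<not> {x, c} \<subseteq> t" if "t \<in> flipped" for t
      using that old_edge[of t] distinct unfolding flipped_cases by auto
    then have "{t\<in>flipped. {x, c} \<subseteq> t} = {}" by blast
    then have "card {t\<in>flipped. {x, c} \<subseteq> t} = 0" by (simp only: card.empty)
    then show ?thesis unfolding 2 by argo
  next
    case 3
    have "card {t\<in>flipped. {x, b} \<subseteq> t} = 2"
      by (rule swap_one_card[of x b "{x, b, c}" "{x, b, d}"])
        (use tri distinct new_notin in \<open>auto simp: flipped_cases\<close>)
    then show ?thesis unfolding 3 by argo
  next
    case 4
    have "card {t\<in>flipped. {x, d} \<subseteq> t} = 2"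
      by (rule swap_one_card[of x d "{x, c, d}" "{x, b, d}"])
        (use tri distinct new_notin in \<open>auto simp: flipped_cases\<close>)
    then show ?thesis unfolding 4 by argo
  next
    case 5
    have "card {t\<in>flipped. {b, c} \<subseteq> t} = 2"
      by (rule swap_one_card[of b c "{x, b, c}" "{b, c, d}"])
        (use tri distinct new_notin in \<open>auto simp: flipped_cases\<close>)
    then show ?thesis unfolding 5 by argo
  next
    case 6
    have "card {t\<in>flipped. {c, d} \<subseteq> t} = 2"
      by (rule swap_one_card[of c d "{x, c, d}" "{b, c, d}"])
        (use tri distinct new_notin in \<open>auto simp: flipped_cases\<close>)
    then show ?thesis unfolding 6 by argo
  next
    case 7
    then have "{t\<in>flipped. {u, v} \<subseteq> t} = {t\<in>T. {u, v} \<subseteq> t}" by (auto simp: flipped_cases)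
    then show ?thesis using closed_surfaceD(4)[OF T uv] by argo
  qed
qed

text \<open>
  A set of triangles of the flipped surface is carried back to the original one. The truth value \<open>s\<close> says
  whether the two triangles that the flip destroys belong to the result.
\<close>

definition unflip :: "bool \<Rightarrow> 'a set set \<Rightarrow> 'a set set" where
  "unflip s W = {t\<in>W. t \<noteq> {x, b, c} \<and> t \<noteq> {x, c, d}} \<union> (if s then {{x, b, c}, {x, c, d}} else {})"

lemma unflip_iff:
  "{x, b, c} \<in> unflip s W \<longleftrightarrow> s" "{x, c, d} \<in> unflip s W \<longleftrightarrow> s"
  "t \<noteq> {x, b, c} \<Longrightarrow> t \<noteq> {x, c, d} \<Longrightarrow> t \<in> unflip s W \<longleftrightarrow> t \<in> W"
  by (simp_all add: unflip_def)

lemma unflip_coherent: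
  assumes c: "coherent flipped W \<alpha>"
    and s: "\<alpha> \<subseteq> {x, b, c} \<or> \<alpha> \<subseteq> {x, c, d} \<Longrightarrow> \<exists>n\<in>flipped. \<alpha> \<subseteq> n \<and> (n \<in> W \<longleftrightarrow> s)"
  shows "coherent T (unflip s W) \<alpha>"
proof (rule coherent_transfer[OF c])
  fix r assume r: "r \<in> T" "\<alpha> \<subseteq> r"
  consider "r = {x, b, c}" | "r = {x, c, d}" | "r \<noteq> {x, b, c}" "r \<noteq> {x, c, d}" by blast
  then show "\<exists>t\<in>flipped. \<alpha> \<subseteq> t \<and> (t \<in> W \<longleftrightarrow> r \<in> unflip s W)"
  proof cases
    case 1 then show ?thesis using s r(2) unflip_iff(1) by simp
  next
    case 2 then show ?thesis using s r(2) unflip_iff(2) by simp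
  next
    case 3
    then have "r \<in> flipped" using r(1) flipped_cases by blast
    then show ?thesis using r(2) unflip_iff(3)[OF 3] by blast
  qed
qed

lemma flipped_coherent:
  assumes c: "coherent T (unflip s W) \<alpha>"
    and n1: "\<alpha> \<subseteq> {x, b, d} \<Longrightarrow> (\<alpha> \<subseteq> {x, b, c} \<or> \<alpha> \<subseteq> {x, c, d}) \<and> ({x, b, d} \<in> W \<longleftrightarrow> s)"
    and n2: "\<alpha> \<subseteq> {b, c, d} \<Longrightarrow> (\<alpha> \<subseteq> {x, b, c} \<or> \<alpha> \<subseteq> {x, c, d}) \<and> ({b, c, d} \<in> W \<longleftrightarrow> s)"
  shows "coherent flipped W \<alpha>"
proof (rule coherent_transfer[OF c])
  have s: "\<exists>t\<in>T. \<alpha> \<subseteq> t \<and> (t \<in> unflip s W \<longleftrightarrow> s)" if "\<alpha> \<subseteq> {x, b, c} \<or> \<alpha> \<subseteq> {x, c, d}"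
    using that
  proof
    assume "\<alpha> \<subseteq> {x, b, c}"
    then show ?thesis by (intro bexI[OF _ tri(1)]) (simp add: unflip_iff(1))
  next
    assume "\<alpha> \<subseteq> {x, c, d}"
    then show ?thesis by (intro bexI[OF _ tri(2)]) (simp add: unflip_iff(2))
  qed
  fix r assume r: "r \<in> flipped" "\<alpha> \<subseteq> r"
  from r(1) consider "r = {x, b, d}" | "r = {b, c, d}" | "r \<in> T" "r \<noteq> {x, b, c}" "r \<noteq> {x, c, d}"
    unfolding flipped_cases by blast
  then show "\<exists>t\<in>T. \<alpha> \<subseteq> t \<and> (t \<in> unflip s W \<longleftrightarrow> r \<in> W)"
  proof cases
    case 1 then show ?thesis using s n1 r(2) by simp
  next
    case 2 then show ?thesis using s n2 r(2) by simp
  next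
    case 3 then show ?thesis using r(2) unflip_iff(3)[OF 3(2,3)] by blast
  qed
qed

lemma new_in_flipped: "{x, b, d} \<in> flipped" "{b, c, d} \<in> flipped"
  by (simp_all add: flipped_cases)

text \<open>
  Only one of the new triangles contains \<open>x\<close>; it decides about both old ones.
\<close>

lemma flipped_local_x:
  assumes c: "\<And>y. y \<noteq> x \<Longrightarrow> coherent flipped W {x, y}"
  shows "coherent flipped W {x}"
proof -
  let ?s = "{x, b, d} \<in> W"
  have "coherent T (unflip ?s W) {x, y}" if y: "y \<noteq> x" for y
  proof (cases "y = c")
    case True
    have "t \<in> unflip ?s W \<longleftrightarrow> ?s" if "t \<in> T" "{x, c} \<subseteq> t" for t
    proof -
      have "t = {x, b, c} \<or> t = {x, c, d}" using old_edge[OF that(1)] that(2) by simp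
      then show ?thesis by (elim disjE) (simp_all add: unflip_iff)
    qed
    then show ?thesis unfolding True coherent_def by (cases ?s) simp_all
  next
    case False
    show ?thesis
    proof (rule unflip_coherent[OF c[OF y]])
      assume "{x, y} \<subseteq> {x, b, c} \<or> {x, y} \<subseteq> {x, c, d}"
      then have "{x, y} \<subseteq> {x, b, d}" using False y by simp
      then show "\<exists>n\<in>flipped. {x, y} \<subseteq> n \<and> (n \<in> W \<longleftrightarrow> ?s)"
        by (intro bexI[OF _ new_in_flipped(1)]) simp
    qed
  qed
  then have "coherent T (unflip ?s W) {x}" by (rule closed_surfaceD(5)[OF T])
  then show ?thesis by (rule flipped_coherent) (use distinct in simp_all)
qed

text \<open>
  Both new triangles contain the new edge \<open>bd\<close>; coherence there makes them agree.
\<close>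

lemma flipped_local_b:
  assumes c: "\<And>y. y \<noteq> b \<Longrightarrow> coherent flipped W {b, y}"
  shows "coherent flipped W {b}"
proof -
  let ?s = "{x, b, d} \<in> W"
  have "coherent flipped W {b, d}" using c[of d] distinct by simp
  from coherentD[OF this new_in_flipped(2,1)] have s: "{b, c, d} \<in> W \<longleftrightarrow> ?s" by simp
  have "coherent T (unflip ?s W) {b, y}" if y: "y \<noteq> b" for y
  proof (rule unflip_coherent[OF c[OF y]])
    assume "{b, y} \<subseteq> {x, b, c} \<or> {b, y} \<subseteq> {x, c, d}"
    then have "y = x \<or> y = c" using y distinct by simp
    then show "\<exists>n\<in>flipped. {b, y} \<subseteq> n \<and> (n \<in> W \<longleftrightarrow> ?s)"
    proof
      assume "y = x" then show ?thesis by (intro bexI[OF _ new_in_flipped(1)]) simp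
    next
      assume "y = c" then show ?thesis using s by (intro bexI[OF _ new_in_flipped(2)]) simp
    qed
  qed
  then have "coherent T (unflip ?s W) {b}" by (rule closed_surfaceD(5)[OF T])
  then show ?thesis by (rule flipped_coherent) (use s in simp_all)
qed

lemma flipped_swap: "edge_flip.flipped T c b x d = flipped" "edge_flip.flipped T x d c b = flipped"
  unfolding edge_flip.flipped_def[OF swap(1)] edge_flip.flipped_def[OF swap(2)] flipped_def
  by (auto simp: insert_commute)

lemma flipped_local:
  assumes c: "\<And>y. y \<noteq> u \<Longrightarrow> coherent flipped W {u, y}"
  shows "coherent flipped W {u}"
proof -
  consider "u = x" | "u = b" | "u = c" | "u = d" | "u \<notin> {x, b, c, d}" by blast
  then show ?thesis
  proof cases
    case 1 then show ?thesis using flipped_local_x c by blast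
  next
    case 2 then show ?thesis using flipped_local_b c by blast
  next
    case 3
    then show ?thesis using edge_flip.flipped_local_x[OF swap(1), of W] c unfolding flipped_swap by blast
  next
    case 4
    then show ?thesis using edge_flip.flipped_local_b[OF swap(2), of W] c unfolding flipped_swap by blast
  next
    case 5
    have same: "t \<in> flipped \<longleftrightarrow> t \<in> T" if "u \<in> t" for t using that 5 by (auto simp: flipped_cases)
    have "coherent flipped W \<alpha> \<longleftrightarrow> coherent T W \<alpha>" if "u \<in> \<alpha>" for \<alpha>
      unfolding coherent_def using same that by blast
    then show ?thesis using closed_surfaceD(5)[OF T, of u W] c by simp
  qed
qed

lemma flipped_global:
  assumes c: "\<And>u. coherent flipped W {u}"
  shows "coherent flipped W {}"
proof -
  let ?s = "{x, b, d} \<in> W"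
  from coherentD[OF c[of b] new_in_flipped(2,1)] have s: "{b, c, d} \<in> W \<longleftrightarrow> ?s" by simp
  have "coherent T (unflip ?s W) {u}" for u
  proof (rule unflip_coherent[OF c])
    assume "{u} \<subseteq> {x, b, c} \<or> {u} \<subseteq> {x, c, d}"
    then have "{u} \<subseteq> {x, b, d} \<or> {u} \<subseteq> {b, c, d}" by auto
    then show "\<exists>n\<in>flipped. {u} \<subseteq> n \<and> (n \<in> W \<longleftrightarrow> ?s)"
    proof
      assume "{u} \<subseteq> {x, b, d}" then show ?thesis by (intro bexI[OF _ new_in_flipped(1)]) simp
    next
      assume "{u} \<subseteq> {b, c, d}" then show ?thesis using s by (intro bexI[OF _ new_in_flipped(2)]) simp
    qed
  qed
  then have "coherent T (unflip ?s W) {}" by (rule closed_surfaceD(6)[OF T])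
  then show ?thesis by (rule flipped_coherent) (use s in simp_all)
qed

theorem flipped_surface: "closed_surface flipped"
  unfolding closed_surface_def
proof (intro conjI allI impI ballI)
  show "finite flipped" using closed_surfaceD(1)[OF T] by (simp add: flipped_def)
  show "flipped \<noteq> {}" by (simp add: flipped_def)
  show "card t = 3" if "t \<in> flipped" for t
    using that distinct closed_surfaceD(3)[OF T] by (auto simp: flipped_cases)
  show "card {t \<in> flipped. {u, v} \<subseteq> t} = 0 \<or> card {t \<in> flipped. {u, v} \<subseteq> t} = 2" if "u \<noteq> v" for u v
    by (rule flipped_edge[OF that])
  show "coherent flipped W {u}" if "\<forall>y. y \<noteq> u \<longrightarrow> coherent flipped W {u, y}" for W u
    using flipped_local that by blast
  show "coherent flipped W {}" if "\<forall>x. coherent flipped W {x}" for W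
    using flipped_global that by blast
qed

theorem flipped_sphere:
  assumes "two_sphere T" shows "two_sphere flipped"
  using assms flipped_surface by (simp add: two_sphere_def card_flipped Union_flipped)

end

section \<open>Graph inequalities at a vertex of degree four or five\<close>

lemma avg_nonempty_meet:
  assumes "finite V" "W \<subseteq> V"
  shows "avg V (\<lambda>A. if A \<inter> W = {} then 0 else 1) = 1 - 1 / real (card W + 1)"
proof -
  have fW: "finite W" using assms finite_subset by blast
  have "avg V (\<lambda>A. if A \<inter> W = {} then 0 else 1) = avg W (\<lambda>A. if A = {} then 0 else 1)"
    by (rule avg_restrict[OF assms, of "\<lambda>A. if A = {} then 0 else 1"])
  also have "\<dots> = avg W (\<lambda>A. 1 - (if A = {} then 1 else 0))"
    by (rule avg_cong) simp
  also have "\<dots> = 1 - 1 / real (card W + 1)"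
    unfolding avg_diff avg_const[OF fW] using avg_indicator[OF fW, of "{}"] by simp
  finally show ?thesis .
qed

lemma avg_clique:
  assumes "finite V" "symp E" "\<And>u v. u \<in> V \<Longrightarrow> v \<in> V \<Longrightarrow> u \<noteq> v \<Longrightarrow> E u v"
  shows "avg V (\<lambda>A. real (ncomp E A)) = 1 - 1 / real (card V + 1)"
proof -
  have "avg V (\<lambda>A. real (ncomp E A)) = avg V (\<lambda>A. if A \<inter> V = {} then 0 else 1)"
  proof (rule avg_cong)
    fix A assume A: "A \<subseteq> V"
    have "ncomp E A = (if A = {} then 0 else 1)"
      by (rule ncomp_clique[OF assms(2)]) (use A assms(3) in blast)
    moreover have "A \<inter> V = A" using A by blast
    ultimately show "real (ncomp E A) = (if A \<inter> V = {} then 0 else 1)" by simp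
  qed
  then show ?thesis using avg_nonempty_meet[OF assms(1) order_refl] by simp
qed

text \<open>
  By \<open>ncomp_glue\<close> the number of components is additive up to a correction of 1 whenever the random set
  meets \<open>t0\<close>. This happens with probability \<open>3/4\<close>.
\<close>

lemma avg_ncomp_glue:
  assumes fin: "finite V1" "finite V2" and sym: "symp E" and t0: "V1 \<inter> V2 = t0" "card t0 = 3"
    and clique: "\<And>u v. u \<in> t0 \<Longrightarrow> v \<in> t0 \<Longrightarrow> u \<noteq> v \<Longrightarrow> E u v"
    and sep: "\<And>u v. E u v \<Longrightarrow> u \<in> V1 \<and> v \<in> V1 \<or> u \<in> V2 \<and> v \<in> V2"
  shows "avg (V1 \<union> V2) (\<lambda>A. real (ncomp E A)) =
    avg V1 (\<lambda>A. real (ncomp E A)) + avg V2 (\<lambda>A. real (ncomp E A)) - 3 / 4"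
proof -
  let ?V = "V1 \<union> V2"
  have finV: "finite ?V" using fin by simp
  have t0V: "t0 \<subseteq> ?V" using t0(1) by blast
  have "real (ncomp E A) = real (ncomp E (A \<inter> V1)) + real (ncomp E (A \<inter> V2)) - (if A \<inter> t0 = {} then 0 else 1)"
    if A: "A \<subseteq> ?V" for A
  proof -
    have "ncomp E ((A \<inter> V1) \<union> (A \<inter> V2)) + (if (A \<inter> V1) \<inter> (A \<inter> V2) = {} then 0 else 1) =
        ncomp E (A \<inter> V1) + ncomp E (A \<inter> V2)"
    proof (rule ncomp_glue)
      show "E u v" if "u \<in> (A \<inter> V1) \<inter> (A \<inter> V2)" "v \<in> (A \<inter> V1) \<inter> (A \<inter> V2)" "u \<noteq> v" for u v
        using clique[of u v] that t0(1) by blast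
      show "u \<in> A \<inter> V1 \<and> v \<in> A \<inter> V1 \<or> u \<in> A \<inter> V2 \<and> v \<in> A \<inter> V2"
        if "u \<in> (A \<inter> V1) \<union> (A \<inter> V2)" "v \<in> (A \<inter> V1) \<union> (A \<inter> V2)" "E u v" for u v
        using sep[OF that(3)] that by blast
    qed (use fin sym in auto)
    moreover have "(A \<inter> V1) \<union> (A \<inter> V2) = A" "(A \<inter> V1) \<inter> (A \<inter> V2) = A \<inter> t0"
      using A t0(1) by blast+
    ultimately have "ncomp E A + (if A \<inter> t0 = {} then 0 else 1) = ncomp E (A \<inter> V1) + ncomp E (A \<inter> V2)"
      by simp
    then show ?thesis by (simp split: if_splits)
  qed
  then have "avg ?V (\<lambda>A. real (ncomp E A)) =
      avg ?V (\<lambda>A. real (ncomp E (A \<inter> V1)) + real (ncomp E (A \<inter> V2)) - (if A \<inter> t0 = {} then 0 else 1))"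
    by (rule avg_cong)
  also have "\<dots> = avg V1 (\<lambda>A. real (ncomp E A)) + avg V2 (\<lambda>A. real (ncomp E A)) - (1 - 1 / real (card t0 + 1))"
    unfolding avg_diff avg_add
    using avg_restrict[OF finV, of V1 "\<lambda>A. real (ncomp E A)"] avg_restrict[OF finV, of V2 "\<lambda>A. real (ncomp E A)"]
      avg_nonempty_meet[OF finV, of t0] t0V by simp
  finally show ?thesis using t0(2) by simp
qed

text \<open>
  The weight of a set depends only on its size. Hence prescribing the trace on \<open>S\<close> to be \<open>B\<close> gives the
  same average for all \<open>B\<close> of the same size, which allows cancellation between different traces.
\<close>

lemma avg_block:
  assumes "finite V" "S \<subseteq> V" "B \<subseteq> S"
  shows "avg V (\<lambda>A. if A \<inter> S = B then q (A - S) else 0) =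
    (\<Sum>Z\<in>Pow (V - S). q Z / (real (card V + 1) * real (card V choose (card B + card Z))))"
proof -
  let ?w = "\<lambda>k. real (card V + 1) * real (card V choose k)"
  have "avg V (\<lambda>A. if A \<inter> S = B then q (A - S) else 0) =
      (\<Sum>A\<in>Pow V. if A \<inter> S = B then q (A - S) / ?w (card A) else 0)"
    unfolding avg_def by (rule sum.cong) auto
  also have "\<dots> = (\<Sum>A\<in>{A\<in>Pow V. A \<inter> S = B}. q (A - S) / ?w (card A))"
    by (rule sum.inter_filter[symmetric]) (use assms(1) in simp)
  also have "{A\<in>Pow V. A \<inter> S = B} = (\<lambda>Z. B \<union> Z) ` Pow (V - S)"
  proof (intro set_eqI iffI)
    fix A assume "A \<in> {A\<in>Pow V. A \<inter> S = B}"
    then have "A = B \<union> (A - S)" "A - S \<in> Pow (V - S)" by blast+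
    then show "A \<in> (\<lambda>Z. B \<union> Z) ` Pow (V - S)" by blast
  next
    fix A assume "A \<in> (\<lambda>Z. B \<union> Z) ` Pow (V - S)"
    then show "A \<in> {A\<in>Pow V. A \<inter> S = B}" using assms by blast
  qed
  also have "(\<Sum>A\<in>(\<lambda>Z. B \<union> Z) ` Pow (V - S). q (A - S) / ?w (card A)) =
      (\<Sum>Z\<in>Pow (V - S). q ((B \<union> Z) - S) / ?w (card (B \<union> Z)))"
    by (rule sum.reindex_cong[of "\<lambda>Z. B \<union> Z"]) (use assms in \<open>auto simp: inj_on_def\<close>)
  also have "\<dots> = (\<Sum>Z\<in>Pow (V - S). q Z / ?w (card B + card Z))"
  proof (rule sum.cong[OF refl])
    fix Z assume Z: "Z \<in> Pow (V - S)"
    have "(B \<union> Z) - S = Z" using Z assms by blast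
    moreover have "card (B \<union> Z) = card B + card Z"
      by (rule card_Un_disjoint) (use Z assms finite_subset[of _ V] in blast)+
    ultimately show "q ((B \<union> Z) - S) / ?w (card (B \<union> Z)) = q Z / ?w (card B + card Z)" by simp
  qed
  finally show ?thesis .
qed

lemma not_reach_pair:
  assumes "u \<noteq> v" "\<not> E u v"
  shows "\<not> reach E {u, v} u v"
proof
  assume "reach E {u, v} u v"
  then have "v \<in> {u}" by (rule reach_closed) (use assms in auto)
  then show False using assms(1) by simp
qed

lemma ncomp_two_steps:
  assumes "finite A" "symp E" "u \<in> A"
    and "\<And>p q. p \<in> A \<Longrightarrow> q \<in> A \<Longrightarrow> E' p q \<Longrightarrow> reach (\<lambda>x y. E x y \<or> {x, y} = {u, v}) A p q"
  shows "ncomp E A \<le> ncomp E' A + 1"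
proof -
  let ?F = "\<lambda>x y. E x y \<or> {x, y} = {u, v}"
  have sF: "symp ?F" using assms(2) by (auto simp: symp_def insert_commute)
  have "ncomp ?F A \<le> ncomp E' A"
  proof (rule ncomp_le[OF assms(1) sF order_refl])
    show "\<exists>u\<in>A. reach ?F A y u" if "y \<in> A" for y using that reach_refl by (rule bexI[rotated])
  qed (rule assms(4))
  then show ?thesis using ncomp_add_edge[OF assms(1-3), of v] by linarith
qed

lemma reach_path2:
  "x \<in> A \<Longrightarrow> y \<in> A \<Longrightarrow> z \<in> A \<Longrightarrow> E x y \<Longrightarrow> E y z \<Longrightarrow> reach E A x z"
  by (rule reach_trans[OF reach_edge reach_edge])

lemma reach_path3:
  "x \<in> A \<Longrightarrow> y \<in> A \<Longrightarrow> z \<in> A \<Longrightarrow> w \<in> A \<Longrightarrow> E x y \<Longrightarrow> E y z \<Longrightarrow> E z w \<Longrightarrow> reach E A x w"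
  by (rule reach_trans[OF reach_path2 reach_edge])

lemma reach_chord:
  assumes "symp E" "{p, q} = {u, v}" "reach E A u v" shows "reach E A p q"
  using assms(2,3) reach_sym[OF assms(1,3)] by (auto simp: doubleton_eq_iff)

lemma ncomp_le_same:
  assumes "finite A" "symp E" "\<And>u v. u \<in> A \<Longrightarrow> v \<in> A \<Longrightarrow> E' u v \<Longrightarrow> reach E A u v"
  shows "ncomp E A \<le> ncomp E' A"
proof (rule ncomp_le[OF assms(1,2) order_refl])
  show "\<exists>u\<in>A. reach E A y u" if "y \<in> A" for y using that reach_refl by (rule bexI[rotated])
qed (rule assms(3))

lemma inter_eq_iff: "B \<subseteq> S \<Longrightarrow> A \<inter> S = B \<longleftrightarrow> (\<forall>s\<in>S. s \<in> A \<longleftrightarrow> s \<in> B)"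
  by blast

text \<open>
  Here \<open>a, b, c, d\<close> is the link of \<open>x\<close> and \<open>ac\<close> the diagonal that replaces \<open>x\<close>. Compare the components
  on \<open>A\<close> in the old graph with those on \<open>A - {x}\<close> in the new graph. There can be one more of the old
  ones only if \<open>A\<close> meets the star in \<open>{x}\<close>, which then is isolated, or in \<open>{a, c}\<close>, where the diagonal
  may have connected something. These two events have probabilities \<open>1/30\<close> and \<open>1/60\<close>. The inequality
  is strict because on \<open>{x, b, d}\<close> the vertex \<open>x\<close> connects \<open>b\<close> with \<open>d\<close>.
\<close>

theorem degree_4_bound:
  assumes V: "finite V" and E: "symp E" and S: "{x, a, b, c, d} \<subseteq> V" "card {x, a, b, c, d} = 5"
    and spokes: "\<And>y. E x y \<longleftrightarrow> y \<in> {a, b, c, d}"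
    and cyc: "E a b" "E b c" "E c d" "E d a" and non: "\<not> E b d"
  shows "avg V (\<lambda>A. real (ncomp E A)) <
    avg (V - {x}) (\<lambda>A. real (ncomp (\<lambda>u v. E u v \<or> {u, v} = {a, c}) A)) + 1 / 20"
proof -
  let ?E' = "\<lambda>u v. E u v \<or> {u, v} = {a, c}"
  let ?S = "{x, a, b, c, d}"
  have dist: "x \<noteq> a" "x \<noteq> b" "x \<noteq> c" "x \<noteq> d" "a \<noteq> b" "a \<noteq> c" "a \<noteq> d" "b \<noteq> c" "b \<noteq> d" "c \<noteq> d"
    using S(2) by (auto simp: card_insert_if split: if_splits)
  have E': "symp ?E'" using E by (auto simp: symp_def insert_commute)
  have sp: "E x a" "E x b" "E x c" "E x d" "E a x" "E b x" "E c x" "E d x"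
    using spokes sympD[OF E] by blast+
  define f where "f A = real (ncomp E A) - real (ncomp ?E' (A - {x}))" for A
  define g :: "'a set \<Rightarrow> real" where "g B = (if B = {x} then 1 else 0) + (if B = {a, c} then 1 else 0)" for B
  have F1: "f A \<le> 1" if A: "A \<subseteq> V" "x \<in> A" "A \<inter> {a, b, c, d} = {}" for A
  proof -
    have "ncomp E A \<le> ncomp ?E' (A - {x}) + 1"
    proof (rule ncomp_le_Suc[where ?y0.0 = x])
      show "finite A" using A(1) V finite_subset by blast
      show "reach E A u v" if "u \<in> A - {x}" "v \<in> A - {x}" "?E' u v" for u v
      proof -
        have "E u v" using that A(3) by (auto simp: doubleton_eq_iff)
        then show ?thesis using that reach_edge[of u A v E] by blast
      qed
      show "reach E A y x \<or> (\<exists>u\<in>A - {x}. reach E A y u)" if "y \<in> A" for y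
        using that by (cases "y = x") (auto intro!: bexI[of _ y])
    qed (use A E in auto)
    then show ?thesis by (simp add: f_def)
  qed
  have map2: "reach E A u v" if "x \<in> A" "u \<in> A - {x}" "v \<in> A - {x}" "?E' u v" for u v A
    using that(4)
  proof
    assume "E u v" then show ?thesis using that reach_edge[of u A v E] by blast
  next
    assume uv: "{u, v} = {a, c}"
    then have "a \<in> A" "c \<in> A" using that by (auto simp: doubleton_eq_iff)
    then show ?thesis by (intro reach_chord[OF E uv] reach_path2[of _ _ x]) (use that sp in auto)
  qed
  have cover2: "\<exists>u\<in>A - {x}. reach E A y u" if "x \<in> A" "A \<inter> {a, b, c, d} \<noteq> {}" "y \<in> A" for y A
  proof (cases "y = x")
    case True
    have "\<exists>u\<in>A. u \<in> {a, b, c, d}" using that(2) by blast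
    then obtain u where "u \<in> A" "u \<in> {a, b, c, d}" by blast
    then have "E x u" "u \<noteq> x" using spokes dist by auto
    then show ?thesis using True \<open>u \<in> A\<close> that(1) reach_edge[of x A u E] by blast
  qed (use that in \<open>auto intro!: bexI[of _ y]\<close>)
  have F2: "f A \<le> 0" if A: "A \<subseteq> V" "x \<in> A" "A \<inter> {a, b, c, d} \<noteq> {}" for A
  proof -
    have "ncomp E A \<le> ncomp ?E' (A - {x})"
      by (rule ncomp_le) (use A V E finite_subset map2[OF A(2)] cover2[OF A(2,3)] in blast)+
    then show ?thesis by (simp add: f_def)
  qed
  have F3: "f A \<le> 0" if A: "A \<subseteq> V" "x \<notin> A" "\<not> (a \<in> A \<and> c \<in> A \<and> b \<notin> A \<and> d \<notin> A)" for A
  proof -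
    have "reach E A u v" if uv: "u \<in> A" "v \<in> A" "?E' u v" for u v
      using uv(3)
    proof
      assume "{u, v} = {a, c}"
      moreover from this have ac: "a \<in> A" "c \<in> A" using uv by (auto simp: doubleton_eq_iff)
      have "reach E A a c"
      proof (cases "b \<in> A")
        case True then show ?thesis using ac cyc by (intro reach_path2[of a A b c])
      next
        case False
        then have "d \<in> A" using ac A(3) by blast
        then have "reach E A c a" using ac cyc by (intro reach_path2[of c A d a])
        then show ?thesis by (rule reach_sym[OF E])
      qed
      ultimately show ?thesis by (rule reach_chord[OF E])
    qed (use uv reach_edge[of u A v E] in blast)
    then have "ncomp E A \<le> ncomp ?E' A"
      by (rule ncomp_le_same[OF finite_subset[OF A(1) V] E])
    then show ?thesis using A(2) by (simp add: f_def)
  qed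
  have F4: "f A \<le> 1" if A: "A \<subseteq> V" "x \<notin> A" "a \<in> A" for A
    using ncomp_add_edge[OF finite_subset[OF A(1) V] E A(3), of c] A(2) by (simp add: f_def)
  have le: "f A \<le> g (A \<inter> ?S)" if A: "A \<subseteq> V" for A
  proof -
    have e0: "A \<inter> {a, b, c, d} = {} \<longleftrightarrow> a \<notin> A \<and> b \<notin> A \<and> c \<notin> A \<and> d \<notin> A" by blast
    have e1: "A \<inter> ?S = {x} \<longleftrightarrow> x \<in> A \<and> A \<inter> {a, b, c, d} = {}"
      unfolding e0 by (subst inter_eq_iff) (use dist in simp_all)
    have e2: "A \<inter> ?S = {a, c} \<longleftrightarrow> x \<notin> A \<and> a \<in> A \<and> c \<in> A \<and> b \<notin> A \<and> d \<notin> A"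
      by (subst inter_eq_iff) (use dist in auto)
    show ?thesis
    proof (cases "x \<in> A")
      case True
      then show ?thesis unfolding g_def e1 e2 using F1[OF A True] F2[OF A True] by simp
    next
      case False
      then show ?thesis unfolding g_def e1 e2 using F3[OF A False] F4[OF A False] by simp
    qed
  qed
  have "f {x, b, d} < g ({x, b, d} \<inter> ?S)"
  proof -
    have "ncomp E {x, b, d} + 1 \<le> ncomp ?E' ({x, b, d} - {x})"
    proof (rule ncomp_less[where a = b and b = d])
      have "{x, b, d} - {x} = {b, d}" using dist by auto
      moreover have "\<not> ?E' b d" using non dist by (auto simp: doubleton_eq_iff)
      ultimately show "\<not> reach ?E' ({x, b, d} - {x}) b d" using not_reach_pair[OF dist(9), of ?E'] by simp
      show "reach E {x, b, d} b d" by (rule reach_path2[of _ _ x]) (use sp in auto)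
      show "reach E {x, b, d} u v" if "u \<in> {x, b, d} - {x}" "v \<in> {x, b, d} - {x}" "?E' u v" for u v
        using map2[of "{x, b, d}" u v] that by blast
      show "\<exists>u\<in>{x, b, d} - {x}. reach E {x, b, d} y u" if "y \<in> {x, b, d}" for y
        using cover2[of "{x, b, d}" y] that by blast
    qed (use E E' dist in auto)
    moreover have "g ({x, b, d} \<inter> ?S) = 0" unfolding g_def using dist by auto
    ultimately show ?thesis by (simp add: f_def)
  qed
  then have "avg V f < avg V (\<lambda>A. g (A \<inter> ?S))"
    by (intro avg_strict_mono[OF V le, where B = "{x, b, d}"]) (use S(1) in auto)
  also have "avg V (\<lambda>A. g (A \<inter> ?S)) = avg ?S g" by (rule avg_restrict[OF V S(1)])
  also have "\<dots> = 1 / 30 + 1 / 60"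
  proof -
    have "avg ?S (\<lambda>B. if B = {x} then 1 else 0) = 1 / 30"
      by (subst avg_indicator) (use S(2) in auto)
    moreover have "avg ?S (\<lambda>B. if B = {a, c} then 1 else 0) = 1 / 60"
      by (subst avg_indicator) (use S(2) dist(6) in \<open>auto simp: binomial_fact fact_numeral\<close>)
    ultimately show ?thesis unfolding g_def avg_add by simp
  qed
  finally have "avg V f < 1 / 20" by simp
  moreover have "avg V f = avg V (\<lambda>A. real (ncomp E A)) - avg (V - {x}) (\<lambda>A. real (ncomp ?E' A))"
  proof -
    have xV: "insert x (V - {x}) = V" using S(1) by blast
    have "avg V (\<lambda>A. real (ncomp ?E' (A - {x}))) = avg (V - {x}) (\<lambda>A. real (ncomp ?E' A))"
      using avg_insert[of "V - {x}" x "\<lambda>A. real (ncomp ?E' A)"] V unfolding xV by simp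
    then show ?thesis unfolding f_def avg_diff by simp
  qed
  ultimately show ?thesis by simp
qed

text \<open>
  The link of \<open>x\<close> is \<open>a, b, c, d, e\<close>, and the diagonals \<open>ac\<close> and \<open>ad\<close> replace \<open>x\<close>. The old graph can have
  one more component on \<open>A\<close> only if the trace of \<open>A\<close> on the star is one of \<open>{x}\<close>, \<open>{a, c}\<close>, \<open>{a, d}\<close>,
  \<open>{a, c, d}\<close>, \<open>{a, b, d}\<close>, \<open>{a, c, e}\<close>. For \<open>{a, b, d}\<close> this requires that \<open>a\<close> and \<open>d\<close> are not connected
  through the rest of \<open>A\<close>. Then, with the same rest but the trace \<open>{x, b, d}\<close>, the vertex \<open>x\<close>
  connects \<open>b\<close> with \<open>d\<close>, which are separated without it: the loss there pays for the gain, by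
  \<open>avg_block\<close>. Likewise \<open>{a, c, e}\<close> is paid for by \<open>{x, c, e}\<close>. The other four traces have total
  probability \<open>1/42 + 2/105 + 1/140 = 1/20\<close>, and \<open>{x, b, e}\<close> makes the inequality strict.
\<close>

theorem degree_5_bound:
  assumes V: "finite V" and E: "symp E" and S: "{x, a, b, c, d, e} \<subseteq> V" "card {x, a, b, c, d, e} = 6"
    and spokes: "\<And>y. E x y \<longleftrightarrow> y \<in> {a, b, c, d, e}"
    and cyc: "E a b" "E b c" "E c d" "E d e" "E e a" and non: "\<not> E b e"
  shows "avg V (\<lambda>A. real (ncomp E A)) <
    avg (V - {x}) (\<lambda>A. real (ncomp (\<lambda>u v. E u v \<or> {u, v} = {a, c} \<or> {u, v} = {a, d}) A)) + 1 / 20"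
proof -
  let ?E' = "\<lambda>u v. E u v \<or> {u, v} = {a, c} \<or> {u, v} = {a, d}"
  let ?S = "{x, a, b, c, d, e}"
  have dist: "x \<noteq> a" "x \<noteq> b" "x \<noteq> c" "x \<noteq> d" "x \<noteq> e" "a \<noteq> b" "a \<noteq> c" "a \<noteq> d" "a \<noteq> e"
    "b \<noteq> c" "b \<noteq> d" "b \<noteq> e" "c \<noteq> d" "c \<noteq> e" "d \<noteq> e"
    using S(2) by (auto simp: card_insert_if split: if_splits)
  have E': "symp ?E'" using E by (auto simp: symp_def insert_commute)
  have sp: "E x a" "E x b" "E x c" "E x d" "E x e" "E a x" "E b x" "E c x" "E d x" "E e x"
    using spokes sympD[OF E] by blast+
  have rcyc: "E b a" "E c b" "E d c" "E e d" "E a e"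
    using cyc sympD[OF E] by blast+
  define f where "f A = real (ncomp E A) - real (ncomp ?E' (A - {x}))" for A
  define q1 :: "'a set \<Rightarrow> real" where "q1 Z = (if reach E (Z \<union> {a, b, d}) a d then 0 else 1)" for Z
  define q2 :: "'a set \<Rightarrow> real" where "q2 Z = (if reach E (Z \<union> {a, c, e}) a c then 0 else 1)" for Z
  define g :: "'a set \<Rightarrow> real" where
    "g B = (if B = {x} then 1 else 0) + (if B = {a, c} then 1 else 0) + (if B = {a, d} then 1 else 0)
      + (if B = {a, c, d} then 1 else 0)" for B
  have chord: "(u = a \<and> v = p) \<or> (u = p \<and> v = a)" if "{u, v} = {a, p}" for u v p
    using that by (auto simp: doubleton_eq_iff)
  have F1: "f A \<le> 1" if A: "A \<subseteq> V" "x \<in> A" "A \<inter> {a, b, c, d, e} = {}" for A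
  proof -
    have "ncomp E A \<le> ncomp ?E' (A - {x}) + 1"
    proof (rule ncomp_le_Suc[where ?y0.0 = x])
      show "finite A" using A(1) V finite_subset by blast
      show "reach E A u v" if "u \<in> A - {x}" "v \<in> A - {x}" "?E' u v" for u v
      proof -
        have "E u v" using that A(3) chord by blast
        then show ?thesis using that reach_edge[of u A v E] by blast
      qed
      show "reach E A y x \<or> (\<exists>u\<in>A - {x}. reach E A y u)" if "y \<in> A" for y
        using that by (cases "y = x") (auto intro!: bexI[of _ y])
    qed (use A E in auto)
    then show ?thesis by (simp add: f_def)
  qed
  have map2: "reach E A u v" if "x \<in> A" "u \<in> A - {x}" "v \<in> A - {x}" "?E' u v" for u v A
  proof (cases "E u v")
    case True then show ?thesis using that reach_edge[of u A v E] by blast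
  next
    case False
    then have "(u = a \<and> v = c \<or> u = c \<and> v = a) \<or> (u = a \<and> v = d \<or> u = d \<and> v = a)"
      using that(4) chord[of u v c] chord[of u v d] by argo
    then have "E u x \<and> E x v" using sp by (elim disjE conjE) simp_all
    then show ?thesis using that(1-3) by (intro reach_path2[of u A x v]) auto
  qed
  have cover2: "\<exists>u\<in>A - {x}. reach E A y u" if "x \<in> A" "A \<inter> {a, b, c, d, e} \<noteq> {}" "y \<in> A" for y A
  proof (cases "y = x")
    case True
    have "\<exists>u\<in>A. u \<in> {a, b, c, d, e}" using that(2) by blast
    then obtain u where "u \<in> A" "u \<in> {a, b, c, d, e}" by blast
    then have "E x u" "u \<noteq> x" using spokes dist by auto
    then show ?thesis using True \<open>u \<in> A\<close> that(1) reach_edge[of x A u E] by blast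
  qed (use that in \<open>auto intro!: bexI[of _ y]\<close>)
  have F2: "f A \<le> 0" if A: "A \<subseteq> V" "x \<in> A" "A \<inter> {a, b, c, d, e} \<noteq> {}" for A
  proof -
    have "ncomp E A \<le> ncomp ?E' (A - {x})"
      by (rule ncomp_le) (use A V E finite_subset map2[OF A(2)] cover2[OF A(2,3)] in blast)+
    then show ?thesis by (simp add: f_def)
  qed
  have F2': "f A \<le> - 1"
    if A: "A \<subseteq> V" "x \<in> A" "p \<in> A" "r \<in> A" "p \<in> {a, b, c, d, e}" "r \<in> {a, b, c, d, e}"
      and nr: "\<not> reach ?E' (A - {x}) p r" for A p r
  proof -
    have px: "p \<noteq> x" "r \<noteq> x" using A(5,6) dist by auto
    have "ncomp E A + 1 \<le> ncomp ?E' (A - {x})"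
    proof (rule ncomp_less[where a = p and b = r])
      show "finite A" using A(1) V finite_subset by blast
      show "reach E A p r"
        by (rule reach_path2[of _ _ x]) (use A spokes sympD[OF E] in blast)+
      show "reach E A u v" if "u \<in> A - {x}" "v \<in> A - {x}" "?E' u v" for u v
        using map2[OF A(2)] that by blast
      show "\<exists>u\<in>A - {x}. reach E A y u" if "y \<in> A" for y
        using cover2[OF A(2) _ that] A(3,5) by blast
    qed (use E E' px A nr in auto)
    then show ?thesis by (simp add: f_def)
  qed
  have F3: "f A \<le> 0" if A: "A \<subseteq> V" "x \<notin> A"
    and ac: "a \<in> A \<Longrightarrow> c \<in> A \<Longrightarrow> reach E A a c" and ad: "a \<in> A \<Longrightarrow> d \<in> A \<Longrightarrow> reach E A a d" for A
  proof -
    have "reach E A u v" if uv: "u \<in> A" "v \<in> A" "?E' u v" for u v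
      using uv(3)
    proof (elim disjE)
      assume uvc: "{u, v} = {a, c}"
      have "a \<in> A" "c \<in> A" using chord[OF uvc] uv(1,2) by (elim disjE conjE, simp_all)+
      then show ?thesis using reach_chord[OF E uvc] ac by blast
    next
      assume uvc: "{u, v} = {a, d}"
      have "a \<in> A" "d \<in> A" using chord[OF uvc] uv(1,2) by (elim disjE conjE, simp_all)+
      then show ?thesis using reach_chord[OF E uvc] ad by blast
    qed (use uv reach_edge[of u A v E] in blast)
    then have "ncomp E A \<le> ncomp ?E' A"
      by (rule ncomp_le_same[OF finite_subset[OF A(1) V] E])
    then show ?thesis using A(2) by (simp add: f_def)
  qed
  have F4: "f A \<le> 1" if A: "A \<subseteq> V" "x \<notin> A" "a \<in> A" for A
  proof -
    define p where "p = (if c \<in> A then c else d)"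
    let ?F = "\<lambda>x y. E x y \<or> {x, y} = {a, p}"
    have sF: "symp ?F" using E by (auto simp: symp_def insert_commute)
    have ap: "reach ?F A a p" if "p \<in> A" by (rule reach_edge) (use that A in auto)
    have cd: "reach ?F A c d" if "c \<in> A" "d \<in> A" by (rule reach_edge) (use that cyc in auto)
    have ac: "reach ?F A a c" if "c \<in> A" using ap that by (simp add: p_def)
    have ad: "reach ?F A a d" if "d \<in> A"
    proof (cases "c \<in> A")
      case True then show ?thesis using reach_trans[OF ac cd] that by blast
    next
      case False then show ?thesis using ap that by (simp add: p_def)
    qed
    have "reach ?F A u v" if uv: "u \<in> A" "v \<in> A" "?E' u v" for u v
      using uv(3)
    proof (elim disjE)
      assume uvc: "{u, v} = {a, c}"
      have "c \<in> A" using chord[OF uvc] uv(1,2) by (elim disjE conjE) simp_all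
      then show ?thesis using reach_chord[OF sF uvc] ac by blast
    next
      assume uvc: "{u, v} = {a, d}"
      have "d \<in> A" using chord[OF uvc] uv(1,2) by (elim disjE conjE) simp_all
      then show ?thesis using reach_chord[OF sF uvc] ad by blast
    qed (use uv reach_edge[of u A v ?F] in blast)
    then have "ncomp E A \<le> ncomp ?E' A + 1"
      by (rule ncomp_two_steps[OF finite_subset[OF A(1) V] E A(3)])
    then show ?thesis using A(2) by (simp add: f_def)
  qed
  have F3': "f A \<le> 0"
    if A: "A \<subseteq> V" "x \<notin> A" and ok: "a \<notin> A \<or> (c \<notin> A \<or> b \<in> A \<or> d \<in> A \<and> e \<in> A) \<and> (d \<notin> A \<or> e \<in> A \<or> c \<in> A \<and> b \<in> A)" for A
  proof (rule F3[OF A])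
    assume ac: "a \<in> A" "c \<in> A"
    then consider "b \<in> A" | "d \<in> A" "e \<in> A" using ok by blast
    then show "reach E A a c"
    proof cases
      case 1 then show ?thesis using ac cyc by (intro reach_path2[of a A b c])
    next
      case 2 then show ?thesis using ac rcyc by (intro reach_path3[of a A e d c])
    qed
  next
    assume ad: "a \<in> A" "d \<in> A"
    then consider "e \<in> A" | "c \<in> A" "b \<in> A" using ok by blast
    then show "reach E A a d"
    proof cases
      case 1 then show ?thesis using ad rcyc by (intro reach_path2[of a A e d])
    next
      case 2 then show ?thesis using ad cyc by (intro reach_path3[of a A b c d])
    qed
  qed
  have eqs:
    "A \<inter> ?S = {x} \<longleftrightarrow> x \<in> A \<and> a \<notin> A \<and> b \<notin> A \<and> c \<notin> A \<and> d \<notin> A \<and> e \<notin> A"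
    "A \<inter> ?S = {a, c} \<longleftrightarrow> x \<notin> A \<and> a \<in> A \<and> b \<notin> A \<and> c \<in> A \<and> d \<notin> A \<and> e \<notin> A"
    "A \<inter> ?S = {a, d} \<longleftrightarrow> x \<notin> A \<and> a \<in> A \<and> b \<notin> A \<and> c \<notin> A \<and> d \<in> A \<and> e \<notin> A"
    "A \<inter> ?S = {a, c, d} \<longleftrightarrow> x \<notin> A \<and> a \<in> A \<and> b \<notin> A \<and> c \<in> A \<and> d \<in> A \<and> e \<notin> A"
    "A \<inter> ?S = {a, b, d} \<longleftrightarrow> x \<notin> A \<and> a \<in> A \<and> b \<in> A \<and> c \<notin> A \<and> d \<in> A \<and> e \<notin> A"
    "A \<inter> ?S = {x, b, d} \<longleftrightarrow> x \<in> A \<and> a \<notin> A \<and> b \<in> A \<and> c \<notin> A \<and> d \<in> A \<and> e \<notin> A"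
    "A \<inter> ?S = {a, c, e} \<longleftrightarrow> x \<notin> A \<and> a \<in> A \<and> b \<notin> A \<and> c \<in> A \<and> d \<notin> A \<and> e \<in> A"
    "A \<inter> ?S = {x, c, e} \<longleftrightarrow> x \<in> A \<and> a \<notin> A \<and> b \<notin> A \<and> c \<in> A \<and> d \<notin> A \<and> e \<in> A" for A
    by (subst inter_eq_iff, simp, use dist in simp)+
  have set1: "A = (A - ?S) \<union> (A \<inter> ?S)" for A by blast
  have P1: "f A \<le> q1 (A - ?S)" if A: "A \<subseteq> V" "A \<inter> ?S = {a, b, d}" for A
  proof -
    have mem: "x \<notin> A" "a \<in> A" "b \<in> A" "d \<in> A" "c \<notin> A" "e \<notin> A" using A(2) unfolding eqs by simp_all
    have q: "q1 (A - ?S) = (if reach E A a d then 0 else 1)"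
      unfolding q1_def using set1[of A] A(2) by simp
    show ?thesis
    proof (cases "reach E A a d")
      case True
      have "f A \<le> 0" by (rule F3[OF A(1) mem(1)]) (use True mem in auto)
      then show ?thesis using True q by simp
    next
      case False
      then show ?thesis using F4[OF A(1) mem(1,2)] q by simp
    qed
  qed
  have P2: "f A \<le> q2 (A - ?S)" if A: "A \<subseteq> V" "A \<inter> ?S = {a, c, e}" for A
  proof -
    have mem: "x \<notin> A" "a \<in> A" "c \<in> A" "e \<in> A" "b \<notin> A" "d \<notin> A" using A(2) unfolding eqs by simp_all
    have q: "q2 (A - ?S) = (if reach E A a c then 0 else 1)"
      unfolding q2_def using set1[of A] A(2) by simp
    show ?thesis
    proof (cases "reach E A a c")
      case True
      have "f A \<le> 0" by (rule F3[OF A(1) mem(1)]) (use True mem in auto)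
      then show ?thesis using True q by simp
    next
      case False
      then show ?thesis using F4[OF A(1) mem(1,2)] q by simp
    qed
  qed
  have no_chord: "?E' u v \<Longrightarrow> a \<noteq> u \<Longrightarrow> a \<noteq> v \<Longrightarrow> E u v" for u v
    using chord by blast
  have M1: "f A \<le> - q1 (A - ?S)" if A: "A \<subseteq> V" "A \<inter> ?S = {x, b, d}" for A
  proof -
    have mem: "x \<in> A" "a \<notin> A" "b \<in> A" "d \<in> A" "c \<notin> A" "e \<notin> A" using A(2) unfolding eqs by simp_all
    let ?D = "(A - ?S) \<union> {a, b, d}"
    have sub: "A - {x} \<subseteq> ?D" using A(2) by blast
    show ?thesis
    proof (cases "reach E ?D a d")
      case True
      then show ?thesis using F2[OF A(1) mem(1)] mem(3) by (auto simp: q1_def)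
    next
      case False
      have "\<not> reach ?E' (A - {x}) b d"
      proof
        assume r: "reach ?E' (A - {x}) b d"
        have "reach E ?D b d"
          by (rule reach_map[OF r], rule reach_edge) (use sub mem no_chord in blast)+
        moreover have "reach E ?D a b" by (rule reach_edge) (use cyc in auto)
        ultimately show False using False reach_trans[of E ?D a b d] by blast
      qed
      then have "f A \<le> - 1" by (intro F2'[OF A(1) mem(1,3,4)]) auto
      then show ?thesis using False by (simp add: q1_def)
    qed
  qed
  have M2: "f A \<le> - q2 (A - ?S)" if A: "A \<subseteq> V" "A \<inter> ?S = {x, c, e}" for A
  proof -
    have mem: "x \<in> A" "a \<notin> A" "c \<in> A" "e \<in> A" "b \<notin> A" "d \<notin> A" using A(2) unfolding eqs by simp_all
    let ?D = "(A - ?S) \<union> {a, c, e}"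
    have sub: "A - {x} \<subseteq> ?D" using A(2) by blast
    show ?thesis
    proof (cases "reach E ?D a c")
      case True
      then show ?thesis using F2[OF A(1) mem(1)] mem(3) by (auto simp: q2_def)
    next
      case False
      have "\<not> reach ?E' (A - {x}) e c"
      proof
        assume r: "reach ?E' (A - {x}) e c"
        have "reach E ?D e c"
          by (rule reach_map[OF r], rule reach_edge) (use sub mem no_chord in blast)+
        moreover have "reach E ?D a e" by (rule reach_edge) (use rcyc in auto)
        ultimately show False using False reach_trans[of E ?D a e c] by blast
      qed
      then have "f A \<le> - 1" by (intro F2'[OF A(1) mem(1,4,3)]) auto
      then show ?thesis using False by (simp add: q2_def)
    qed
  qed
  define G where "G A = g (A \<inter> ?S)
      + ((if A \<inter> ?S = {a, b, d} then q1 (A - ?S) else 0) - (if A \<inter> ?S = {x, b, d} then q1 (A - ?S) else 0))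
      + ((if A \<inter> ?S = {a, c, e} then q2 (A - ?S) else 0) - (if A \<inter> ?S = {x, c, e} then q2 (A - ?S) else 0))" for A
  have le: "f A \<le> G A" if A: "A \<subseteq> V" for A
  proof -
    have i0: "A \<inter> {a, b, c, d, e} = {} \<longleftrightarrow> a \<notin> A \<and> b \<notin> A \<and> c \<notin> A \<and> d \<notin> A \<and> e \<notin> A" by blast
    show ?thesis
    proof (cases "x \<in> A")
      case True
      show ?thesis
        using F1[OF A True] F2[OF A True] M1[OF A] M2[OF A] True
        unfolding G_def g_def eqs i0 by (auto split: if_splits)
    next
      case False
      show ?thesis
        using F3'[OF A False] F4[OF A False] P1[OF A] P2[OF A] False
        unfolding G_def g_def eqs
        by (cases "a \<in> A"; cases "b \<in> A"; cases "c \<in> A"; cases "d \<in> A"; cases "e \<in> A"; simp)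
    qed
  qed
  have "f {x, b, e} < G {x, b, e}"
  proof -
    have "f {x, b, e} \<le> - 1"
    proof (rule F2'[of _ b e])
      have "{x, b, e} - {x} = {b, e}" using dist by auto
      moreover have "\<not> ?E' b e" using non chord dist by blast
      ultimately show "\<not> reach ?E' ({x, b, e} - {x}) b e" using not_reach_pair[OF dist(12), of ?E'] by simp
    qed (use S in auto)
    moreover have "G {x, b, e} = 0" unfolding G_def g_def eqs using dist by simp
    ultimately show ?thesis by simp
  qed
  then have "avg V f < avg V G"
    by (intro avg_strict_mono[OF V le, where B = "{x, b, e}"]) (use S(1) in auto)
  also have "avg V G = avg V (\<lambda>A. g (A \<inter> ?S))"
  proof -
    have c3: "card {a, b, d} = 3" "card {x, b, d} = 3" "card {a, c, e} = 3" "card {x, c, e} = 3" using dist by simp_all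
    have "avg V (\<lambda>A. if A \<inter> ?S = {a, b, d} then q1 (A - ?S) else 0) = avg V (\<lambda>A. if A \<inter> ?S = {x, b, d} then q1 (A - ?S) else 0)"
      by (subst (1 2) avg_block[OF V S(1)]) (simp_all add: c3)
    moreover have "avg V (\<lambda>A. if A \<inter> ?S = {a, c, e} then q2 (A - ?S) else 0) = avg V (\<lambda>A. if A \<inter> ?S = {x, c, e} then q2 (A - ?S) else 0)"
      by (subst (1 2) avg_block[OF V S(1)]) (simp_all add: c3)
    ultimately show ?thesis unfolding G_def avg_add avg_diff by simp
  qed
  also have "\<dots> = avg ?S g" by (rule avg_restrict[OF V S(1)])
  also have "\<dots> = 1 / 42 + 1 / 105 + 1 / 105 + 1 / 140"
  proof -
    have bin: "6 choose 2 = (15::nat)" "6 choose 3 = (20::nat)"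
      by (simp_all add: binomial_fact' fact_numeral)
    have "avg ?S (\<lambda>B. if B = {x} then 1 else 0) = 1 / 42"
      by (subst avg_indicator) (use S(2) in simp_all)
    moreover have "avg ?S (\<lambda>B. if B = {a, c} then 1 else 0) = 1 / 105"
      by (subst avg_indicator) (use S(2) dist bin in simp_all)
    moreover have "avg ?S (\<lambda>B. if B = {a, d} then 1 else 0) = 1 / 105"
      by (subst avg_indicator) (use S(2) dist bin in simp_all)
    moreover have "avg ?S (\<lambda>B. if B = {a, c, d} then 1 else 0) = 1 / 140"
      by (subst avg_indicator) (use S(2) dist bin in simp_all)
    ultimately show ?thesis unfolding g_def avg_add by simp
  qed
  finally have "avg V f < 1 / 20" by simp
  moreover have "avg V f = avg V (\<lambda>A. real (ncomp E A)) - avg (V - {x}) (\<lambda>A. real (ncomp ?E' A))"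
  proof -
    have xV: "insert x (V - {x}) = V" using S(1) by blast
    have "avg V (\<lambda>A. real (ncomp ?E' (A - {x}))) = avg (V - {x}) (\<lambda>A. real (ncomp ?E' A))"
      using avg_insert[of "V - {x}" x "\<lambda>A. real (ncomp ?E' A)"] V unfolding xV by simp
    then show ?thesis unfolding f_def avg_diff by simp
  qed
  ultimately show ?thesis by simp
qed

section \<open>Vertex stars in a surface\<close>

definition nbrs :: "'a set set \<Rightarrow> 'a \<Rightarrow> 'a set" where
  "nbrs T x = {y. adj T x y}"

lemma nbrs_subset: "nbrs T x \<subseteq> \<Union>T - {x}"
  by (auto simp: nbrs_def adj_def)

lemma finite_nbrs: "closed_surface T \<Longrightarrow> finite (nbrs T x)"
  by (rule finite_subset[OF nbrs_subset finite_Diff[OF surface_finite_verts]])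

text \<open>
  Edges and vertices of a cycle are equal in number.
\<close>

lemma card_star:
  assumes T: "closed_surface T"
  shows "card {t\<in>T. x \<in> t} = card (nbrs T x)"
proof -
  let ?S = "{t\<in>T. x \<in> t}" and ?N = "nbrs T x"
  have "(\<Sum>y\<in>?N. card {t\<in>?S. y \<in> t}) = (\<Sum>t\<in>?S. card {y\<in>?N. y \<in> t})"
    by (rule sum_multicount_gen) (use finite_nbrs[OF T] closed_surfaceD(1)[OF T] in auto)
  moreover have "card {t\<in>?S. y \<in> t} = 2" if "y \<in> ?N" for y
  proof -
    have xy: "x \<noteq> y" "adj T x y" using that by (auto simp: nbrs_def adj_def)
    obtain s t where st: "s \<noteq> t" "{r\<in>T. {x, y} \<subseteq> r} = {s, t}" using edge_two_triangles[OF T xy] .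
    have "{t\<in>?S. y \<in> t} = {r\<in>T. {x, y} \<subseteq> r}" by blast
    then have "card {t\<in>?S. y \<in> t} = card {s, t}" unfolding st(2) by (rule arg_cong)
    then show ?thesis using st(1) by simp
  qed
  moreover have "card {y\<in>?N. y \<in> t} = 2" if t: "t \<in> ?S" for t
  proof -
    have "{y\<in>?N. y \<in> t} = t - {x}" using t by (auto simp: nbrs_def adj_def)
    moreover have "card (t - {x}) = 2" using t closed_surfaceD(3)[OF T, of t] triangle_finite[OF T, of t] by simp
    ultimately show ?thesis by (simp only:)
  qed
  ultimately show ?thesis by simp
qed

text \<open>
  The average degree is \<open>6 - 12 / n\<close>.
\<close>

lemma low_degree_vertex:
  assumes T: "two_sphere T"
  obtains x where "x \<in> \<Union>T" "card (nbrs T x) \<le> 5"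
proof -
  have S: "closed_surface T" and Eu: "card T + 4 = 2 * card (\<Union>T)" using T by (auto simp: two_sphere_def)
  note fV = surface_finite_verts[OF S]
  have "(\<Sum>x\<in>\<Union>T. card {t\<in>T. x \<in> t}) = (\<Sum>t\<in>T. card {x\<in>\<Union>T. x \<in> t})"
    by (rule sum_multicount_gen) (use fV closed_surfaceD(1)[OF S] in auto)
  also have "\<dots> = (\<Sum>t\<in>T. 3)"
  proof (rule sum.cong[OF refl])
    fix t assume t: "t \<in> T"
    then have "{x\<in>\<Union>T. x \<in> t} = t" by blast
    then show "card {x\<in>\<Union>T. x \<in> t} = 3" using closed_surfaceD(3)[OF S t] by simp
  qed
  finally have sum: "(\<Sum>x\<in>\<Union>T. card {t\<in>T. x \<in> t}) = 3 * card T" by simp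
  show thesis
  proof (rule ccontr)
    assume no: "\<not> thesis"
    have "6 \<le> card {t\<in>T. x \<in> t}" if x: "x \<in> \<Union>T" for x
    proof -
      have "\<not> card (nbrs T x) \<le> 5" using no \<open>\<And>x. x \<in> \<Union>T \<Longrightarrow> card (nbrs T x) \<le> 5 \<Longrightarrow> thesis\<close> x by blast
      then show ?thesis unfolding card_star[OF S] by simp
    qed
    then have "(\<Sum>x\<in>\<Union>T. 6) \<le> (\<Sum>x\<in>\<Union>T. card {t\<in>T. x \<in> t})" by (rule sum_mono)
    then show False using sum Eu by simp
  qed
qed

definition link_edge :: "'a set set \<Rightarrow> 'a \<Rightarrow> 'a \<Rightarrow> 'a \<Rightarrow> bool" where
  "link_edge T x p q \<longleftrightarrow> {x, p, q} \<in> T \<and> p \<noteq> x \<and> q \<noteq> x \<and> p \<noteq> q"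

lemma link_edge_sym: "link_edge T x p q \<Longrightarrow> link_edge T x q p"
  by (auto simp: link_edge_def insert_commute)

lemma link_edge_nbrs: "link_edge T x p q \<Longrightarrow> p \<in> nbrs T x"
  unfolding link_edge_def nbrs_def using adjI[of "{x, p, q}" T x p] by auto

lemma nbrs_link_edge:
  assumes T: "closed_surface T" and "p \<in> nbrs T x"
  obtains q where "link_edge T x p q"
proof -
  obtain t where t: "t \<in> T" "x \<in> t" "p \<in> t" "x \<noteq> p" using assms(2) by (auto simp: nbrs_def adj_def)
  obtain q where "t = {x, p, q}" "q \<noteq> x" "q \<noteq> p" using triangle_third[OF closed_surfaceD(3)[OF T t(1)] t(2-4)] .
  then show thesis using that t by (auto simp: link_edge_def)
qed

lemma link_next:
  assumes T: "closed_surface T" and pq: "link_edge T x p q"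
  obtains r where "r \<noteq> p" "link_edge T x q r" "\<forall>s. link_edge T x q s \<longrightarrow> s = p \<or> s = r"
proof -
  have t: "{x, p, q} \<in> T" "p \<noteq> x" "q \<noteq> x" "p \<noteq> q" using pq by (auto simp: link_edge_def)
  obtain u where u: "u \<in> T" "{x, q} \<subseteq> u" "u \<noteq> {x, p, q}" "\<forall>r\<in>T. {x, q} \<subseteq> r \<longrightarrow> r = u \<or> r = {x, p, q}"
    using other_triangle[OF T t(1), of x q] t(3) by auto
  obtain r where r: "u = {x, q, r}" "r \<noteq> x" "r \<noteq> q"
    using triangle_third[OF closed_surfaceD(3)[OF T u(1)], of x q] u(2) t(3) by auto
  have "r \<noteq> p" using u(3) r(1) by (auto simp: insert_commute)
  moreover have "link_edge T x q r" using u(1) r t by (auto simp: link_edge_def)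
  moreover have "s = p \<or> s = r" if "link_edge T x q s" for s
  proof -
    have "{x, q, s} \<in> T" "s \<noteq> x" "s \<noteq> q" using that by (auto simp: link_edge_def)
    then have "{x, q, s} = {x, q, r} \<or> {x, q, s} = {x, p, q}" using u(4) r(1) by simp
    then show ?thesis using \<open>s \<noteq> x\<close> \<open>s \<noteq> q\<close> by blast
  qed
  ultimately show thesis using that by blast
qed

text \<open>
  The triangles at \<open>x\<close> that have another vertex in \<open>W\<close> are coherent at each edge through \<open>x\<close>.
\<close>

lemma link_connected:
  assumes T: "closed_surface T" and W: "link_edge T x a b" "a \<in> W"
    and closed: "\<And>p q. p \<in> W \<Longrightarrow> link_edge T x p q \<Longrightarrow> q \<in> W"
  shows "nbrs T x \<subseteq> W"
proof
  fix u assume "u \<in> nbrs T x"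
  then obtain v where uv: "link_edge T x u v" using nbrs_link_edge[OF T] by blast
  let ?U = "{t\<in>T. x \<in> t \<and> t \<inter> (W - {x}) \<noteq> {}}"
  have in_W: "t - {x} \<subseteq> W" if t: "t \<in> ?U" for t
  proof
    fix q assume q: "q \<in> t - {x}"
    obtain p where p: "p \<in> t" "p \<in> W" "p \<noteq> x" using t by blast
    show "q \<in> W"
    proof (cases "p = q")
      case False
      have tT: "t \<in> T" "x \<in> t" using t by blast+
      obtain r where "t = {x, p, r}" "r \<noteq> x" "r \<noteq> p"
        using triangle_third[OF closed_surfaceD(3)[OF T tT(1)] tT(2) p(1)] p(3) by metis
      then have "t = {x, p, q}" using q False by auto
      then have "link_edge T x p q" using tT q p False by (auto simp: link_edge_def)
      then show ?thesis using closed p(2) by blast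
    qed (use p in simp)
  qed
  have "coherent T ?U {x, y}" if "y \<noteq> x" for y
  proof (cases "y \<in> W")
    case True
    then show ?thesis using that unfolding coherent_def by blast
  next
    case False
    then have "t \<notin> ?U" if "{x, y} \<subseteq> t" for t using in_W[of t] that \<open>y \<noteq> x\<close> by blast
    then show ?thesis unfolding coherent_def by blast
  qed
  then have c: "coherent T ?U {x}" by (rule closed_surfaceD(5)[OF T])
  have ab: "{x, a, b} \<in> T" "a \<noteq> x" using W(1) by (auto simp: link_edge_def)
  have "{x, a, b} \<in> ?U" using ab W(2) by simp
  moreover have "{x, u, v} \<in> T" "u \<noteq> x" using uv by (auto simp: link_edge_def)
  ultimately have "{x, u, v} \<in> ?U" using coherentD[OF c ab(1), of "{x, u, v}"] by simp
  then show "u \<in> W" using in_W \<open>u \<noteq> x\<close> by blast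
qed

text \<open>
  Walk around the link from \<open>a\<close>. A vertex already visited can only be reached again if it is the
  starting point, because the others have their two neighbours in the link already; and six different
  vertices are too many.
\<close>

lemma link_cycle_cases:
  assumes T: "closed_surface T" and x: "x \<in> \<Union>T" and le: "card (nbrs T x) \<le> 5"
  obtains
    (three) a b c where "distinct [a, b, c]" "nbrs T x = {a, b, c}"
      "link_edge T x a b" "link_edge T x b c" "link_edge T x c a"
  | (four) a b c d where "distinct [a, b, c, d]" "nbrs T x = {a, b, c, d}"
      "link_edge T x a b" "link_edge T x b c" "link_edge T x c d" "link_edge T x d a"
  | (five) a b c d e where "distinct [a, b, c, d, e]" "nbrs T x = {a, b, c, d, e}"
      "link_edge T x a b" "link_edge T x b c" "link_edge T x c d" "link_edge T x d e" "link_edge T x e a"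
proof -
  let ?L = "link_edge T x"
  note sym = link_edge_sym[of T x]
  have ne: "p \<noteq> q" if "?L p q" for p q using that by (simp add: link_edge_def)
  obtain t where t: "t \<in> T" "x \<in> t" using x by blast
  have "\<not> t \<subseteq> {x}" using card_mono[of "{x}" t] closed_surfaceD(3)[OF T t(1)] by auto
  then obtain a where "a \<in> t" "a \<noteq> x" by blast
  then have "a \<in> nbrs T x" using adjI[OF t(1,2)] by (simp add: nbrs_def)
  then obtain b where ab: "?L a b" using nbrs_link_edge[OF T] by blast
  obtain c where c: "c \<noteq> a" "?L b c" "\<forall>s. ?L b s \<longrightarrow> s = a \<or> s = c" using link_next[OF T ab] .
  obtain d where d: "d \<noteq> b" "?L c d" "\<forall>s. ?L c s \<longrightarrow> s = b \<or> s = d" using link_next[OF T c(2)] .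
  obtain g where g: "g \<noteq> b" "?L a g" "\<forall>s. ?L a s \<longrightarrow> s = b \<or> s = g" using link_next[OF T sym[OF ab]] .
  show thesis
  proof (cases "d = a")
    case True
    then have "g = c" using g(3) d(2) sym[OF d(2)] c ne[OF c(2)] by blast
    have "nbrs T x \<subseteq> {a, b, c}"
      by (rule link_connected[OF T ab]) (use c(3) d(3) g(3) True \<open>g = c\<close> in blast)+
    moreover have "{a, b, c} \<subseteq> nbrs T x" using link_edge_nbrs[of T x] ab c(2) d(2) by blast
    ultimately show ?thesis using three[of a b c] ab c d True ne by auto
  next
    case da: False
    have dist4: "distinct [a, b, c, d]" using ne[OF ab] ne[OF c(2)] ne[OF d(2)] c(1) d(1) da by auto
    obtain e where e: "e \<noteq> c" "?L d e" "\<forall>s. ?L d s \<longrightarrow> s = c \<or> s = e" using link_next[OF T d(2)] .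
    have "e \<noteq> b" using c(3) sym[OF e(2)] dist4 by auto
    show ?thesis
    proof (cases "e = a")
      case True
      then have "g = d" using g(3) sym[OF e(2)] dist4 by auto
      have "nbrs T x \<subseteq> {a, b, c, d}"
        by (rule link_connected[OF T ab]) (use c(3) d(3) e(3) g(3) True \<open>g = d\<close> in blast)+
      moreover have "{a, b, c, d} \<subseteq> nbrs T x" using link_edge_nbrs[of T x] ab c(2) d(2) e(2) by blast
      ultimately show ?thesis using four[OF dist4 _ ab c(2) d(2)] e(2) True by blast
    next
      case ea: False
      have dist5: "distinct [a, b, c, d, e]" using dist4 ea \<open>e \<noteq> b\<close> e(1) ne[OF e(2)] by auto
      obtain f where f: "f \<noteq> d" "?L e f" "\<forall>s. ?L e s \<longrightarrow> s = d \<or> s = f" using link_next[OF T e(2)] .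
      have "f \<noteq> b" using c(3) sym[OF f(2)] dist5 by auto
      have "f \<noteq> c" using d(3) sym[OF f(2)] dist5 by auto
      show ?thesis
      proof (cases "f = a")
        case True
        then have "g = e" using g(3) sym[OF f(2)] dist5 by auto
        have "nbrs T x \<subseteq> {a, b, c, d, e}"
          by (rule link_connected[OF T ab]) (use c(3) d(3) e(3) f(3) g(3) True \<open>g = e\<close> in blast)+
        moreover have "{a, b, c, d, e} \<subseteq> nbrs T x"
          using link_edge_nbrs[of T x] ab c(2) d(2) e(2) f(2) by blast
        ultimately show ?thesis using five[OF dist5 _ ab c(2) d(2) e(2)] f(2) True by blast
      next
        case False
        have "distinct [a, b, c, d, e, f]"
          using dist5 False \<open>f \<noteq> b\<close> \<open>f \<noteq> c\<close> f(1) ne[OF f(2)] by auto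
        then have "card {a, b, c, d, e, f} = 6" by simp
        moreover have "{a, b, c, d, e, f} \<subseteq> nbrs T x"
          using link_edge_nbrs[of T x] ab c(2) d(2) e(2) f(2) sym[OF f(2)] by blast
        ultimately have "6 \<le> card (nbrs T x)"
          using card_mono[OF finite_nbrs[OF T, of x], of "{a, b, c, d, e, f}"] by simp
        then show ?thesis using le by simp
      qed
    qed
  qed
qed

section \<open>Removing a vertex of degree three\<close>

lemma card_le_4: "card {p, q, r, s} \<le> 4"
proof -
  have "card (set [p, q, r, s]) \<le> length [p, q, r, s]" by (rule card_length)
  then show ?thesis by simp
qed

locale degree_3_vertex =
  fixes T :: "'a set set" and x a b c :: 'a
  assumes T: "two_sphere T"
    and dist: "distinct [a, b, c]" and nbrs: "nbrs T x = {a, b, c}"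
    and tri: "link_edge T x a b" "link_edge T x b c" "link_edge T x c a"
    and big: "5 \<le> card (\<Union>T)"
begin

lemma S: "closed_surface T"
  using T by (simp add: two_sphere_def)

lemma triT: "{x, a, b} \<in> T" "{x, b, c} \<in> T" "{x, c, a} \<in> T"
  using tri by (simp_all add: link_edge_def)

lemma xdist: "x \<noteq> a" "x \<noteq> b" "x \<noteq> c" "a \<noteq> b" "b \<noteq> c" "c \<noteq> a"
  using tri dist by (auto simp: link_edge_def)

lemma star: "t \<in> T \<Longrightarrow> x \<in> t \<longleftrightarrow> t = {x, a, b} \<or> t = {x, b, c} \<or> t = {x, c, a}"
proof
  assume t: "t \<in> T" "x \<in> t"
  have sub: "t - {x} \<subseteq> {a, b, c}" using t unfolding nbrs[symmetric] nbrs_def adj_def by blast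
  have c2: "card (t - {x}) = 2" using t closed_surfaceD(3)[OF S t(1)] triangle_finite[OF S t(1)] by simp
  then obtain p q where pq: "t - {x} = {p, q}" "p \<noteq> q" unfolding card_2_iff by blast
  then have tx: "t = {x, p, q}" using t(2) by blast
  have "p = a \<or> p = b \<or> p = c" "q = a \<or> q = b \<or> q = c" using sub pq(1) by auto
  then show "t = {x, a, b} \<or> t = {x, b, c} \<or> t = {x, c, a}"
    unfolding tx using pq(2) by (elim disjE) (simp_all add: insert_commute)
qed auto

text \<open>
  Otherwise \<open>abc\<close> and the three triangles at \<open>x\<close> form a closed surface, the boundary of a tetrahedron,
  which would be everything.
\<close>

lemma not_face: "{a, b, c} \<notin> T"
proof
  assume abc: "{a, b, c} \<in> T"
  define U where "U = {{x, a, b}, {x, b, c}, {x, c, a}, {a, b, c}}"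
  have memU: "r \<in> U \<longleftrightarrow> r = {x, a, b} \<or> r = {x, b, c} \<or> r = {x, c, a} \<or> r = {a, b, c}" for r
    by (simp add: U_def)
  have "x \<notin> {a, b, c}" using xdist by simp
  then have ne: "{x, p, q} \<noteq> {a, b, c}" for p q by blast
  have ab: "r = {x, a, b} \<or> r = {a, b, c}" if "r \<in> T" "{a, b} \<subseteq> r" for r
    by (rule two_triangles[OF S xdist(4) triT(1) _ abc _ ne that]) simp_all
  have bc: "r = {x, b, c} \<or> r = {a, b, c}" if "r \<in> T" "{b, c} \<subseteq> r" for r
    by (rule two_triangles[OF S xdist(5) triT(2) _ abc _ ne that]) simp_all
  have ca: "r = {x, c, a} \<or> r = {a, b, c}" if "r \<in> T" "{c, a} \<subseteq> r" for r
    by (rule two_triangles[OF S xdist(6) triT(3) _ abc _ ne that]) simp_all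
  have in_U: "r \<in> U" if r: "r \<in> T" "t \<in> U" "{u, v} \<subseteq> t" "{u, v} \<subseteq> r" "u \<noteq> v" for r t u v
  proof (cases "x \<in> r")
    case True then show ?thesis using star[OF r(1)] memU by blast
  next
    case False
    then have "x \<noteq> u" "x \<noteq> v" using r(4) by auto
    moreover have "t \<subseteq> {x, a, b, c}" using r(2) unfolding memU by (elim disjE) simp_all
    ultimately have uv: "u = a \<or> u = b \<or> u = c" "v = a \<or> v = b \<or> v = c" using r(3) by auto
    have "{a, b} \<subseteq> r \<or> {b, c} \<subseteq> r \<or> {c, a} \<subseteq> r" using uv r(4,5) by (elim disjE) simp_all
    then show ?thesis using ab[OF r(1)] bc[OF r(1)] ca[OF r(1)] memU[of r] by argo
  qed
  have coh: "coherent T U {u, v}" if "u \<noteq> v" for u v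
  proof (cases "\<exists>t\<in>U. {u, v} \<subseteq> t")
    case True
    then obtain t where t: "t \<in> U" "{u, v} \<subseteq> t" by blast
    have "\<forall>r\<in>T. {u, v} \<subseteq> r \<longrightarrow> r \<in> U" by (intro ballI impI in_U[OF _ t _ that])
    then show ?thesis unfolding coherent_def by (rule disjI1)
  next
    case False
    then have "\<forall>r\<in>T. {u, v} \<subseteq> r \<longrightarrow> r \<notin> U" by blast
    then show ?thesis unfolding coherent_def by (rule disjI2)
  qed
  have "T \<subseteq> U \<or> T \<inter> U = {}"
  proof (rule all_or_none[OF S])
    show "coherent T U {y}" for y by (rule closed_surfaceD(5)[OF S]) (use coh in simp)
  qed
  moreover have "{a, b, c} \<in> U" by (simp add: memU)
  ultimately have "T \<subseteq> U" using abc by blast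
  then have "card T \<le> card U" by (rule card_mono[rotated]) (simp add: U_def)
  also have "\<dots> \<le> 4" unfolding U_def by (rule card_le_4)
  finally show False using big T by (simp add: two_sphere_def)
qed

text \<open>
  The far side of the curve \<open>abc\<close>, capped with the triangle \<open>abc\<close>.
\<close>

definition removed :: "'a set set" where
  "removed = insert {a, b, c} {t\<in>T. x \<notin> t}"

lemma split_cond:
  assumes "u \<noteq> v"
  shows "coherent T {t\<in>T. x \<notin> t} {u, v} \<longleftrightarrow> \<not> {u, v} \<subseteq> {a, b, c}"
proof -
  have other: "\<exists>s\<in>T. x \<notin> s \<and> {p, q} \<subseteq> s" if pq: "{x, p, q} \<in> T" "p \<noteq> q" "x \<noteq> p" "x \<noteq> q"
    "\<And>t. t \<in> T \<Longrightarrow> x \<in> t \<Longrightarrow> {p, q} \<subseteq> t \<Longrightarrow> t = {x, p, q}" for p q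
    using other_triangle[OF S pq(1), of p q] pq(2,5) by (metis insert_subset subset_insertI)
  have ab: "\<exists>s\<in>T. x \<notin> s \<and> {a, b} \<subseteq> s"
    by (rule other) (use star xdist triT in auto)
  have bc: "\<exists>s\<in>T. x \<notin> s \<and> {b, c} \<subseteq> s"
    by (rule other) (use star xdist triT in auto)
  have ca: "\<exists>s\<in>T. x \<notin> s \<and> {c, a} \<subseteq> s"
    by (rule other) (use star xdist triT in auto)
  show ?thesis
  proof
    assume c: "coherent T {t\<in>T. x \<notin> t} {u, v}"
    show "\<not> {u, v} \<subseteq> {a, b, c}"
    proof
      assume "{u, v} \<subseteq> {a, b, c}"
      then have "u = a \<or> u = b \<or> u = c" "v = a \<or> v = b \<or> v = c" by simp_all
      then have "\<exists>s\<in>T. x \<in> s \<and> {u, v} \<subseteq> s" "\<exists>s\<in>T. x \<notin> s \<and> {u, v} \<subseteq> s"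
        using assms bexI[OF _ triT(1), of "\<lambda>s. x \<in> s \<and> {u, v} \<subseteq> s"]
          bexI[OF _ triT(2), of "\<lambda>s. x \<in> s \<and> {u, v} \<subseteq> s"] bexI[OF _ triT(3), of "\<lambda>s. x \<in> s \<and> {u, v} \<subseteq> s"] ab bc ca
        by (auto simp: insert_commute)
      then show False using c unfolding coherent_def by blast
    qed
  next
    assume n: "\<not> {u, v} \<subseteq> {a, b, c}"
    show "coherent T {t\<in>T. x \<notin> t} {u, v}"
    proof (cases "x \<in> {u, v}")
      case True
      then show ?thesis unfolding coherent_def by blast
    next
      case False
      have "x \<notin> t" if "t \<in> T" "{u, v} \<subseteq> t" for t
      proof
        assume "x \<in> t"
        then have "t \<subseteq> {x, a, b, c}" using star[OF that(1)] by auto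
        then show False using that(2) n False by auto
      qed
      then show ?thesis unfolding coherent_def by blast
    qed
  qed
qed

lemma card_abc: "card {a, b, c} = 3"
  using dist by simp

lemma outside_subset: "{t\<in>T. x \<notin> t} \<subseteq> T"
  by blast

lemma split_cond_all:
  "\<forall>u v. u \<noteq> v \<longrightarrow> coherent T {t\<in>T. x \<notin> t} {u, v} \<longleftrightarrow> \<not> {u, v} \<subseteq> {a, b, c}"
  using split_cond by blast

lemmas split = split_sphere[OF T card_abc not_face outside_subset split_cond_all, folded removed_def]

lemma removed_sphere: "two_sphere removed"
  by (rule split(1))

lemma star_verts: "\<Union>(insert {a, b, c} (T - {t\<in>T. x \<notin> t})) = {x, a, b, c}"
proof
  show "\<Union>(insert {a, b, c} (T - {t\<in>T. x \<notin> t})) \<subseteq> {x, a, b, c}" using star by auto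
  have "{x, a, b} \<in> T - {t\<in>T. x \<notin> t}" using triT by simp
  then show "{x, a, b, c} \<subseteq> \<Union>(insert {a, b, c} (T - {t\<in>T. x \<notin> t}))" by blast
qed

lemma verts_removed: "\<Union>removed = \<Union>T - {x}"
proof -
  have i: "\<Union>removed \<inter> {x, a, b, c} = {a, b, c}" using split(3) unfolding star_verts by blast
  have u: "\<Union>removed \<union> {x, a, b, c} = \<Union>T" using split(4) unfolding star_verts by blast
  have "x \<notin> \<Union>removed" using i xdist by blast
  then show ?thesis using i u by blast
qed

lemma adj_removed: "adj removed u v \<longleftrightarrow> adj T u v \<and> u \<noteq> x \<and> v \<noteq> x"
proof
  assume a: "adj removed u v"
  then have V: "u \<in> \<Union>removed" "v \<in> \<Union>removed" by (auto simp: adj_def)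
  then show "adj T u v \<and> u \<noteq> x \<and> v \<noteq> x" using split(7)[OF V] a unfolding verts_removed by simp
next
  assume a: "adj T u v \<and> u \<noteq> x \<and> v \<noteq> x"
  then have "u \<in> \<Union>T" "v \<in> \<Union>T" by (auto simp: adj_def)
  then have V: "u \<in> \<Union>removed" "v \<in> \<Union>removed" using a unfolding verts_removed by simp_all
  show "adj removed u v" using split(7)[OF V] a by simp
qed

lemma ncomp_removed: "A \<subseteq> \<Union>T - {x} \<Longrightarrow> ncomp (adj removed) A = ncomp (adj T) A"
  by (rule ncomp_cong) (use adj_removed in blast)

text \<open>
  The near side of the curve \<open>abc\<close> is a tetrahedron with expected number of components \<open>4/5\<close>, of which
  \<open>3/4\<close> is absorbed by the gluing.
\<close>

theorem avg_removed:
  "avg (\<Union>T) (\<lambda>A. real (ncomp (adj T) A)) = avg (\<Union>removed) (\<lambda>A. real (ncomp (adj removed) A)) + 1 / 20"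
proof -
  have fin: "finite (\<Union>T)" by (rule surface_finite_verts[OF S])
  have abcV: "{a, b, c} \<subseteq> \<Union>T - {x}" using nbrs nbrs_subset[of T x] by simp
  have xV: "x \<in> \<Union>T" using triT by blast
  have un: "(\<Union>T - {x}) \<union> {x, a, b, c} = \<Union>T" using abcV xV by blast
  have adj12: "adj T x a" "adj T x b" "adj T x c" "adj T a b" "adj T b c" "adj T c a"
    using adjI[OF triT(1)] adjI[OF triT(2)] adjI[OF triT(3)] xdist by simp_all
  have ad: "adj T p q" if "p \<in> {x, a, b, c}" "q \<in> {x, a, b, c}" "p \<noteq> q" for p q
  proof -
    have "p = x \<or> p = a \<or> p = b \<or> p = c" "q = x \<or> q = a \<or> q = b \<or> q = c" using that by simp_all
    then show ?thesis using that(3) adj12 adj12[THEN sympD[OF symp_adj]] by (elim disjE) simp_all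
  qed
  have "avg ((\<Union>T - {x}) \<union> {x, a, b, c}) (\<lambda>A. real (ncomp (adj T) A)) =
    avg (\<Union>T - {x}) (\<lambda>A. real (ncomp (adj T) A)) + avg {x, a, b, c} (\<lambda>A. real (ncomp (adj T) A)) - 3 / 4"
  proof (rule avg_ncomp_glue[OF _ _ symp_adj _ card_abc])
    show "(\<Union>T - {x}) \<inter> {x, a, b, c} = {a, b, c}" using abcV by blast
    show "adj T u v" if "u \<in> {a, b, c}" "v \<in> {a, b, c}" "u \<noteq> v" for u v using ad that by blast
    show "u \<in> \<Union>T - {x} \<and> v \<in> \<Union>T - {x} \<or> u \<in> {x, a, b, c} \<and> v \<in> {x, a, b, c}" if uv: "adj T u v" for u v
    proof -
      have V: "u \<in> \<Union>T" "v \<in> \<Union>T" using uv by (auto simp: adj_def)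
      have "v \<in> {a, b, c}" if "u = x" using uv nbrs that unfolding nbrs_def by blast
      moreover have "u \<in> {a, b, c}" if "v = x" using sympD[OF symp_adj uv] nbrs that unfolding nbrs_def by blast
      ultimately show ?thesis using V by blast
    qed
  qed (use fin in auto)
  moreover have "avg {x, a, b, c} (\<lambda>A. real (ncomp (adj T) A)) = 4 / 5"
    using avg_clique[of "{x, a, b, c}" "adj T", OF _ symp_adj ad] xdist by simp
  moreover have "avg (\<Union>T - {x}) (\<lambda>A. real (ncomp (adj T) A)) = avg (\<Union>removed) (\<lambda>A. real (ncomp (adj removed) A))"
    unfolding verts_removed by (rule avg_cong) (simp add: ncomp_removed)
  ultimately show ?thesis unfolding un by simp
qed

end

section \<open>The bound for triangulated 2-spheres\<close>

definition sphere_avg :: "'a set set \<Rightarrow> real" where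
  "sphere_avg T = avg (\<Union>T) (\<lambda>A. real (ncomp (adj T) A))"

lemma tetrahedron_adj:
  assumes T: "two_sphere T" and four: "card (\<Union>T) = 4" and uv: "u \<in> \<Union>T" "v \<in> \<Union>T" "u \<noteq> v"
  shows "adj T u v"
proof -
  have S: "closed_surface T" and cT: "card T = 4" using T four by (auto simp: two_sphere_def)
  note fV = surface_finite_verts[OF S]
  have "T = {s. s \<subseteq> \<Union>T \<and> card s = 3}"
  proof (rule card_subset_eq)
    show "finite {s. s \<subseteq> \<Union>T \<and> card s = 3}" using fV by simp
    show "T \<subseteq> {s. s \<subseteq> \<Union>T \<and> card s = 3}" using closed_surfaceD(3)[OF S] by blast
    have "(4::nat) choose 3 = 4" by (simp add: numeral_eq_Suc)
    then show "card T = card {s. s \<subseteq> \<Union>T \<and> card s = 3}" using n_subsets[OF fV, of 3] four cT by simp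
  qed
  moreover have "\<exists>s. {u, v} \<subseteq> s \<and> s \<subseteq> \<Union>T \<and> card s = 3"
    using exists_subset_between[of "{u, v}" 3 "\<Union>T"] uv four fV by auto
  ultimately have "\<exists>s\<in>T. {u, v} \<subseteq> s" by blast
  then show ?thesis using uv(3) by (auto simp: adj_def)
qed

lemma nbrs_eq_star:
  assumes "{t\<in>T'. u \<in> t} = {t\<in>T. u \<in> t}" shows "nbrs T' u = nbrs T u"
proof -
  have "nbrs T u = \<Union>{t\<in>T. u \<in> t} - {u}" for T :: "'a set set" by (auto simp: nbrs_def adj_def)
  then show ?thesis using assms by metis
qed

text \<open>
  Used for the two pieces of a split sphere: a degree 3 vertex off the cutting triangle keeps its star
  when the pieces are reassembled.
\<close>

lemma degree_3_off_triangle: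
  assumes T: "two_sphere T" and t0: "t0 \<in> T"
    and ex: "5 \<le> card (\<Union>T) \<Longrightarrow> \<exists>u v. u \<noteq> v \<and> \<not> adj T u v \<and> card (nbrs T u) = 3 \<and> card (nbrs T v) = 3"
  shows "\<exists>u\<in>\<Union>T - t0. card (nbrs T u) = 3"
proof (cases "5 \<le> card (\<Union>T)")
  case True
  then obtain u v where uv: "u \<noteq> v" "\<not> adj T u v" "card (nbrs T u) = 3" "card (nbrs T v) = 3" using ex by blast
  have V: "w \<in> \<Union>T" if "card (nbrs T w) = 3" for w
  proof -
    have "nbrs T w \<noteq> {}" using that by auto
    then show ?thesis by (auto simp: nbrs_def adj_def)
  qed
  have "\<not> (u \<in> t0 \<and> v \<in> t0)" using uv(1,2) adjI[OF t0] by blast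
  then show ?thesis using V uv(3,4) by blast
next
  case False
  have S: "closed_surface T" using T by (simp add: two_sphere_def)
  have four: "card (\<Union>T) = 4" using False surface_card_verts[OF S] by simp
  have sub: "t0 \<subseteq> \<Union>T" using t0 by blast
  have fV: "finite (\<Union>T)" by (rule surface_finite_verts[OF S])
  have "card (\<Union>T - t0) = 1"
    using card_Diff_subset[OF finite_subset[OF sub fV] sub] closed_surfaceD(3)[OF S t0] four by simp
  then obtain u where u: "u \<in> \<Union>T - t0" by (metis card_1_singletonE singletonI)
  have "nbrs T u = \<Union>T - {u}"
    using nbrs_subset[of T u] tetrahedron_adj[OF T four, of u] u by (auto simp: nbrs_def)
  then have "card (nbrs T u) = 3" using u four fV by simp
  then show ?thesis using u by blast
qed

text \<open>
  A chord of the link would span a triangle with \<open>x\<close>, and then the edge \<open>xq\<close> would lie in three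
  triangles.
\<close>

lemma no_link_chord:
  assumes T: "closed_surface T"
    and flag: "\<And>a b c. a \<noteq> b \<Longrightarrow> b \<noteq> c \<Longrightarrow> c \<noteq> a \<Longrightarrow> adj T a b \<Longrightarrow> adj T b c \<Longrightarrow> adj T c a \<Longrightarrow> {a, b, c} \<in> T"
    and L: "link_edge T x p q" "link_edge T x q r" "p \<noteq> r" and q: "s \<in> nbrs T x" "s \<notin> {p, q, r}"
  shows "\<not> adj T q s"
proof
  assume a: "adj T q s"
  have f: "{x, p, q} \<in> T" "{x, q, r} \<in> T" "x \<noteq> q" "x \<noteq> p" "x \<noteq> r" "p \<noteq> q" "q \<noteq> r"
    using L by (auto simp: link_edge_def)
  have xs: "adj T x s" "x \<noteq> s" using q by (auto simp: nbrs_def adj_def)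
  have xq: "adj T x q" using adjI[OF f(1), of x q] f(3) by simp
  have "q \<noteq> s" using q(2) by auto
  then have t: "{x, q, s} \<in> T" using flag[of x q s] xq a sympD[OF symp_adj xs(1)] xs(2) f(3) by blast
  have "p \<notin> {x, q, r}" using L(3) f by simp
  then have ne: "{x, p, q} \<noteq> {x, q, r}" by blast
  have "{x, q, s} = {x, p, q} \<or> {x, q, s} = {x, q, r}"
    by (rule two_triangles[OF T f(3,1) _ f(2) _ ne t]) simp_all
  moreover have "s \<notin> {x, p, q}" "s \<notin> {x, q, r}" using q(2) xs(2) by auto
  ultimately show False by blast
qed

lemma nbrs_flip:
  assumes "edge_flip T x p q r"
  shows "nbrs (edge_flip.flipped T x p q r) x = nbrs T x - {q}"
proof -
  interpret edge_flip T x p q r by fact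
  show ?thesis
    unfolding nbrs_def adj_flipped using distinct by (auto simp: doubleton_eq_iff)
qed

lemma degree_4_sphere:
  assumes T: "two_sphere T" and big: "5 \<le> card (\<Union>T)"
    and flag: "\<And>a b c. a \<noteq> b \<Longrightarrow> b \<noteq> c \<Longrightarrow> c \<noteq> a \<Longrightarrow> adj T a b \<Longrightarrow> adj T b c \<Longrightarrow> adj T c a \<Longrightarrow> {a, b, c} \<in> T"
    and dist: "distinct [a, b, c, d]" and N: "nbrs T x = {a, b, c, d}"
    and L: "link_edge T x a b" "link_edge T x b c" "link_edge T x c d" "link_edge T x d a"
  shows "\<exists>T'. two_sphere T' \<and> \<Union>T' = \<Union>T - {x} \<and> sphere_avg T < sphere_avg T' + 1 / 20"
proof -
  have S: "closed_surface T" using T by (simp add: two_sphere_def)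
  have tri: "{x, a, b} \<in> T" "{x, b, c} \<in> T" "{x, c, d} \<in> T" "{x, d, a} \<in> T"
    and xd: "x \<noteq> a" "x \<noteq> b" "x \<noteq> c" "x \<noteq> d"
    using L by (auto simp: link_edge_def)
  have d: "a \<noteq> b" "a \<noteq> c" "a \<noteq> d" "b \<noteq> c" "b \<noteq> d" "c \<noteq> d" using dist by auto
  have nac: "\<not> adj T a c"
    by (rule no_link_chord[OF S flag L(4,1), of c], assumption+) (use N d in auto)
  have nbd: "\<not> adj T b d"
    by (rule no_link_chord[OF S flag L(1,2), of d], assumption+) (use N d in auto)
  interpret F: edge_flip T x a b c
    by unfold_locales (use S tri xd d nac in auto)
  let ?T1 = "F.flipped"
  have T1: "two_sphere ?T1" by (rule F.flipped_sphere[OF T])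
  have mem1: "link_edge ?T1 x a c" "link_edge ?T1 x c d" "link_edge ?T1 x d a"
  proof -
    have "d \<notin> {x, a, b}" "d \<notin> {x, b, c}" using d xd by auto
    then have "{x, c, d} \<in> ?T1" "{x, d, a} \<in> ?T1" using tri(3,4) unfolding F.flipped_cases by blast+
    moreover have "{x, a, c} \<in> ?T1" by (simp add: F.flipped_cases)
    ultimately show "link_edge ?T1 x a c" "link_edge ?T1 x c d" "link_edge ?T1 x d a"
      using xd d by (simp_all add: link_edge_def)
  qed
  have N1: "nbrs ?T1 x = {a, c, d}"
    using nbrs_flip[OF F.edge_flip_axioms] N d by auto
  interpret R: degree_3_vertex ?T1 x a c d
    by unfold_locales (use T1 N1 mem1 d big F.Union_flipped in auto)
  let ?E' = "\<lambda>u v. adj T u v \<or> {u, v} = {a, c}"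
  have V: "\<Union>R.removed = \<Union>T - {x}" using R.verts_removed F.Union_flipped by simp
  have xS: "{x, a, b, c, d} \<subseteq> \<Union>T" using tri by blast
  have "avg (\<Union>T) (\<lambda>A. real (ncomp (adj T) A)) < avg (\<Union>T - {x}) (\<lambda>A. real (ncomp ?E' A)) + 1 / 20"
  proof (rule degree_4_bound[OF surface_finite_verts[OF S] symp_adj xS])
    show "card {x, a, b, c, d} = 5" using xd d by simp
    show "adj T x y \<longleftrightarrow> y \<in> {a, b, c, d}" for y using N by (auto simp: nbrs_def)
    show "adj T a b" "adj T b c" "adj T c d" "adj T d a"
      using adjI[OF tri(1)] adjI[OF tri(2)] adjI[OF tri(3)] adjI[OF tri(4)] d by simp_all
  qed (rule nbd)
  also have "avg (\<Union>T - {x}) (\<lambda>A. real (ncomp ?E' A)) = sphere_avg R.removed"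
    unfolding sphere_avg_def V
  proof (rule avg_cong)
    fix A assume A: "A \<subseteq> \<Union>T - {x}"
    have "ncomp ?E' A = ncomp (adj R.removed) A"
    proof (rule ncomp_cong)
      fix u v assume "u \<in> A" "v \<in> A"
      then have "u \<noteq> x" "v \<noteq> x" using A by blast+
      then show "?E' u v \<longleftrightarrow> adj R.removed u v"
        unfolding R.adj_removed F.adj_flipped by (auto simp: doubleton_eq_iff)
    qed
    then show "real (ncomp ?E' A) = real (ncomp (adj R.removed) A)" by simp
  qed
  finally show ?thesis using R.removed_sphere V unfolding sphere_avg_def by blast
qed

lemma degree_5_sphere:
  assumes T: "two_sphere T" and big: "5 \<le> card (\<Union>T)"
    and flag: "\<And>a b c. a \<noteq> b \<Longrightarrow> b \<noteq> c \<Longrightarrow> c \<noteq> a \<Longrightarrow> adj T a b \<Longrightarrow> adj T b c \<Longrightarrow> adj T c a \<Longrightarrow> {a, b, c} \<in> T"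
    and dist: "distinct [a, b, c, d, e]" and N: "nbrs T x = {a, b, c, d, e}"
    and L: "link_edge T x a b" "link_edge T x b c" "link_edge T x c d" "link_edge T x d e" "link_edge T x e a"
  shows "\<exists>T'. two_sphere T' \<and> \<Union>T' = \<Union>T - {x} \<and> sphere_avg T < sphere_avg T' + 1 / 20"
proof -
  have S: "closed_surface T" using T by (simp add: two_sphere_def)
  have tri: "{x, a, b} \<in> T" "{x, b, c} \<in> T" "{x, c, d} \<in> T" "{x, d, e} \<in> T" "{x, e, a} \<in> T"
    and xd: "x \<noteq> a" "x \<noteq> b" "x \<noteq> c" "x \<noteq> d" "x \<noteq> e"
    using L by (auto simp: link_edge_def)
  have d: "a \<noteq> b" "a \<noteq> c" "a \<noteq> d" "a \<noteq> e" "b \<noteq> c" "b \<noteq> d" "b \<noteq> e" "c \<noteq> d" "c \<noteq> e" "d \<noteq> e"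
    using dist by auto
  have nac: "\<not> adj T a c"
    by (rule no_link_chord[OF S flag L(5,1), of c], assumption+) (use N d in auto)
  have nad: "\<not> adj T a d"
    by (rule no_link_chord[OF S flag L(5,1), of d], assumption+) (use N d in auto)
  have nbe: "\<not> adj T b e"
    by (rule no_link_chord[OF S flag L(1,2), of e], assumption+) (use N d in auto)
  interpret F: edge_flip T x a b c
    by unfold_locales (use S tri xd d nac in auto)
  let ?T1 = "F.flipped"
  have T1: "two_sphere ?T1" by (rule F.flipped_sphere[OF T])
  have mem1: "{x, a, c} \<in> ?T1" "{x, c, d} \<in> ?T1" "{x, d, e} \<in> ?T1" "{x, e, a} \<in> ?T1"
  proof -
    have "d \<notin> {x, a, b}" "d \<notin> {x, b, c}" "e \<notin> {x, a, b}" "e \<notin> {x, b, c}" using d xd by auto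
    then show "{x, c, d} \<in> ?T1" "{x, d, e} \<in> ?T1" "{x, e, a} \<in> ?T1"
      using tri(3-5) unfolding F.flipped_cases by blast+
  qed (simp add: F.flipped_cases)
  have "\<not> adj ?T1 d a"
    using nad sympD[OF symp_adj, of T d a] d unfolding F.adj_flipped by (auto simp: doubleton_eq_iff)
  then interpret G: edge_flip ?T1 x d e a
    by unfold_locales (use F.flipped_surface mem1 xd d in auto)
  let ?T2 = "G.flipped"
  have T2: "two_sphere ?T2" by (rule G.flipped_sphere[OF T1])
  have mem2: "link_edge ?T2 x a c" "link_edge ?T2 x c d" "link_edge ?T2 x d a"
  proof -
    have "c \<notin> {x, d, e}" "c \<notin> {x, e, a}" using d xd by auto
    then have "{x, a, c} \<in> ?T2" "{x, c, d} \<in> ?T2" using mem1(1,2) unfolding G.flipped_cases by blast+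
    moreover have "{x, d, a} \<in> ?T2" by (simp add: G.flipped_cases)
    ultimately show "link_edge ?T2 x a c" "link_edge ?T2 x c d" "link_edge ?T2 x d a"
      using xd d by (simp_all add: link_edge_def)
  qed
  have N2: "nbrs ?T2 x = {a, c, d}"
    using nbrs_flip[OF G.edge_flip_axioms] nbrs_flip[OF F.edge_flip_axioms] N d by auto
  interpret R: degree_3_vertex ?T2 x a c d
    by unfold_locales (use T2 N2 mem2 d big G.Union_flipped F.Union_flipped in auto)
  let ?E' = "\<lambda>u v. adj T u v \<or> {u, v} = {a, c} \<or> {u, v} = {a, d}"
  have V: "\<Union>R.removed = \<Union>T - {x}" using R.verts_removed G.Union_flipped F.Union_flipped by simp
  have xS: "{x, a, b, c, d, e} \<subseteq> \<Union>T" using tri by blast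
  have "avg (\<Union>T) (\<lambda>A. real (ncomp (adj T) A)) < avg (\<Union>T - {x}) (\<lambda>A. real (ncomp ?E' A)) + 1 / 20"
  proof (rule degree_5_bound[OF surface_finite_verts[OF S] symp_adj xS])
    show "card {x, a, b, c, d, e} = 6" using xd d by simp
    show "adj T x y \<longleftrightarrow> y \<in> {a, b, c, d, e}" for y using N by (auto simp: nbrs_def)
    show "adj T a b" "adj T b c" "adj T c d" "adj T d e" "adj T e a"
      using adjI[OF tri(1)] adjI[OF tri(2)] adjI[OF tri(3)] adjI[OF tri(4)] adjI[OF tri(5)] d by simp_all
  qed (rule nbe)
  also have "avg (\<Union>T - {x}) (\<lambda>A. real (ncomp ?E' A)) = sphere_avg R.removed"
    unfolding sphere_avg_def V
  proof (rule avg_cong)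
    fix A assume A: "A \<subseteq> \<Union>T - {x}"
    have "ncomp ?E' A = ncomp (adj R.removed) A"
    proof (rule ncomp_cong)
      fix u v assume "u \<in> A" "v \<in> A"
      then have "u \<noteq> x" "v \<noteq> x" using A by blast+
      then show "?E' u v \<longleftrightarrow> adj R.removed u v"
        unfolding R.adj_removed G.adj_flipped F.adj_flipped by (auto simp: doubleton_eq_iff)
    qed
    then show "real (ncomp ?E' A) = real (ncomp (adj R.removed) A)" by simp
  qed
  finally show ?thesis using R.removed_sphere V unfolding sphere_avg_def by blast
qed

text \<open>
  The statement about equality has to produce two nonadjacent vertices of degree 3 to be inductive: a
  triangle contains at most one of them, so each piece of a split sphere contributes one vertex of
  degree 3 off the cutting triangle, and these two are again nonadjacent. Spheres in which every
  three mutually adjacent vertices span a triangle never attain the bound, except for the tetrahedron.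
\<close>

theorem sphere_bound:
  assumes "two_sphere T"
  shows "sphere_avg T \<le> (real (card (\<Union>T)) + 12) / 20 \<and>
    (sphere_avg T = (real (card (\<Union>T)) + 12) / 20 \<longrightarrow> 5 \<le> card (\<Union>T) \<longrightarrow>
      (\<exists>u v. u \<noteq> v \<and> \<not> adj T u v \<and> card (nbrs T u) = 3 \<and> card (nbrs T v) = 3))"
  using assms
proof (induction "card (\<Union>T)" arbitrary: T rule: less_induct)
  case less
  note T = less.prems
  have S: "closed_surface T" using T by (simp add: two_sphere_def)
  note fV = surface_finite_verts[OF S]
  have ge4: "4 \<le> card (\<Union>T)" by (rule surface_card_verts[OF S])
  show ?case
  proof (cases "card (\<Union>T) = 4")
    case True
    have "sphere_avg T = 1 - 1 / real (card (\<Union>T) + 1)"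
      unfolding sphere_avg_def by (rule avg_clique[OF fV symp_adj tetrahedron_adj[OF T True]])
    then show ?thesis using True by simp
  next
    case False
    then have big: "5 \<le> card (\<Union>T)" using ge4 by simp
    show ?thesis
    proof (cases "\<forall>a b c. a \<noteq> b \<longrightarrow> b \<noteq> c \<longrightarrow> c \<noteq> a \<longrightarrow> adj T a b \<longrightarrow> adj T b c \<longrightarrow> adj T c a \<longrightarrow> {a, b, c} \<in> T")
      case False
      then obtain a b c where abc: "a \<noteq> b" "b \<noteq> c" "c \<noteq> a" "adj T a b" "adj T b c" "adj T c a" "{a, b, c} \<notin> T"
        by blast
      obtain U where U: "U \<subseteq> T" "\<And>x y. x \<noteq> y \<Longrightarrow> coherent T U {x, y} \<longleftrightarrow> \<not> {x, y} \<subseteq> {a, b, c}"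
        by (rule Jordan_triangle[OF T abc(1-6)]) blast
      define t0 where "t0 = {a, b, c}"
      have c3: "card t0 = 3" and nf: "t0 \<notin> T" using abc by (simp_all add: t0_def)
      have U': "U \<subseteq> T" "\<forall>x y. x \<noteq> y \<longrightarrow> coherent T U {x, y} \<longleftrightarrow> \<not> {x, y} \<subseteq> t0"
        using U unfolding t0_def by blast+
      note sp = split_sphere[OF T c3 nf U']
      define T1 where "T1 = insert t0 U"
      define T2 where "T2 = insert t0 (T - U)"
      note sp = sp[folded T1_def T2_def]
      have S1: "closed_surface T1" and S2: "closed_surface T2" using sp(1,2) by (auto simp: two_sphere_def)
      have f: "finite (\<Union>T1)" "finite (\<Union>T2)" using surface_finite_verts S1 S2 by blast+
      have cV: "card (\<Union>T1) + card (\<Union>T2) = card (\<Union>T) + 3"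
        using card_Un_Int[OF f] sp(3,4) c3 by simp
      have lt: "card (\<Union>T1) < card (\<Union>T)" "card (\<Union>T2) < card (\<Union>T)"
        using cV surface_card_verts[OF S1] surface_card_verts[OF S2] by linarith+
      note IH1 = less.hyps[OF lt(1) sp(1)] and IH2 = less.hyps[OF lt(2) sp(2)]
      have "avg (\<Union>T1 \<union> \<Union>T2) (\<lambda>A. real (ncomp (adj T) A)) =
          avg (\<Union>T1) (\<lambda>A. real (ncomp (adj T) A)) + avg (\<Union>T2) (\<lambda>A. real (ncomp (adj T) A)) - 3 / 4"
        by (rule avg_ncomp_glue[OF f symp_adj sp(3) c3 sp(10) sp(9)])
      moreover have "avg (\<Union>T1) (\<lambda>A. real (ncomp (adj T) A)) = sphere_avg T1"
        unfolding sphere_avg_def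
      proof (rule avg_cong)
        fix A assume "A \<subseteq> \<Union>T1"
        then have "ncomp (adj T) A = ncomp (adj T1) A" by (intro ncomp_cong sp(7)) blast+
        then show "real (ncomp (adj T) A) = real (ncomp (adj T1) A)" by simp
      qed
      moreover have "avg (\<Union>T2) (\<lambda>A. real (ncomp (adj T) A)) = sphere_avg T2"
        unfolding sphere_avg_def
      proof (rule avg_cong)
        fix A assume "A \<subseteq> \<Union>T2"
        then have "ncomp (adj T) A = ncomp (adj T2) A" by (intro ncomp_cong sp(8)) blast+
        then show "real (ncomp (adj T) A) = real (ncomp (adj T2) A)" by simp
      qed
      ultimately have sum: "sphere_avg T = sphere_avg T1 + sphere_avg T2 - 3 / 4"
        unfolding sp(4) sphere_avg_def[of T] by simp
      have cV': "real (card (\<Union>T1)) + real (card (\<Union>T2)) = real (card (\<Union>T)) + 3"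
        using cV by (metis of_nat_add of_nat_numeral)
      have le: "sphere_avg T1 \<le> (real (card (\<Union>T1)) + 12) / 20" "sphere_avg T2 \<le> (real (card (\<Union>T2)) + 12) / 20"
        using IH1 IH2 by blast+
      have "sphere_avg T \<le> (real (card (\<Union>T)) + 12) / 20" using sum le cV' by argo
      moreover have "\<exists>u v. u \<noteq> v \<and> \<not> adj T u v \<and> card (nbrs T u) = 3 \<and> card (nbrs T v) = 3"
        if eq: "sphere_avg T = (real (card (\<Union>T)) + 12) / 20"
      proof -
        have "sphere_avg T1 = (real (card (\<Union>T1)) + 12) / 20" "sphere_avg T2 = (real (card (\<Union>T2)) + 12) / 20"
          using sum le cV' eq by argo+
        then have "\<exists>u\<in>\<Union>T1 - t0. card (nbrs T1 u) = 3" "\<exists>v\<in>\<Union>T2 - t0. card (nbrs T2 v) = 3"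
          using IH1 IH2 by (intro degree_3_off_triangle sp(1,2); simp add: T1_def T2_def)+
        then obtain u v where uv: "u \<in> \<Union>T1" "u \<notin> t0" "card (nbrs T1 u) = 3" "v \<in> \<Union>T2" "v \<notin> t0" "card (nbrs T2 v) = 3"
          by blast
        have "card (nbrs T u) = 3" using nbrs_eq_star[OF sp(5)[OF uv(2,1)]] uv(3) by simp
        moreover have "card (nbrs T v) = 3" using nbrs_eq_star[OF sp(6)[OF uv(5,4)]] uv(6) by simp
        moreover have ni: "u \<notin> \<Union>T2" "v \<notin> \<Union>T1" using sp(3) uv(1,2,4,5) by blast+
        moreover have "\<not> adj T u v" using sp(9)[of u v] ni by blast
        moreover have "u \<noteq> v" using ni(2) uv(1) by blast
        ultimately show ?thesis by blast
      qed
      ultimately show ?thesis by blast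
    next
      case True
      then have flag: "{a, b, c} \<in> T" if "a \<noteq> b" "b \<noteq> c" "c \<noteq> a" "adj T a b" "adj T b c" "adj T c a" for a b c
        using that by blast
      obtain x where x: "x \<in> \<Union>T" "card (nbrs T x) \<le> 5" by (rule low_degree_vertex[OF T])
      have "\<exists>T'. two_sphere T' \<and> \<Union>T' = \<Union>T - {x} \<and> sphere_avg T < sphere_avg T' + 1 / 20"
      proof (cases rule: link_cycle_cases[OF S x])
        case (1 a b c)
        then interpret degree_3_vertex T x a b c by unfold_locales (use T big in auto)
        have "adj T a b" "adj T b c" "adj T c a"
          using adjI[OF triT(1)] adjI[OF triT(2)] adjI[OF triT(3)] xdist by simp_all
        then show ?thesis using flag[of a b c] xdist not_face by blast
      next
        case (2 a b c d)
        show ?thesis by (rule degree_4_sphere[OF T big flag 2])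
      next
        case (3 a b c d e)
        show ?thesis by (rule degree_5_sphere[OF T big flag 3])
      qed
      then obtain T' where T': "two_sphere T'" "\<Union>T' = \<Union>T - {x}" "sphere_avg T < sphere_avg T' + 1 / 20" by blast
      have cc: "card (\<Union>T') + 1 = card (\<Union>T)" unfolding T'(2) using card_Suc_Diff1[OF fV x(1)] by (simp only: Suc_eq_plus1)
      then have "card (\<Union>T') < card (\<Union>T)" by simp
      from less.hyps[OF this T'(1)] have "sphere_avg T' \<le> (real (card (\<Union>T')) + 12) / 20" by blast
      then have "sphere_avg T < (real (card (\<Union>T)) + 12) / 20" using T'(3) cc[symmetric] by simp
      then show ?thesis by simp
    qed
  qed
qed

section \<open>Links and connectedness\<close>

lemma complex_connected:
  assumes X: "simplicial_complex X" and b: "betti TYPE('f::field) 0 X = 1"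
    and W: "w \<in> W" "w \<in> verts X" "\<And>u v. u \<in> W \<Longrightarrow> u \<noteq> v \<Longrightarrow> {u, v} \<in> X \<Longrightarrow> v \<in> W"
  shows "verts X \<subseteq> W"
proof
  fix y assume y: "y \<in> verts X"
  have "card (component (adj X) (verts X) ` verts X) = 1"
    using betti_0_eq_ncomp[OF X, where 'f = 'f] b by (simp add: ncomp_def)
  then obtain K where "component (adj X) (verts X) ` verts X = {K}" by (rule card_1_singletonE)
  then have "component (adj X) (verts X) w = component (adj X) (verts X) y" using W(2) y by blast
  then have "reach (adj X) (verts X) w y" using component_eq_iff[OF symp_adj W(2) y] by simp
  then show "y \<in> W"
  proof (rule reach_closed[OF _ W(1)])
    fix u v assume "u \<in> W" "adj X u v"
    then obtain t where "t \<in> X" "u \<in> t" "v \<in> t" "u \<noteq> v" by (auto simp: adj_def)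
    then show "v \<in> W" using W(3)[of u v] \<open>u \<in> W\<close> simplicial_complexD(4)[OF X, of t "{u, v}"] by blast
  qed
qed

lemma betti_discrete:
  assumes X: "simplicial_complex X" and "\<And>\<alpha>. \<alpha> \<in> X \<Longrightarrow> card \<alpha> \<le> 1"
  shows "betti TYPE('f::field) 0 X = card (verts X)" "0 < i \<Longrightarrow> betti TYPE('f) i X = 0"
proof -
  have f: "faces i X = {}" if "0 < i" for i using assms(2) that by (fastforce simp: faces_def)
  then show "betti TYPE('f) i X = 0" if "0 < i" using betti_eq_0[OF X] that by blast
  have "int (card (faces 0 X)) = int (betti TYPE('f) 0 X)"
    using Euler_Poincare[OF X f[of "Suc 0"], where 'f = 'f] by simp
  then show "betti TYPE('f) 0 X = card (verts X)" by (simp add: card_faces_0)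
qed

lemma link_iff: "\<beta> \<in> link \<alpha> X \<longleftrightarrow> \<alpha> \<inter> \<beta> = {} \<and> \<alpha> \<union> \<beta> \<in> X"
  by (simp add: link_def)

lemma link_complex:
  assumes X: "simplicial_complex X" and "\<alpha> \<in> X"
  shows "simplicial_complex (link \<alpha> X)"
  unfolding simplicial_complex_def
proof (intro conjI ballI allI impI)
  have sub: "link \<alpha> X \<subseteq> X"
  proof
    fix \<beta> assume "\<beta> \<in> link \<alpha> X"
    then show "\<beta> \<in> X" using simplicial_complexD(4)[OF X, of "\<alpha> \<union> \<beta>" \<beta>] by (simp add: link_iff)
  qed
  then show "finite (link \<alpha> X)" using simplicial_complexD(1)[OF X] by (rule finite_subset)
  show "{} \<in> link \<alpha> X" using assms(2) by (simp add: link_iff)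
  show "finite \<beta>" if "\<beta> \<in> link \<alpha> X" for \<beta> using sub that simplicial_complexD(3)[OF X] by blast
  show "\<gamma> \<in> link \<alpha> X" if "\<beta> \<in> link \<alpha> X" "\<gamma> \<subseteq> \<beta>" for \<beta> \<gamma>
    using that simplicial_complexD(4)[OF X, of "\<alpha> \<union> \<beta>" "\<alpha> \<union> \<gamma>"] unfolding link_iff by blast
qed

lemma link_empty: "link {} X = X"
  by (auto simp: link_iff)

lemma link_link:
  assumes "\<alpha> \<inter> \<beta> = {}" shows "link \<beta> (link \<alpha> X) = link (\<alpha> \<union> \<beta>) X"
  using assms by (auto simp: link_iff Un_assoc)

lemma verts_link: "verts (link \<alpha> X) = {y. y \<notin> \<alpha> \<and> insert y \<alpha> \<in> X}"
  by (auto simp: verts_def link_iff)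

lemma pure_faces:
  assumes X: "simplicial_complex X" and p: "pure d X" and \<alpha>: "\<alpha> \<in> X"
  shows "int (card \<alpha>) \<le> d + 1" "\<exists>\<beta>\<in>X. \<alpha> \<subseteq> \<beta> \<and> int (card \<beta>) = d + 1"
proof -
  have "face_dim \<alpha> \<le> Max (face_dim ` X)" using simplicial_complexD(1)[OF X] \<alpha> by (intro Max_ge) auto
  then show "int (card \<alpha>) \<le> d + 1" using p by (simp add: pure_def complex_dim_def face_dim_def)
  obtain \<beta> where \<beta>: "\<beta> \<in> X" "\<alpha> \<subseteq> \<beta>" "\<forall>\<gamma>\<in>X. \<beta> \<subseteq> \<gamma> \<longrightarrow> \<beta> = \<gamma>"
    using finite_has_maximal2[OF simplicial_complexD(1)[OF X] \<alpha>] by auto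
  then have "face_dim \<beta> = d" using p unfolding pure_def by blast
  then show "\<exists>\<beta>\<in>X. \<alpha> \<subseteq> \<beta> \<and> int (card \<beta>) = d + 1" using \<beta> by (auto simp: face_dim_def)
qed

lemma pureI:
  assumes X: "simplicial_complex X" and le: "\<And>\<alpha>. \<alpha> \<in> X \<Longrightarrow> int (card \<alpha>) \<le> d + 1"
    and ex: "\<And>\<alpha>. \<alpha> \<in> X \<Longrightarrow> \<exists>\<beta>\<in>X. \<alpha> \<subseteq> \<beta> \<and> int (card \<beta>) = d + 1"
  shows "pure d X"
  unfolding pure_def
proof (intro conjI ballI impI)
  obtain \<beta> where "\<beta> \<in> X" "int (card \<beta>) = d + 1" using ex[OF simplicial_complexD(2)[OF X]] by blast
  then show "complex_dim X = d" unfolding complex_dim_def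
    by (intro Max_eqI) (use simplicial_complexD(1)[OF X] le in \<open>force simp: face_dim_def\<close>)+
  fix \<alpha> assume \<alpha>: "\<alpha> \<in> X" "\<forall>\<beta>\<in>X. \<alpha> \<subseteq> \<beta> \<longrightarrow> \<beta> = \<alpha>"
  obtain \<gamma> where "\<gamma> \<in> X" "\<alpha> \<subseteq> \<gamma>" "int (card \<gamma>) = d + 1" using ex[OF \<alpha>(1)] by blast
  then show "face_dim \<alpha> = d" using \<alpha>(2) by (force simp: face_dim_def)
qed

text \<open>
  The link of a face of codimension one is a set of points.
\<close>

lemma ridge_degree:
  assumes X: "simplicial_complex X" and le: "\<And>\<beta>. \<beta> \<in> X \<Longrightarrow> card \<beta> \<le> Suc k" and \<alpha>: "\<alpha> \<in> X" "card \<alpha> = k"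
  shows "card {t\<in>{t\<in>X. card t = Suc k}. \<alpha> \<subseteq> t} = betti TYPE('f::field) 0 (link \<alpha> X)"
    and "0 < i \<Longrightarrow> betti TYPE('f::field) i (link \<alpha> X) = 0"
proof -
  note f\<alpha> = simplicial_complexD(3)[OF X \<alpha>(1)]
  have small: "card \<beta> \<le> 1" if "\<beta> \<in> link \<alpha> X" for \<beta>
  proof -
    have b: "\<alpha> \<inter> \<beta> = {}" "\<alpha> \<union> \<beta> \<in> X" using that by (simp_all add: link_iff)
    then have "finite \<beta>" using simplicial_complexD(3)[OF X] by blast
    then have "card (\<alpha> \<union> \<beta>) = k + card \<beta>" using card_Un_disjoint[OF f\<alpha> _ b(1)] \<alpha>(2) by simp
    then show ?thesis using le[OF b(2)] by simp
  qed
  note disc = betti_discrete[OF link_complex[OF X \<alpha>(1)] small, where 'f = 'f]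
  show "0 < i \<Longrightarrow> betti TYPE('f::field) i (link \<alpha> X) = 0" by (rule disc(2))
  have inj: "inj_on (\<lambda>y. insert y \<alpha>) (verts (link \<alpha> X))"
    unfolding verts_link by (auto simp: inj_on_def)
  have "(\<lambda>y. insert y \<alpha>) ` verts (link \<alpha> X) = {t\<in>{t\<in>X. card t = Suc k}. \<alpha> \<subseteq> t}"
  proof (intro set_eqI iffI)
    fix t assume "t \<in> (\<lambda>y. insert y \<alpha>) ` verts (link \<alpha> X)"
    then show "t \<in> {t\<in>{t\<in>X. card t = Suc k}. \<alpha> \<subseteq> t}" using f\<alpha> \<alpha>(2) by (auto simp: verts_link)
  next
    fix t assume "t \<in> {t\<in>{t\<in>X. card t = Suc k}. \<alpha> \<subseteq> t}"
    then have t: "t \<in> X" "card t = Suc k" "\<alpha> \<subseteq> t" by blast+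
    have "card (t - \<alpha>) = 1" using card_Diff_subset[OF f\<alpha> t(3)] t(2) \<alpha>(2) by simp
    then obtain y where y: "t - \<alpha> = {y}" by (rule card_1_singletonE)
    then have "t = insert y \<alpha>" "y \<notin> \<alpha>" using t(3) by blast+
    then show "t \<in> (\<lambda>y. insert y \<alpha>) ` verts (link \<alpha> X)" using t(1) by (simp add: verts_link)
  qed
  then show "card {t\<in>{t\<in>X. card t = Suc k}. \<alpha> \<subseteq> t} = betti TYPE('f) 0 (link \<alpha> X)"
    using card_image[OF inj] disc(1) by simp
qed

text \<open>
  Coherence at all faces \<open>\<alpha> \<union> {y}\<close> spreads along the edges of the link of \<open>\<alpha>\<close>, so connectedness of the
  link gives coherence at \<open>\<alpha>\<close>. Going from faces of codimension one down to the empty face, this shows that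
  complexes with connected links are strongly connected.
\<close>

lemma coherent_link:
  assumes X: "simplicial_complex X" and facet: "\<And>\<beta>. \<beta> \<in> X \<Longrightarrow> \<exists>t\<in>X. \<beta> \<subseteq> t \<and> card t = k"
    and \<alpha>: "\<alpha> \<in> X" "card \<alpha> < k" and b: "betti TYPE('f::field) 0 (link \<alpha> X) = 1"
    and up: "\<And>y. y \<in> verts (link \<alpha> X) \<Longrightarrow> coherent {t\<in>X. card t = k} U (insert y \<alpha>)"
  shows "coherent {t\<in>X. card t = k} U \<alpha>"
proof -
  let ?F = "{t\<in>X. card t = k}" and ?V = "verts (link \<alpha> X)"
  let ?W = "{y\<in>?V. \<forall>t\<in>?F. insert y \<alpha> \<subseteq> t \<longrightarrow> t \<in> U}"
  have closed: "v \<in> ?W" if "u \<in> ?W" "u \<noteq> v" "{u, v} \<in> link \<alpha> X" for u v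
  proof -
    have f: "\<alpha> \<union> {u, v} \<in> X" "v \<notin> \<alpha>" using that(3) by (auto simp: link_iff)
    then have vV: "v \<in> ?V" using simplicial_complexD(4)[OF X f(1), of "insert v \<alpha>"] by (auto simp: verts_link)
    obtain t where t: "t \<in> X" "\<alpha> \<union> {u, v} \<subseteq> t" "card t = k" using facet[OF f(1)] by blast
    then have "t \<in> U" using that(1) by blast
    then have "s \<in> U" if "s \<in> ?F" "insert v \<alpha> \<subseteq> s" for s
      using coherentD[OF up[OF vV], of t s] t that by blast
    then show ?thesis using vV by blast
  qed
  have pt: "\<exists>y\<in>?V. insert y \<alpha> \<subseteq> t" if t: "t \<in> ?F" "\<alpha> \<subseteq> t" for t
  proof -
    have "\<not> t \<subseteq> \<alpha>" using card_mono[OF simplicial_complexD(3)[OF X \<alpha>(1)], of t] t(1) \<alpha>(2) by auto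
    then obtain y where "y \<in> t" "y \<notin> \<alpha>" by blast
    then show ?thesis using simplicial_complexD(4)[OF X, of t "insert y \<alpha>"] t by (auto simp: verts_link)
  qed
  show ?thesis
  proof (cases "?W = {}")
    case True
    have "t \<notin> U" if t: "t \<in> ?F" "\<alpha> \<subseteq> t" for t
    proof
      assume "t \<in> U"
      obtain y where y: "y \<in> ?V" "insert y \<alpha> \<subseteq> t" using pt[OF t] by blast
      have "s \<in> U" if "s \<in> ?F" "insert y \<alpha> \<subseteq> s" for s
        using coherentD[OF up[OF y(1)], of t s] t y(2) that \<open>t \<in> U\<close> by blast
      then have "y \<in> ?W" using y(1) by blast
      then show False using True by blast
    qed
    then show ?thesis unfolding coherent_def by blast
  next
    case False
    then obtain w where w: "w \<in> ?W" by blast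
    have VW: "?V \<subseteq> ?W"
    proof (rule complex_connected[OF link_complex[OF X \<alpha>(1)] b w])
      show "w \<in> ?V" using w by simp
    qed (rule closed)
    have "t \<in> U" if t: "t \<in> ?F" "\<alpha> \<subseteq> t" for t
    proof -
      obtain y where y: "y \<in> ?V" "insert y \<alpha> \<subseteq> t" using pt[OF t] by blast
      have "y \<in> ?W" by (rule subsetD[OF VW y(1)])
      then have "\<forall>t\<in>?F. insert y \<alpha> \<subseteq> t \<longrightarrow> t \<in> U" by simp
      from this[rule_format, OF t(1) y(2)] show ?thesis .
    qed
    then show ?thesis unfolding coherent_def by blast
  qed
qed

section \<open>Homology 2-spheres\<close>

definition triangles :: "'a set set \<Rightarrow> 'a set set" where
  "triangles X = {t\<in>X. card t = 3}"

text \<open>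
  Links of edges are pairs of points, links of vertices and the sphere itself are connected, and the
  Euler characteristic is 2 by the Euler-Poincare formula.
\<close>

theorem homology_2_sphere_surface:
  assumes "homology_sphere TYPE('f::field) 2 L"
  shows "two_sphere (triangles L)" "faces_of (triangles L) = L"
proof -
  have ml: "manifold_links TYPE('f) 2 L" and bd: "manifold_boundary TYPE('f) L = {{}}"
    and sh: "sphere_homology TYPE('f) 2 L"
    using assms by (auto simp: homology_sphere_def closed_homology_manifold_def)
  have L: "simplicial_complex L" and p: "pure 2 L" using ml by (auto simp: manifold_links_def)
  have le: "card \<alpha> \<le> 3" if "\<alpha> \<in> L" for \<alpha> using pure_faces(1)[OF L p that] by simp
  have facet: "\<exists>t\<in>L. \<alpha> \<subseteq> t \<and> card t = 3" if "\<alpha> \<in> L" for \<alpha> using pure_faces(2)[OF L p that] by auto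
  have lk: "sphere_homology TYPE('f) (2 - int (card \<alpha>)) (link \<alpha> L)" if "\<alpha> \<in> L" "\<alpha> \<noteq> {}" for \<alpha>
  proof -
    have "\<alpha> \<notin> manifold_boundary TYPE('f) L" using bd that(2) by blast
    then have "\<not> point_homology TYPE('f) (link \<alpha> L)" using that by (auto simp: manifold_boundary_def)
    then show ?thesis using ml that unfolding manifold_links_def by blast
  qed
  let ?T = "triangles L"
  show fT: "faces_of ?T = L"
  proof
    show "faces_of ?T \<subseteq> L" using simplicial_complexD(4)[OF L] by (auto simp: faces_of_def triangles_def)
    show "L \<subseteq> faces_of ?T" using facet by (fastforce simp: faces_of_def triangles_def)
  qed
  have edge: "card {t\<in>?T. {x, y} \<subseteq> t} = 0 \<or> card {t\<in>?T. {x, y} \<subseteq> t} = 2" if xy: "x \<noteq> y" for x y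
  proof (cases "{x, y} \<in> L")
    case True
    have c2: "card {x, y} = 2" using xy by simp
    have "betti TYPE('f) 0 (link {x, y} L) = 2"
      using lk[OF True] c2 by (simp add: sphere_homology_def)
    moreover have "card {t\<in>{t\<in>L. card t = Suc 2}. {x, y} \<subseteq> t} = betti TYPE('f) 0 (link {x, y} L)"
      by (rule ridge_degree(1)[OF L _ True c2]) (use le in simp)
    ultimately have "card {t\<in>?T. {x, y} \<subseteq> t} = 2"
      unfolding triangles_def by (simp only: numeral_3_eq_3 numeral_2_eq_2)
    then show ?thesis by argo
  next
    case False
    then have "{t\<in>?T. {x, y} \<subseteq> t} = {}"
      using simplicial_complexD(4)[OF L, of _ "{x, y}"] unfolding triangles_def by blast
    then have "card {t\<in>?T. {x, y} \<subseteq> t} = 0" by (simp only: card.empty)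
    then show ?thesis by argo
  qed
  have local: "coherent ?T U {x}" if c: "\<forall>y. y \<noteq> x \<longrightarrow> coherent ?T U {x, y}" for U x
  proof (cases "{x} \<in> L")
    case True
    have b: "betti TYPE('f) 0 (link {x} L) = 1" using lk[OF True] by (simp add: sphere_homology_def)
    show ?thesis unfolding triangles_def
    proof (rule coherent_link[OF L _ True _ b])
      show "\<exists>t\<in>L. \<beta> \<subseteq> t \<and> card t = 3" if "\<beta> \<in> L" for \<beta> by (rule facet[OF that])
      fix y assume "y \<in> verts (link {x} L)"
      then have "y \<noteq> x" by (auto simp: verts_link)
      then have "coherent ?T U {x, y}" using c by blast
      moreover have "insert y {x} = {x, y}" by blast
      ultimately show "coherent {t \<in> L. card t = 3} U (insert y {x})" by (simp only: triangles_def)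
    qed simp_all
  next
    case False
    then have "t \<notin> ?T" if "{x} \<subseteq> t" for t
      using simplicial_complexD(4)[OF L, of t "{x}"] that unfolding triangles_def by blast
    then show ?thesis unfolding coherent_def by blast
  qed
  have global: "coherent ?T U {}" if c: "\<forall>x. coherent ?T U {x}" for U
  proof -
    have b: "betti TYPE('f) 0 (link {} L) = 1" using sh by (simp add: sphere_homology_def link_empty)
    show ?thesis unfolding triangles_def
    proof (rule coherent_link[OF L _ simplicial_complexD(2)[OF L] _ b])
      show "\<exists>t\<in>L. \<beta> \<subseteq> t \<and> card t = 3" if "\<beta> \<in> L" for \<beta> by (rule facet[OF that])
      show "coherent {t \<in> L. card t = 3} U (insert y {})" for y using c unfolding triangles_def by blast
    qed simp
  qed
  have ne: "?T \<noteq> {}" using facet[OF simplicial_complexD(2)[OF L]] by (auto simp: triangles_def)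
  have S: "closed_surface ?T"
    unfolding closed_surface_def
    using simplicial_complexD(1)[OF L] ne edge local global by (auto simp: triangles_def)
  have "faces (Suc 2) L = {}" using le by (fastforce simp: faces_def)
  from Euler_Poincare[OF L this, where 'f = 'f]
  have "int (card (faces 0 L)) - int (card (faces 1 L)) + int (card (faces 2 L)) = 2"
    using sh by (simp add: numeral_2_eq_2 sphere_homology_def)
  moreover have "2 * card (faces 1 L) = 3 * card ?T" using double_count_edges[OF S] fT by simp
  moreover have "faces 2 L = ?T" by (simp add: faces_def triangles_def numeral_3_eq_3)
  moreover have "card (faces 0 L) = card (\<Union>?T)" using card_faces_0[of L] verts_faces_of[of ?T] fT by simp
  ultimately have "card ?T + 4 = 2 * card (\<Union>?T)" by simp
  then show "two_sphere ?T" using S by (simp add: two_sphere_def)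
qed

text \<open>
  Links in the link of \<open>x\<close> are links in \<open>M\<close>.
\<close>

lemma vertex_link_sphere:
  assumes M: "closed_homology_manifold TYPE('f::field) 3 M" and x: "x \<in> verts M"
  shows "homology_sphere TYPE('f) 2 (link {x} M)"
proof -
  have ml: "manifold_links TYPE('f) 3 M" and bd: "manifold_boundary TYPE('f) M = {{}}"
    using M by (auto simp: closed_homology_manifold_def)
  have C: "simplicial_complex M" and p: "pure 3 M" using ml by (auto simp: manifold_links_def)
  have nb: "\<not> point_homology TYPE('f) (link \<alpha> M)" if "\<alpha> \<in> M" "\<alpha> \<noteq> {}" for \<alpha>
  proof -
    have "\<alpha> \<notin> manifold_boundary TYPE('f) M" using bd that(2) by blast
    then show ?thesis using that by (auto simp: manifold_boundary_def)
  qed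
  have lk: "sphere_homology TYPE('f) (3 - int (card \<alpha>)) (link \<alpha> M)" if "\<alpha> \<in> M" "\<alpha> \<noteq> {}" for \<alpha>
    using nb[OF that] ml that unfolding manifold_links_def by blast
  have xM: "{x} \<in> M" using x by (simp add: verts_def)
  let ?L = "link {x} M"
  have L: "simplicial_complex ?L" by (rule link_complex[OF C xM])
  have mem: "insert x \<alpha> \<in> M" "x \<notin> \<alpha>" "finite \<alpha>" if "\<alpha> \<in> ?L" for \<alpha>
    using that simplicial_complexD(3)[OF L that] by (auto simp: link_iff)
  have ll: "link \<alpha> ?L = link (insert x \<alpha>) M" if "\<alpha> \<in> ?L" for \<alpha>
    using link_link[of "{x}" \<alpha> M] mem(2)[OF that] by simp
  have p2: "pure 2 ?L"
  proof (rule pureI[OF L])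
    fix \<alpha> assume a: "\<alpha> \<in> ?L"
    show "int (card \<alpha>) \<le> 2 + 1" using pure_faces(1)[OF C p mem(1)[OF a]] mem(2,3)[OF a] by simp
    obtain \<beta> where \<beta>: "\<beta> \<in> M" "insert x \<alpha> \<subseteq> \<beta>" "int (card \<beta>) = 3 + 1"
      using pure_faces(2)[OF C p mem(1)[OF a]] by blast
    have "\<beta> - {x} \<in> ?L" using \<beta> by (simp add: link_iff insert_absorb)
    moreover have "\<alpha> \<subseteq> \<beta> - {x}" using \<beta>(2) mem(2)[OF a] by blast
    moreover have "int (card (\<beta> - {x})) = 2 + 1" using \<beta> simplicial_complexD(3)[OF C \<beta>(1)] by simp
    ultimately show "\<exists>\<beta>\<in>?L. \<alpha> \<subseteq> \<beta> \<and> int (card \<beta>) = 2 + 1" by blast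
  qed
  have "sphere_homology TYPE('f) (2 - int (card \<alpha>)) (link \<alpha> ?L)" if a: "\<alpha> \<in> ?L" for \<alpha>
    using lk[OF mem(1)[OF a]] mem(2,3)[OF a] ll[OF a] by simp
  then have "manifold_links TYPE('f) 2 ?L" unfolding manifold_links_def using L p2 by blast
  moreover have "manifold_boundary TYPE('f) ?L = {{}}"
    unfolding manifold_boundary_def using nb[OF mem(1)] ll by auto
  moreover have "sphere_homology TYPE('f) 2 ?L" using lk[OF xM] by simp
  ultimately show ?thesis by (simp add: homology_sphere_def closed_homology_manifold_def)
qed

text \<open>
  The binomial coefficients in \<open>sigma\<close> are the weights of \<open>avg\<close> up to the factor \<open>1 + f\<^sub>0\<close>, and \<open>-1\<close> is
  the difference between reduced and unreduced Betti numbers.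
\<close>

lemma sigma_0_eq_avg:
  assumes L: "simplicial_complex L"
  shows "sigma TYPE('f::field) 0 L / (1 + real (face_num 0 L)) = avg (verts L) (\<lambda>A. real (ncomp (adj L) A)) - 1"
proof -
  let ?V = "verts L"
  note fV = finite_verts[OF L]
  have n: "face_num 0 L = card ?V" using face_num_eq_card_faces[of 0 L] card_faces_0[of L] by simp
  have b: "betti TYPE('f) 0 (induced L A) = ncomp (adj L) A" if A: "A \<subseteq> ?V" for A
  proof -
    have C: "simplicial_complex (induced L A)"
      unfolding simplicial_complex_def induced_def
      using simplicial_complexD[OF L] by auto
    have "verts (induced L A) = A" using A by (auto simp: verts_def induced_def)
    moreover have "ncomp (adj (induced L A)) A = ncomp (adj L) A"
    proof (rule ncomp_cong)
      fix u v assume uv: "u \<in> A" "v \<in> A"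
      have "{u, v} \<in> induced L A" if "t \<in> L" "u \<in> t" "v \<in> t" for t
        using simplicial_complexD(4)[OF L that(1), of "{u, v}"] that uv by (simp add: induced_def)
      then show "adj (induced L A) u v \<longleftrightarrow> adj L u v" by (auto simp: adj_def induced_def)
    qed
    ultimately show ?thesis using betti_0_eq_ncomp[OF C, where 'f = 'f] by simp
  qed
  have "sigma TYPE('f) 0 L / (1 + real (card ?V)) =
      (\<Sum>A\<in>Pow ?V. (real (ncomp (adj L) A) - 1) / (real (card ?V + 1) * real (card ?V choose card A)))"
    unfolding sigma_def n sum_divide_distrib
    by (rule sum.cong) (auto simp: red_betti_def b mult.commute)
  also have "\<dots> = avg ?V (\<lambda>A. real (ncomp (adj L) A) - 1)" by (simp add: avg_def)
  also have "\<dots> = avg ?V (\<lambda>A. real (ncomp (adj L) A)) - 1" by (simp add: avg_diff avg_const[OF fV])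
  finally show ?thesis by (simp add: n)
qed

section \<open>The 1-stacked spheres attain the bound\<close>

text \<open>
  Families of tetrahedra that arise by attaching one tetrahedron of \<open>Q\<close> at a time along a triangle.
\<close>

inductive grown :: "'a set set \<Rightarrow> 'a set set \<Rightarrow> bool" for Q where
  single: "t \<in> Q \<Longrightarrow> grown Q {t}"
| extend: "grown Q P \<Longrightarrow> t \<in> Q \<Longrightarrow> t \<notin> P \<Longrightarrow> s \<in> P \<Longrightarrow> card (s \<inter> t) = 3 \<Longrightarrow> grown Q (insert t P)"

text \<open>
  Each step adds a tetrahedron and at most one vertex. If it always adds one, then the new vertex is
  joined to three mutually adjacent vertices, which raises the expectation by \<open>4/5 - 3/4 = 1/20\<close>.
\<close>

lemma grown_bound:
  assumes "grown Q P" and Q: "\<And>t. t \<in> Q \<Longrightarrow> card t = 4"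
  shows "finite P \<and> P \<subseteq> Q \<and> P \<noteq> {} \<and> finite (\<Union>P) \<and> card (\<Union>P) \<le> card P + 3 \<and>
    (card (\<Union>P) = card P + 3 \<longrightarrow> sphere_avg P = (real (card (\<Union>P)) + 12) / 20)"
  using assms(1)
proof (induction rule: grown.induct)
  case (single t)
  have c: "card t = 4" using Q single by blast
  then have f: "finite t" by (metis card.infinite zero_neq_numeral)
  have U: "\<Union>{t} = t" by simp
  have "sphere_avg {t} = 1 - 1 / real (card t + 1)"
    unfolding sphere_avg_def U by (rule avg_clique[OF f symp_adj]) (auto simp: adj_def)
  then show ?case using c f single by simp
next
  case (extend P t s)
  note IH = extend.IH
  have c: "card t = 4" using Q extend.hyps by blast
  then have ft: "finite t" by (metis card.infinite zero_neq_numeral)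
  have fP: "finite P" "finite (\<Union>P)" using IH by blast+
  have "card (t - s \<inter> t) = 1" using card_Diff_subset[of "s \<inter> t" t] ft c extend.hyps(5) by simp
  then obtain v where v: "t - s \<inter> t = {v}" by (rule card_1_singletonE)
  have "v \<in> t - s \<inter> t" unfolding v by simp
  have "insert v (s \<inter> t) = (t - s \<inter> t) \<union> (s \<inter> t)" unfolding v by simp
  then have tv: "t = insert v (s \<inter> t)" by blast
  have sU: "s \<inter> t \<subseteq> \<Union>P" using extend.hyps(4) by blast
  have cI: "card (insert t P) = card P + 1" using fP(1) extend.hyps(3) by simp
  have base: "finite (insert t P) \<and> insert t P \<subseteq> Q \<and> insert t P \<noteq> {} \<and> finite (\<Union>(insert t P))"
    using IH ft extend.hyps(2) by simp
  show ?case
  proof (cases "v \<in> \<Union>P")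
    case True
    then have "insert v (s \<inter> t) \<subseteq> \<Union>P" using sU by (simp only: insert_subset simp_thms)
    then have "t \<subseteq> \<Union>P" using tv by argo
    then have "\<Union>(insert t P) = \<Union>P" by blast
    then have "card (\<Union>(insert t P)) \<le> card P + 3" using IH by simp
    then show ?thesis using base cI by simp
  next
    case False
    have U: "\<Union>(insert t P) = \<Union>P \<union> t" by blast
    have int: "\<Union>P \<inter> t = s \<inter> t"
    proof
      show "\<Union>P \<inter> t \<subseteq> s \<inter> t"
      proof
        fix y assume y: "y \<in> \<Union>P \<inter> t"
        then have "y \<in> insert v (s \<inter> t)" using tv by blast
        moreover have "y \<noteq> v" using y False by blast
        ultimately show "y \<in> s \<inter> t" by simp
      qed
    qed (use sU in simp)
    have "card (\<Union>P) + card t = card (\<Union>P \<union> t) + card (\<Union>P \<inter> t)" by (rule card_Un_Int[OF fP(2) ft])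
    then have cU: "card (\<Union>(insert t P)) = card (\<Union>P) + 1" unfolding U int extend.hyps(5) c by simp
    have hEq: "sphere_avg (insert t P) = (real (card (\<Union>(insert t P))) + 12) / 20"
      if eq: "card (\<Union>(insert t P)) = card (insert t P) + 3"
    proof -
      let ?E = "adj (insert t P)"
      have e: "sphere_avg P = (real (card (\<Union>P)) + 12) / 20" using eq cU cI IH by simp
      have "avg (\<Union>P \<union> t) (\<lambda>A. real (ncomp ?E A)) =
          avg (\<Union>P) (\<lambda>A. real (ncomp ?E A)) + avg t (\<lambda>A. real (ncomp ?E A)) - 3 / 4"
      proof (rule avg_ncomp_glue[OF fP(2) ft symp_adj int extend.hyps(5)])
        show "?E u w" if "u \<in> s \<inter> t" "w \<in> s \<inter> t" "u \<noteq> w" for u w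
          using that by (auto simp: adj_def)
        show "u \<in> \<Union>P \<and> w \<in> \<Union>P \<or> u \<in> t \<and> w \<in> t" if "?E u w" for u w
          using that by (auto simp: adj_def)
      qed
      moreover have "avg t (\<lambda>A. real (ncomp ?E A)) = 4 / 5"
        using avg_clique[OF ft symp_adj, of "insert t P"] c by (simp add: adj_def)
      moreover have "avg (\<Union>P) (\<lambda>A. real (ncomp ?E A)) = sphere_avg P"
        unfolding sphere_avg_def
      proof (rule avg_cong)
        fix A assume A: "A \<subseteq> \<Union>P"
        have "ncomp ?E A = ncomp (adj P) A"
        proof (rule ncomp_cong)
          fix u w assume "u \<in> A" "w \<in> A"
          then have "u \<in> t \<Longrightarrow> u \<in> s" "w \<in> t \<Longrightarrow> w \<in> s" using int A by blast+
          then show "?E u w \<longleftrightarrow> adj P u w" using extend.hyps(4) unfolding adj_def by blast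
        qed
        then show "real (ncomp ?E A) = real (ncomp (adj P) A)" by simp
      qed
      ultimately show ?thesis using e cU unfolding sphere_avg_def U by simp
    qed
    have le: "card (\<Union>(insert t P)) \<le> card (insert t P) + 3" using cU cI IH by simp
    show ?thesis by (intro conjI impI) (simp_all only: base le hEq simp_thms)
  qed
qed

text \<open>
  A maximal grown family is coherent at all triangles, as otherwise it could be extended.
\<close>

lemma grown_all:
  assumes Q: "finite Q" "Q \<noteq> {}" "\<And>t. t \<in> Q \<Longrightarrow> card t = 4"
    and conn: "\<And>P. (\<And>\<alpha>. card \<alpha> = 3 \<Longrightarrow> coherent Q P \<alpha>) \<Longrightarrow> coherent Q P {}"
  shows "grown Q Q"
proof -
  let ?G = "{P. grown Q P}"
  have sub: "P \<subseteq> Q" "P \<noteq> {}" if "grown Q P" for P using grown_bound[OF that Q(3)] by blast+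
  then have "?G \<subseteq> Pow Q" by blast
  then have fG: "finite ?G" using Q(1) finite_subset by blast
  obtain t where "t \<in> Q" using Q(2) by blast
  then have "{t} \<in> ?G" using grown.single by blast
  then have "?G \<noteq> {}" by blast
  from finite_has_maximal[OF fG this]
  obtain P where P: "grown Q P" "\<forall>P'\<in>?G. P \<subseteq> P' \<longrightarrow> P = P'" by auto
  have "coherent Q P {}"
  proof (rule conn, rule ccontr)
    fix \<alpha> :: "'a set" assume c3: "card \<alpha> = 3" and "\<not> coherent Q P \<alpha>"
    then obtain s r where sr: "s \<in> Q" "\<alpha> \<subseteq> s" "s \<in> P" "r \<in> Q" "\<alpha> \<subseteq> r" "r \<notin> P"
      unfolding coherent_def by blast
    have f: "finite s" "finite r" using Q(3)[OF sr(1)] Q(3)[OF sr(4)] by (metis card.infinite zero_neq_numeral)+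
    have "s \<noteq> r" using sr by blast
    then have "s \<inter> r \<noteq> s" using Q(3)[OF sr(1)] Q(3)[OF sr(4)] card_subset_eq[OF f(2), of s] by auto
    then have "card (s \<inter> r) < 4" using psubset_card_mono[OF f(1), of "s \<inter> r"] Q(3)[OF sr(1)] by auto
    moreover have "3 \<le> card (s \<inter> r)" using card_mono[of "s \<inter> r" \<alpha>] f(1) sr(2,5) c3 by simp
    ultimately have "card (s \<inter> r) = 3" by simp
    then have "grown Q (insert r P)" using grown.extend[OF P(1) sr(4,6,3)] by blast
    then show False using P(2) sr(6) by blast
  qed
  then have "Q \<subseteq> P" using sub[OF P(1)] unfolding coherent_def by blast
  then show ?thesis using P(1) sub(1)[OF P(1)] by simp
qed

text \<open>
  The ball \<open>D\<close> has the vertices and edges of \<open>L\<close>. Euler's formula, together with counting incidences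
  of triangles and tetrahedra, gives \<open>n - 3\<close> tetrahedra, so the bound on the number of vertices in
  \<open>grown_bound\<close> is attained.
\<close>

theorem stacked_attains_bound:
  assumes "stacked_sphere TYPE('f::field) 2 1 L"
  shows "sphere_avg (triangles L) = (real (card (verts L)) + 12) / 20"
proof -
  obtain D where hs: "homology_sphere TYPE('f) 2 L" and D: "homology_ball TYPE('f) 3 D"
    and bd: "manifold_boundary TYPE('f) D = L" and sk: "skel 1 D = skel 1 L"
    using assms by (auto simp: stacked_sphere_def)
  note sph = homology_2_sphere_surface[OF hs]
  have S: "closed_surface (triangles L)" and Eu: "card (triangles L) + 4 = 2 * card (\<Union>(triangles L))"
    using sph(1) by (auto simp: two_sphere_def)
  have ml: "manifold_links TYPE('f) 3 D" and ph: "point_homology TYPE('f) D"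
    using D by (auto simp: homology_ball_def homology_manifold_def)
  have C: "simplicial_complex D" and p: "pure 3 D" using ml by (auto simp: manifold_links_def)
  have CL: "simplicial_complex L" using hs
    by (auto simp: homology_sphere_def closed_homology_manifold_def manifold_links_def)
  have le: "card \<alpha> \<le> 4" if "\<alpha> \<in> D" for \<alpha> using pure_faces(1)[OF C p that] by simp
  have facet: "\<exists>t\<in>D. \<alpha> \<subseteq> t \<and> card t = 4" if "\<alpha> \<in> D" for \<alpha> using pure_faces(2)[OF C p that] by auto
  have lk: "sphere_homology TYPE('f) (3 - int (card \<alpha>)) (link \<alpha> D) \<or> point_homology TYPE('f) (link \<alpha> D)"
    if "\<alpha> \<in> D" "\<alpha> \<noteq> {}" for \<alpha> using ml that unfolding manifold_links_def by blast
  have b1: "betti TYPE('f) 0 (link \<alpha> D) = 1" if a: "\<alpha> \<in> D" "card \<alpha> \<le> 2" for \<alpha>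
  proof (cases "\<alpha> = {}")
    case True then show ?thesis using ph by (simp add: link_empty point_homology_def)
  next
    case False
    then show ?thesis using lk[OF a(1)] a(2) by (auto simp: sphere_homology_def point_homology_def)
  qed
  let ?Q = "{t\<in>D. card t = 4}"
  have tri: "card {t\<in>?Q. \<alpha> \<subseteq> t} = (if \<alpha> \<in> L then 1 else 2)" if a: "\<alpha> \<in> faces 2 D" for \<alpha>
  proof -
    have aD: "\<alpha> \<in> D" "card \<alpha> = 3" "\<alpha> \<noteq> {}" using a by (auto simp: faces_def)
    have "card {t\<in>{t\<in>D. card t = Suc 3}. \<alpha> \<subseteq> t} = betti TYPE('f) 0 (link \<alpha> D)"
      by (rule ridge_degree(1)[OF C _ aD(1,2)]) (use le in simp)
    then have deg: "card {t\<in>?Q. \<alpha> \<subseteq> t} = betti TYPE('f) 0 (link \<alpha> D)" by simp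
    have "\<alpha> \<in> L \<longleftrightarrow> point_homology TYPE('f) (link \<alpha> D)"
      using aD unfolding bd[symmetric] manifold_boundary_def by blast
    then show ?thesis unfolding deg using lk[OF aD(1,3)] aD(2)
      by (auto simp: sphere_homology_def point_homology_def)
  qed
  have LD: "L \<subseteq> D" unfolding bd[symmetric] manifold_boundary_def using simplicial_complexD(2)[OF C] by blast
  have fin: "finite D" by (rule simplicial_complexD(1)[OF C])
  have fa: "faces 0 D = faces 0 L" "faces 1 D = faces 1 L"
  proof -
    have "faces i X = {\<alpha>\<in>skel 1 X. card \<alpha> = Suc i}" if "i \<le> 1" for i and X :: "'a set set"
      using that by (auto simp: faces_def skel_def face_dim_def)
    then show "faces 0 D = faces 0 L" "faces 1 D = faces 1 L" using sk by simp_all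
  qed
  have count: "4 * card ?Q + card (triangles L) = 2 * card (faces 2 D)"
  proof -
    have "(\<Sum>\<alpha>\<in>faces 2 D. card {t\<in>?Q. \<alpha> \<subseteq> t}) = (\<Sum>t\<in>?Q. card {\<alpha>\<in>faces 2 D. \<alpha> \<subseteq> t})"
      by (rule sum_multicount_gen) (use fin faces_finite[OF C] in auto)
    also have "\<dots> = (\<Sum>t\<in>?Q. 4)"
    proof (rule sum.cong[OF refl])
      fix t assume t: "t \<in> ?Q"
      have "{\<alpha>\<in>faces 2 D. \<alpha> \<subseteq> t} = {\<alpha>. \<alpha> \<subseteq> t \<and> card \<alpha> = 3}"
        using t simplicial_complexD(4)[OF C, of t] by (auto simp: faces_def)
      moreover have "(4::nat) choose 3 = 4" by (simp add: numeral_eq_Suc)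
      ultimately show "card {\<alpha>\<in>faces 2 D. \<alpha> \<subseteq> t} = 4"
        using n_subsets[of t 3] t simplicial_complexD(3)[OF C, of t] by simp
    qed
    finally have 1: "(\<Sum>\<alpha>\<in>faces 2 D. card {t\<in>?Q. \<alpha> \<subseteq> t}) = 4 * card ?Q" by simp
    have "(\<Sum>\<alpha>\<in>faces 2 D. card {t\<in>?Q. \<alpha> \<subseteq> t}) + (\<Sum>\<alpha>\<in>faces 2 D. if \<alpha> \<in> L then 1 else 0) = (\<Sum>\<alpha>\<in>faces 2 D. 2)"
      unfolding sum.distrib[symmetric]
    proof (rule sum.cong[OF refl])
      fix \<alpha> assume "\<alpha> \<in> faces 2 D"
      from tri[OF this] show "card {t\<in>?Q. \<alpha> \<subseteq> t} + (if \<alpha> \<in> L then 1 else 0) = 2"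
        by (cases "\<alpha> \<in> L") simp_all
    qed
    moreover have "(\<Sum>\<alpha>\<in>faces 2 D. if \<alpha> \<in> L then 1 else 0 :: nat) = card {\<alpha>\<in>faces 2 D. \<alpha> \<in> L}"
      using faces_finite[OF C, of 2] by (simp add: sum.If_cases Int_def)
    moreover have "{\<alpha>\<in>faces 2 D. \<alpha> \<in> L} = triangles L" using LD by (auto simp: faces_def triangles_def)
    ultimately show ?thesis using 1 by simp
  qed
  have "faces (Suc 3) D = {}" using le by (fastforce simp: faces_def)
  from Euler_Poincare[OF C this, where 'f = 'f]
  have Euler: "int (card (faces 0 D)) - int (card (faces 1 D)) + int (card (faces 2 D)) - int (card (faces 3 D)) = 1"
    using ph by (simp add: numeral_3_eq_3 numeral_2_eq_2 point_homology_def)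
  have "faces 3 D = ?Q" by (simp add: faces_def)
  moreover have "2 * card (faces 1 L) = 3 * card (triangles L)" using double_count_edges[OF S] sph(2) by simp
  moreover have V: "\<Union>(triangles L) = verts L" using verts_faces_of[of "triangles L"] sph(2) by simp
  moreover have "card (faces 0 L) = card (verts L)" by (rule card_faces_0)
  ultimately have num: "card ?Q + 3 = card (verts L)" using Euler count Eu fa by simp
  have QD: "faces_of ?Q = D"
  proof
    show "faces_of ?Q \<subseteq> D" using simplicial_complexD(4)[OF C] by (auto simp: faces_of_def)
    show "D \<subseteq> faces_of ?Q" using facet by (fastforce simp: faces_of_def)
  qed
  have vD: "verts D = verts L"
  proof -
    have "verts X = {x. {x} \<in> faces 0 X}" for X :: "'a set set" by (auto simp: verts_def faces_def)
    then show ?thesis using fa(1) by metis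
  qed
  have UQ: "\<Union>?Q = verts L" using verts_faces_of[of ?Q] QD vD by simp
  have adjD: "adj ?Q = adj (triangles L)"
  proof -
    have adjX: "adj X u v \<longleftrightarrow> u \<noteq> v \<and> {u, v} \<in> faces 1 X" if X: "simplicial_complex X" for X :: "'a set set" and u v
      using simplicial_complexD(4)[OF X, of _ "{u, v}"] by (auto simp: adj_def faces_def)
    have "adj D = adj L" using adjX[OF C] adjX[OF CL] fa(2) by (simp add: fun_eq_iff)
    then show ?thesis using adj_faces_of[of ?Q] adj_faces_of[of "triangles L"] QD sph(2) by simp
  qed
  have "grown ?Q ?Q"
  proof (rule grown_all)
    show "finite ?Q" using fin by simp
    show "?Q \<noteq> {}" using facet[OF simplicial_complexD(2)[OF C]] by blast
    fix P assume c3: "\<And>\<alpha>. card \<alpha> = 3 \<Longrightarrow> coherent ?Q P \<alpha>"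
    have step: "coherent ?Q P \<alpha>" if a: "card \<alpha> = k" "finite \<alpha>" "k \<le> 2"
      and up: "\<And>\<beta>. card \<beta> = Suc k \<Longrightarrow> coherent ?Q P \<beta>" for \<alpha> k
    proof (cases "\<alpha> \<in> D")
      case True
      show ?thesis
      proof (rule coherent_link[OF C _ True])
        show "\<exists>t\<in>D. \<beta> \<subseteq> t \<and> card t = 4" if "\<beta> \<in> D" for \<beta> by (rule facet[OF that])
        show "betti TYPE('f) 0 (link \<alpha> D) = 1" using b1[OF True] a by simp
        show "coherent ?Q P (insert y \<alpha>)" if "y \<in> verts (link \<alpha> D)" for y
          by (rule up) (use that a in \<open>auto simp: verts_link\<close>)
      qed (use a in simp)
    next
      case False
      then have "\<not> \<alpha> \<subseteq> t" if "t \<in> D" for t using simplicial_complexD(4)[OF C that] by blast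
      then show ?thesis unfolding coherent_def by blast
    qed
    have fin_pos: "finite \<beta>" if "card \<beta> = Suc k" for \<beta> :: "'a set" and k using that card.infinite by fastforce
    have c2: "coherent ?Q P \<beta>" if "card \<beta> = 2" for \<beta>
      by (rule step[OF that]) (use that c3 fin_pos[of \<beta> 1] in \<open>simp_all add: numeral_3_eq_3 numeral_2_eq_2\<close>)
    have c1: "coherent ?Q P \<beta>" if "card \<beta> = 1" for \<beta>
      by (rule step[OF that]) (use that c2 fin_pos[of \<beta> 0] in \<open>simp_all add: numeral_2_eq_2\<close>)
    show "coherent ?Q P {}" by (rule step[of _ 0]) (use c1 in simp_all)
  qed simp
  from grown_bound[OF this] have "sphere_avg ?Q = (real (card (\<Union>?Q)) + 12) / 20"
    using num UQ by simp
  then show ?thesis unfolding sphere_avg_def adjD UQ V by simp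
qed

section \<open>Coning off a simplex\<close>

text \<open>
  The union of \<open>X\<close> with the simplex on \<open>\<tau> \<union> {v}\<close>, where \<open>v\<close> is meant to be new and \<open>\<tau>\<close> a face of \<open>X\<close>.
\<close>

definition cone_off :: "'a set set \<Rightarrow> 'a \<Rightarrow> 'a set \<Rightarrow> 'a set set" where
  "cone_off X v \<tau> = X \<union> insert v ` Pow \<tau>"

locale cone_over_face =
  fixes X :: "'a set set" and v :: 'a and \<tau> :: "'a set"
  assumes X: "simplicial_complex X" and new: "v \<notin> verts X" and \<tau>: "\<tau> \<in> X"
begin

lemma v_notin: "\<alpha> \<in> X \<Longrightarrow> v \<notin> \<alpha>"
  using face_subset_verts[OF X] new by blast

lemma fin\<tau>: "finite \<tau>"
  by (rule simplicial_complexD(3)[OF X \<tau>])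

lemma cone_off_iff: "\<alpha> \<in> cone_off X v \<tau> \<longleftrightarrow> (if v \<in> \<alpha> then \<alpha> - {v} \<subseteq> \<tau> else \<alpha> \<in> X)"
proof (cases "v \<in> \<alpha>")
  case True
  then have "\<alpha> \<in> insert v ` Pow \<tau> \<longleftrightarrow> \<alpha> - {v} \<subseteq> \<tau>"
    using v_notin[OF \<tau>] by (auto simp: image_iff intro!: bexI[of _ "\<alpha> - {v}"])
  then show ?thesis using True v_notin[of \<alpha>] unfolding cone_off_def by auto
next
  case False
  then have "\<alpha> \<notin> insert v ` Pow \<tau>" by blast
  then show ?thesis using False unfolding cone_off_def by auto
qed

lemma cone_complex: "simplicial_complex (cone_off X v \<tau>)"
  unfolding simplicial_complex_def
proof (intro conjI ballI allI impI)
  show "finite (cone_off X v \<tau>)" using simplicial_complexD(1)[OF X] fin\<tau> by (simp add: cone_off_def)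
  show "{} \<in> cone_off X v \<tau>" using simplicial_complexD(2)[OF X] by (simp add: cone_off_def)
  fix \<alpha> assume a: "\<alpha> \<in> cone_off X v \<tau>"
  show "finite \<alpha>"
  proof (cases "v \<in> \<alpha>")
    case True
    then have "\<alpha> - {v} \<subseteq> \<tau>" using a cone_off_iff[of \<alpha>] by simp
    then have "finite (\<alpha> - {v})" using fin\<tau> by (rule finite_subset)
    then show ?thesis by simp
  next
    case False then show ?thesis using a simplicial_complexD(3)[OF X] by (simp add: cone_off_iff)
  qed
  fix \<beta> assume b: "\<beta> \<subseteq> \<alpha>"
  show "\<beta> \<in> cone_off X v \<tau>"
  proof (cases "v \<in> \<alpha>")
    case True
    then have s: "\<alpha> - {v} \<subseteq> \<tau>" using a by (simp add: cone_off_iff)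
    show ?thesis
    proof (cases "v \<in> \<beta>")
      case True then show ?thesis using s b by (auto simp: cone_off_iff)
    next
      case False
      then have "\<beta> \<subseteq> \<tau>" using s b by blast
      then show ?thesis using False simplicial_complexD(4)[OF X \<tau>] by (simp add: cone_off_iff)
    qed
  next
    case False
    then have "\<alpha> \<in> X" "v \<notin> \<beta>" using a b by (auto simp: cone_off_iff)
    then show ?thesis using b simplicial_complexD(4)[OF X] by (simp add: cone_off_iff)
  qed
qed

lemma verts_cone: "verts (cone_off X v \<tau>) = insert v (verts X)"
  by (auto simp: verts_def cone_off_iff)

lemma card_faces_cone: "card (faces i (cone_off X v \<tau>)) = card (faces i X) + (card \<tau> choose i)"
proof -
  let ?N = "{\<beta>. \<beta> \<subseteq> \<tau> \<and> card \<beta> = i}"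
  have vn: "v \<notin> \<beta>" if "\<beta> \<subseteq> \<tau>" for \<beta> using v_notin[OF \<tau>] that by blast
  have eq: "faces i (cone_off X v \<tau>) = faces i X \<union> insert v ` ?N"
  proof (intro set_eqI iffI)
    fix \<alpha> assume "\<alpha> \<in> faces i (cone_off X v \<tau>)"
    then have a: "\<alpha> \<in> cone_off X v \<tau>" "card \<alpha> = Suc i" by (auto simp: faces_def)
    show "\<alpha> \<in> faces i X \<union> insert v ` ?N"
    proof (cases "v \<in> \<alpha>")
      case True
      then have "\<alpha> - {v} \<in> ?N" using a simplicial_complexD(3)[OF cone_complex a(1)] by (simp add: cone_off_iff)
      moreover have "\<alpha> = insert v (\<alpha> - {v})" using True by blast
      ultimately show ?thesis by blast
    next
      case False then show ?thesis using a by (simp add: cone_off_iff faces_def)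
    qed
  next
    fix \<alpha> assume "\<alpha> \<in> faces i X \<union> insert v ` ?N"
    then show "\<alpha> \<in> faces i (cone_off X v \<tau>)"
    proof
      assume "\<alpha> \<in> faces i X" then show ?thesis by (simp add: faces_def cone_off_def)
    next
      assume "\<alpha> \<in> insert v ` ?N"
      then obtain \<beta> where b: "\<beta> \<subseteq> \<tau>" "card \<beta> = i" "\<alpha> = insert v \<beta>" by blast
      then show ?thesis using vn[OF b(1)] finite_subset[OF b(1) fin\<tau>] by (auto simp: faces_def cone_off_def)
    qed
  qed
  have "card (faces i X \<union> insert v ` ?N) = card (faces i X) + card (insert v ` ?N)"
  proof (rule card_Un_disjoint)
    show "finite (faces i X)" by (rule faces_finite[OF X])
    show "finite (insert v ` ?N)" using fin\<tau> by simp
    show "faces i X \<inter> insert v ` ?N = {}" using v_notin by (auto simp: faces_def)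
  qed
  moreover have "card (insert v ` ?N) = card ?N"
  proof (rule card_image, rule inj_onI)
    fix \<beta> \<gamma> assume "\<beta> \<in> ?N" "\<gamma> \<in> ?N" "insert v \<beta> = insert v \<gamma>"
    then show "\<beta> = \<gamma>" using vn[of \<beta>] vn[of \<gamma>] by (metis (no_types, lifting) insert_ident mem_Collect_eq)
  qed
  ultimately show ?thesis unfolding eq using n_subsets[OF fin\<tau>, of i] by simp
qed

text \<open>
  If a cycle vanishes on the faces that contain \<open>v\<close> but not \<open>w\<close>, then the coefficient of its boundary at
  a face \<open>{v} \<union> \<gamma>\<close> is just its own coefficient at \<open>{w, v} \<union> \<gamma>\<close>. So it avoids \<open>v\<close> altogether.
\<close>

lemma cycle_avoiding_cone:
  fixes c :: "'a list \<Rightarrow> 'f::field"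
  assumes c: "c \<in> cycles (cone_off X v \<tau>) i" and w: "w \<in> \<tau>"
    and z: "\<And>l. c l \<noteq> 0 \<Longrightarrow> v \<in> set l \<Longrightarrow> w \<in> set l"
  shows "c \<in> cycles X i"
proof -
  let ?Y = "cone_off X v \<tau>"
  have co: "c \<in> oriented_chains ?Y i" and cyc: "\<And>l. bd ?Y c l = 0" using c by (auto simp: cycles_def)
  have vw: "v \<noteq> w" using v_notin[OF \<tau>] w by blast
  have fV: "finite (verts ?Y)" by (rule finite_verts[OF cone_complex])
  have wV: "w \<in> verts ?Y" using face_subset_verts[OF X \<tau>] w verts_cone by blast
  have none: "c l = 0" if "v \<in> set l" for l
  proof (rule ccontr)
    assume n: "c l \<noteq> 0"
    have d: "distinct l" by (rule oriented_chainsD(1)[OF co n])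
    have "w \<in> set l" by (rule z[OF n that])
    obtain m where m: "distinct m" "set m = set l - {v, w}"
      using finite_distinct_list[of "set l - {v, w}"] by auto
    have ld: "distinct (w # v # m)" "set (w # v # m) = set l"
      using m vw \<open>w \<in> set l\<close> that by auto
    have "c (u # v # m) = 0" if "u \<noteq> w" for u
    proof (rule ccontr)
      assume "c (u # v # m) \<noteq> 0"
      then have "w \<in> set (u # v # m)" by (rule z) simp
      then show False using that vw m(2) by simp
    qed
    then have "(\<Sum>u\<in>verts ?Y. c (u # v # m)) = c (w # v # m)"
      using sum.remove[OF fV wV, of "\<lambda>u. c (u # v # m)"] by simp
    then have "c (w # v # m) = 0" using cyc[of "v # m"] by (simp add: bd_def)
    then have "c l = 0" by (rule oriented_chain_vanish[OF co ld(1) d ld(2)])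
    then show False using n by simp
  qed
  have "c \<in> oriented_chains X i"
    unfolding oriented_chains_def mem_Collect_eq
  proof (intro conjI allI impI)
    fix l assume n: "c l \<noteq> 0"
    show "distinct l" "length l = Suc i" using oriented_chainsD(1,2)[OF co n] .
    have "v \<notin> set l" using none n by blast
    then show "set l \<in> X" using oriented_chainsD(3)[OF co n] by (simp add: cone_off_iff)
  qed (rule oriented_chainsD(4)[OF co])
  moreover have "bd X c l = bd ?Y c l" for l
    unfolding bd_def verts_cone using finite_verts[OF X] new none by simp
  ultimately show ?thesis using cyc by (simp add: cycles_def)
qed

text \<open>
  Let \<open>q\<^sub>i\<close> be the number of \<open>i\<close>-faces that contain \<open>v\<close> but not \<open>w\<close>. There are \<open>q\<^sub>i + q\<^sub>i\<^sub>-\<^sub>1\<close> new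
  \<open>i\<close>-faces. The space of \<open>i\<close>-cycles grows by at most \<open>q\<^sub>i\<close>, by \<open>cycle_avoiding_cone\<close>, and so the
  space of \<open>i\<close>-boundaries grows by at least \<open>q\<^sub>i\<close>.
\<close>

theorem betti_cone_le:
  assumes w: "w \<in> \<tau>"
  shows "betti TYPE('f::field) i (cone_off X v \<tau>) \<le> betti TYPE('f) i X"
proof -
  let ?Y = "cone_off X v \<tau>"
  note Y = cone_complex
  let ?Z = "\<lambda>X i. fun_dim (cycles X i :: ('a list \<Rightarrow> 'f) set)"
  let ?B = "\<lambda>X i. fun_dim (boundaries X i :: ('a list \<Rightarrow> 'f) set)"
  let ?q = "\<lambda>i. (card \<tau> - 1) choose i"
  have ct: "card \<tau> = Suc (card \<tau> - 1)" using w fin\<tau> card_gt_0_iff[of \<tau>] by fastforce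
  have le: "?Z ?Y i \<le> ?Z X i + ?q i" for i
  proof -
    define rl where "rl \<alpha> = (SOME l. distinct l \<and> set l = \<alpha>)" for \<alpha> :: "'a set"
    have rl: "distinct (rl \<alpha>) \<and> set (rl \<alpha>) = \<alpha>" if "finite \<alpha>" for \<alpha>
      unfolding rl_def by (rule someI_ex) (use finite_distinct_list[OF that] in blast)
    let ?N = "{\<beta>. \<beta> \<subseteq> \<tau> - {w} \<and> card \<beta> = i}"
    let ?P = "(\<lambda>\<beta>. rl (insert v \<beta>)) ` ?N"
    have fN: "finite ?N" using fin\<tau> by simp
    have cN: "card ?N = ?q i" using n_subsets[of "\<tau> - {w}" i] fin\<tau> w by simp
    have "{c \<in> cycles ?Y i. \<forall>l\<in>?P. c l = 0} \<subseteq> (cycles X i :: ('a list \<Rightarrow> 'f) set)"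
    proof clarify
      fix c :: "'a list \<Rightarrow> 'f" assume c: "c \<in> cycles ?Y i" "\<forall>l\<in>?P. c l = 0"
      have co: "c \<in> oriented_chains ?Y i" using c cycles_subset by blast
      show "c \<in> cycles X i"
      proof (rule cycle_avoiding_cone[OF c(1) w])
        fix l assume n: "c l \<noteq> 0" and v: "v \<in> set l"
        show "w \<in> set l"
        proof (rule ccontr)
          assume nw: "w \<notin> set l"
          note l = oriented_chainsD(1-3)[OF co n]
          have "set l - {v} \<in> ?N"
            using l v nw distinct_card[OF l(1)] by (auto simp: cone_off_iff)
          then have "rl (insert v (set l - {v})) \<in> ?P" by blast
          moreover have "insert v (set l - {v}) = set l" using v by blast
          ultimately have "c (rl (set l)) = 0" using c(2) by (metis (no_types, lifting))
          then have "c l = 0" using oriented_chain_vanish[OF co _ l(1), of "rl (set l)"] rl[of "set l"] by simp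
          then show False using n by simp
        qed
      qed
    qed
    then have "fun_dim {c \<in> cycles ?Y i. \<forall>l\<in>?P. c l = (0::'f)} \<le> ?Z X i"
      by (rule fun_dim_mono[OF _ cycles_supported finite_face_lists[OF X]])
    moreover have "?Z ?Y i \<le> fun_dim {c \<in> cycles ?Y i. \<forall>l\<in>?P. c l = (0::'f)} + card ?P"
      by (rule fun_dim_le_vanishing[OF cycles_subspace cycles_supported finite_face_lists[OF Y] finite_imageI[OF fN]])
    moreover have "card ?P \<le> ?q i" using card_image_le[OF fN] cN by metis
    ultimately show ?thesis by linarith
  qed
  have "card \<tau> choose Suc i = ?q i + ?q (Suc i)" using ct binomial_Suc_Suc[of "card \<tau> - 1" i] by metis
  then have "card (faces (Suc i) ?Y) = card (faces (Suc i) X) + ?q i + ?q (Suc i)"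
    using card_faces_cone[of "Suc i"] by simp
  then show ?thesis
    using le[of i] le[of "Suc i"] dim_cycles_Suc[OF X, of i, where 'f = 'f] dim_cycles_Suc[OF Y, of i, where 'f = 'f]
      betti_plus_dim_boundaries[OF X, of i, where 'f = 'f] betti_plus_dim_boundaries[OF Y, of i, where 'f = 'f]
    by linarith
qed

corollary point_homology_cone:
  assumes "\<tau> \<noteq> {}" "point_homology TYPE('f::field) X"
  shows "point_homology TYPE('f) (cone_off X v \<tau>)"
proof -
  obtain w where w: "w \<in> \<tau>" using assms(1) by blast
  note le = betti_cone_le[OF w, where 'f = 'f]
  have "ncomp (adj (cone_off X v \<tau>)) (verts (cone_off X v \<tau>)) \<noteq> 0"
    unfolding ncomp_def verts_cone using finite_verts[OF X] by simp
  then have "betti TYPE('f) 0 (cone_off X v \<tau>) \<noteq> 0"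
    using betti_0_eq_ncomp[OF cone_complex, where 'f = 'f] by simp
  then have "betti TYPE('f) 0 (cone_off X v \<tau>) = 1"
    using le[of 0] assms(2) by (simp add: point_homology_def)
  moreover have "betti TYPE('f) i (cone_off X v \<tau>) = 0" if "i \<noteq> 0" for i
    using le[of i] assms(2) that by (simp add: point_homology_def)
  ultimately show ?thesis by (simp add: point_homology_def)
qed

end

lemma Pow_complex: "finite A \<Longrightarrow> simplicial_complex (Pow A)"
  unfolding simplicial_complex_def using finite_subset by auto

lemma point_homology_simplex:
  assumes "finite A" "A \<noteq> {}"
  shows "point_homology TYPE('f::field) (Pow A)"
  using assms
proof (induction A rule: finite_ne_induct)
  case (singleton a)
  have "card \<alpha> \<le> 1" if "\<alpha> \<in> Pow {a}" for \<alpha> using card_mono[of "{a}" \<alpha>] that by simp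
  note b = betti_discrete[OF Pow_complex[of "{a}"] this, where 'f = 'f]
  have "verts (Pow {a}) = {a}" by (auto simp: verts_def)
  then show ?case using b by (simp add: point_homology_def)
next
  case (insert v A)
  interpret cone_over_face "Pow A" v A
    by unfold_locales (use insert Pow_complex in \<open>auto simp: verts_def\<close>)
  have "cone_off (Pow A) v A = Pow (insert v A)" by (simp add: cone_off_def Pow_insert)
  then show ?case using point_homology_cone[where 'f = 'f] insert by simp
qed

lemma sphere_homology_empty: "sphere_homology TYPE('f::field) (-1) {{} :: 'a set}"
proof -
  have X: "simplicial_complex {{} :: 'a set}" by (simp add: simplicial_complex_def)
  have "faces i {{} :: 'a set} = {}" for i by (auto simp: faces_def)
  then have "betti TYPE('f) i {{} :: 'a set} = 0" for i by (rule betti_eq_0[OF X])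
  then show ?thesis by (simp add: sphere_homology_def)
qed

lemma not_point_homology_empty: "\<not> point_homology TYPE('f::field) {{} :: 'a set}"
proof
  assume "point_homology TYPE('f) {{} :: 'a set}"
  then have "betti TYPE('f) 0 {{} :: 'a set} = 1" by (simp add: point_homology_def)
  moreover have "betti TYPE('f) 0 {{} :: 'a set} = 0"
    using sphere_homology_empty[where 'f = 'f and 'a = 'a] by (simp add: sphere_homology_def)
  ultimately show False by simp
qed

section \<open>Spheres attaining the bound are 1-stacked\<close>

lemma link_simplex: "\<alpha> \<subseteq> A \<Longrightarrow> link \<alpha> (Pow A) = Pow (A - \<alpha>)"
  by (auto simp: link_iff)

lemma nonempty_face_of_simplex_homology:
  fixes A :: "'a set"
  assumes "finite A"
  shows "if A = {} then sphere_homology TYPE('f::field) (-1) (Pow A) \<and> \<not> point_homology TYPE('f) (Pow A)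
    else point_homology TYPE('f) (Pow A)"
proof (cases "A = {}")
  case True
  show ?thesis unfolding if_P[OF True] unfolding True Pow_empty
    by (rule conjI[OF sphere_homology_empty not_point_homology_empty])
next
  case False
  then show ?thesis using point_homology_simplex[OF assms False, where 'f = 'f] by simp
qed

text \<open>
  All properties of a ball witnessing 1-stackedness, except that the boundary is a homology sphere. So
  it can be carried through an induction over triangulated spheres.
\<close>

definition fills :: "'f::field itself \<Rightarrow> 'a set set \<Rightarrow> 'a set set \<Rightarrow> bool" where
  "fills F T D \<longleftrightarrow> manifold_links F 3 D \<and> point_homology F D \<and> manifold_boundary F D = faces_of T \<and>
     (\<forall>\<alpha>\<in>D. card \<alpha> \<le> 2 \<longrightarrow> \<alpha> \<in> faces_of T)"

lemma tetrahedron_fills: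
  assumes T: "two_sphere T" and four: "card (\<Union>T) = 4"
  shows "fills TYPE('f::field) T (Pow (\<Union>T))"
proof -
  let ?V = "\<Union>T"
  have S: "closed_surface T" and cT: "card T = 4" using T four by (auto simp: two_sphere_def)
  note fV = surface_finite_verts[OF S]
  note C = Pow_complex[OF fV]
  have TT: "T = {s. s \<subseteq> ?V \<and> card s = 3}"
  proof (rule card_subset_eq)
    show "finite {s. s \<subseteq> ?V \<and> card s = 3}" using fV by simp
    show "T \<subseteq> {s. s \<subseteq> ?V \<and> card s = 3}" using closed_surfaceD(3)[OF S] by blast
    have "(4::nat) choose 3 = 4" by (simp add: numeral_eq_Suc)
    then show "card T = card {s. s \<subseteq> ?V \<and> card s = 3}" using n_subsets[OF fV, of 3] four cT by simp
  qed
  have faces: "\<alpha> \<in> faces_of T \<longleftrightarrow> \<alpha> \<subseteq> ?V \<and> \<alpha> \<noteq> ?V" for \<alpha>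
  proof
    assume "\<alpha> \<in> faces_of T"
    then obtain t where t: "t \<in> T" "\<alpha> \<subseteq> t" by (auto simp: faces_of_def)
    then have "card \<alpha> \<le> 3" using card_mono[OF triangle_finite[OF S t(1)] t(2)] closed_surfaceD(3)[OF S t(1)] by simp
    then show "\<alpha> \<subseteq> ?V \<and> \<alpha> \<noteq> ?V" using t four by auto
  next
    assume a: "\<alpha> \<subseteq> ?V \<and> \<alpha> \<noteq> ?V"
    then have "card \<alpha> < 4" using psubset_card_mono[OF fV, of \<alpha>] four by auto
    then obtain s where "\<alpha> \<subseteq> s" "s \<subseteq> ?V" "card s = 3"
      using exists_subset_between[of \<alpha> 3 ?V] a fV four by auto
    then show "\<alpha> \<in> faces_of T" using TT by (auto simp: faces_of_def)
  qed
  have lk: "if \<alpha> = ?V then sphere_homology TYPE('f) (-1) (link \<alpha> (Pow ?V)) \<and> \<not> point_homology TYPE('f) (link \<alpha> (Pow ?V))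
      else point_homology TYPE('f) (link \<alpha> (Pow ?V))" if "\<alpha> \<subseteq> ?V" for \<alpha>
  proof -
    have "?V - \<alpha> = {} \<longleftrightarrow> \<alpha> = ?V" using that by blast
    then show ?thesis unfolding link_simplex[OF that]
      using nonempty_face_of_simplex_homology[OF finite_Diff[OF fV], of \<alpha>, where 'f = 'f] by presburger
  qed
  have pure: "pure 3 (Pow ?V)"
  proof (rule pureI[OF C])
    show "int (card \<alpha>) \<le> 3 + 1" if "\<alpha> \<in> Pow ?V" for \<alpha> using card_mono[OF fV, of \<alpha>] that four by simp
    show "\<exists>\<beta>\<in>Pow ?V. \<alpha> \<subseteq> \<beta> \<and> int (card \<beta>) = 3 + 1" if "\<alpha> \<in> Pow ?V" for \<alpha>
      using that four by (intro bexI[of _ ?V]) auto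
  qed
  have "sphere_homology TYPE('f) (3 - int (card \<alpha>)) (link \<alpha> (Pow ?V)) \<or> point_homology TYPE('f) (link \<alpha> (Pow ?V))"
    if "\<alpha> \<in> Pow ?V" for \<alpha>
    using lk[of \<alpha>] that four by (cases "\<alpha> = ?V") auto
  then have "manifold_links TYPE('f) 3 (Pow ?V)" unfolding manifold_links_def using C pure by blast
  moreover have e: "?V \<noteq> {}"
  proof
    assume "?V = {}"
    with four have "card ({} :: 'a set) = 4" by (rule subst[rotated])
    then show False by simp
  qed
  moreover have "manifold_boundary TYPE('f) (Pow ?V) = faces_of T"
  proof (intro set_eqI)
    fix \<alpha>
    show "\<alpha> \<in> manifold_boundary TYPE('f) (Pow ?V) \<longleftrightarrow> \<alpha> \<in> faces_of T"
      unfolding manifold_boundary_def faces using lk[of \<alpha>] e[symmetric] by (cases "\<alpha> = ?V") auto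
  qed
  moreover have "\<alpha> \<in> faces_of T" if "\<alpha> \<in> Pow ?V" "card \<alpha> \<le> 2" for \<alpha> unfolding faces using that four by auto
  moreover have "point_homology TYPE('f) (Pow ?V)" by (rule point_homology_simplex[OF fV e])
  ultimately show ?thesis by (simp add: fills_def)
qed

text \<open>
  Coning off the boundary triangle \<open>abc\<close> adds one tetrahedron. Among the old faces, only \<open>abc\<close> itself
  becomes interior: its link gains a second point.
\<close>

lemma (in degree_3_vertex) stack_fills:
  assumes D: "fills TYPE('f::field) removed D"
  shows "fills TYPE('f) T (cone_off D x {a, b, c})"
proof -
  let ?t = "{a, b, c}" and ?D = "cone_off D x {a, b, c}"
  have ml: "manifold_links TYPE('f) 3 D" and ph: "point_homology TYPE('f) D"
    and bd: "manifold_boundary TYPE('f) D = faces_of removed"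
    and low: "\<And>\<alpha>. \<alpha> \<in> D \<Longrightarrow> card \<alpha> \<le> 2 \<Longrightarrow> \<alpha> \<in> faces_of removed"
    using D by (auto simp: fills_def)
  have C: "simplicial_complex D" and p: "pure 3 D" using ml by (auto simp: manifold_links_def)
  have lkD: "sphere_homology TYPE('f) (3 - int (card \<alpha>)) (link \<alpha> D) \<or> point_homology TYPE('f) (link \<alpha> D)"
    if "\<alpha> \<in> D" "\<alpha> \<noteq> {}" for \<alpha> using ml that unfolding manifold_links_def by blast
  have bdD: "\<alpha> \<in> faces_of removed \<longleftrightarrow> \<alpha> = {} \<or> \<alpha> \<in> D \<and> point_homology TYPE('f) (link \<alpha> D)" for \<alpha>
    unfolding bd[symmetric] manifold_boundary_def using simplicial_complexD(2)[OF C] by auto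
  have tR: "?t \<in> removed" by (simp add: removed_def)
  then have tb: "\<alpha> \<in> faces_of removed" if "\<alpha> \<subseteq> ?t" for \<alpha> using that by (auto simp: faces_of_def)
  have tph: "\<alpha> \<in> D \<and> point_homology TYPE('f) (link \<alpha> D)" if "\<alpha> \<subseteq> ?t" "\<alpha> \<noteq> {}" for \<alpha>
    using bdD[of \<alpha>] tb[OF that(1)] that(2) by argo
  have tD: "?t \<in> D" using tph[of ?t] by simp
  have xV: "x \<notin> \<Union>removed" using verts_removed by blast
  have xD: "x \<notin> verts D"
  proof
    assume "x \<in> verts D"
    then have "{x} \<in> faces_of removed" using low[of "{x}"] by (simp add: verts_def)
    then show False using xV by (auto simp: faces_of_def)
  qed
  interpret K: cone_over_face D x ?t by unfold_locales (use C xD tD in auto)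
  note CK = K.cone_complex
  have ph': "point_homology TYPE('f) ?D" by (rule K.point_homology_cone[OF _ ph]) simp
  (* Links of faces through the new vertex are simplices; the others are old links, or old links
     coned off over the rest of the triangle. *)
  have lk_new: "link \<alpha> ?D = Pow (?t - \<alpha>)" if "\<alpha> \<in> ?D" "x \<in> \<alpha>" for \<alpha>
  proof -
    have s: "\<alpha> - {x} \<subseteq> ?t" using that K.cone_off_iff[of \<alpha>] by simp
    have "\<beta> \<in> link \<alpha> ?D \<longleftrightarrow> \<beta> \<in> Pow (?t - \<alpha>)" for \<beta>
      unfolding link_iff K.cone_off_iff using that(2) s xdist by auto
    then show ?thesis by blast
  qed
  have lk_off: "link \<alpha> ?D = link \<alpha> D" if "\<alpha> \<in> D" "\<not> \<alpha> \<subseteq> ?t" for \<alpha>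
  proof -
    have "x \<notin> \<alpha>" by (rule K.v_notin[OF that(1)])
    then have "\<beta> \<in> link \<alpha> ?D \<longleftrightarrow> \<beta> \<in> link \<alpha> D" for \<beta>
      unfolding link_iff K.cone_off_iff using that(2) K.v_notin[of "\<alpha> \<union> \<beta>"] by auto
    then show ?thesis by blast
  qed
  have lk_on: "link \<alpha> ?D = cone_off (link \<alpha> D) x (?t - \<alpha>)" "cone_over_face (link \<alpha> D) x (?t - \<alpha>)"
    if a: "\<alpha> \<in> D" "\<alpha> \<subseteq> ?t" for \<alpha>
  proof -
    have xa: "x \<notin> \<alpha>" by (rule K.v_notin[OF a(1)])
    show cf: "cone_over_face (link \<alpha> D) x (?t - \<alpha>)"
    proof
      show "simplicial_complex (link \<alpha> D)" by (rule link_complex[OF C a(1)])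
      show "x \<notin> verts (link \<alpha> D)" unfolding verts_link using K.v_notin by blast
      have "\<alpha> \<union> (?t - \<alpha>) = ?t" using a(2) by blast
      then show "?t - \<alpha> \<in> link \<alpha> D" using tD by (simp only: link_iff) blast
    qed
    have "\<beta> \<in> link \<alpha> ?D \<longleftrightarrow> \<beta> \<in> cone_off (link \<alpha> D) x (?t - \<alpha>)" for \<beta>
      unfolding cone_over_face.cone_off_iff[OF cf] link_iff K.cone_off_iff using a(2) xa by auto
    then show "link \<alpha> ?D = cone_off (link \<alpha> D) x (?t - \<alpha>)" by blast
  qed
  have t0: "sphere_homology TYPE('f) 0 (link ?t ?D) \<and> \<not> point_homology TYPE('f) (link ?t ?D)"
  proof -
    have tK: "?t \<in> ?D" using tD by (simp add: cone_off_def)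
    have c3: "card ?t = 3" by (rule card_abc)
    have le4: "card \<beta> \<le> Suc 3" if "\<beta> \<in> ?D" for \<beta>
    proof (cases "x \<in> \<beta>")
      case True
      then have "\<beta> \<subseteq> insert x ?t" using that K.cone_off_iff[of \<beta>] by auto
      then have "card \<beta> \<le> card (insert x ?t)" by (rule card_mono[rotated]) simp
      then show ?thesis using c3 xdist by simp
    next
      case False
      then have "\<beta> \<in> D" using that K.cone_off_iff[of \<beta>] by simp
      then show ?thesis using pure_faces(1)[OF C p] by fastforce
    qed
    have b0: "betti TYPE('f) i (link ?t ?D) = 0" if "0 < i" for i
      by (rule ridge_degree(2)[OF CK _ tK c3 that]) (rule le4)
    have disc: "card \<beta> \<le> 1" if "\<beta> \<in> link ?t D" for \<beta>
    proof -
      have b: "?t \<inter> \<beta> = {}" "?t \<union> \<beta> \<in> D" using that by (simp_all add: link_iff)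
      then have "finite \<beta>" using simplicial_complexD(3)[OF C] by blast
      then have "card (?t \<union> \<beta>) = 3 + card \<beta>" using card_Un_disjoint[of ?t \<beta>] b(1) c3 by simp
      then show ?thesis using pure_faces(1)[OF C p b(2)] by simp
    qed
    have disc': "card \<beta> \<le> 1" if "\<beta> \<in> link ?t ?D" for \<beta>
    proof -
      have b: "?t \<inter> \<beta> = {}" "?t \<union> \<beta> \<in> ?D" using that by (simp_all add: link_iff)
      then have "finite \<beta>" using simplicial_complexD(3)[OF CK] by blast
      then have "card (?t \<union> \<beta>) = 3 + card \<beta>" using card_Un_disjoint[of ?t \<beta>] b(1) c3 by simp
      then show ?thesis using le4[OF b(2)] by simp
    qed
    have "card (verts (link ?t D)) = 1"
      using betti_discrete(1)[OF link_complex[OF C tD] disc, where 'f = 'f] tph[of ?t] by (simp add: point_homology_def)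
    moreover have "verts (link ?t ?D) = insert x (verts (link ?t D))"
      unfolding lk_on(1)[OF tD order_refl] by (rule cone_over_face.verts_cone[OF lk_on(2)[OF tD order_refl]])
    moreover have "x \<notin> verts (link ?t D)" using cone_over_face.new[OF lk_on(2)[OF tD order_refl]] .
    moreover have "finite (verts (link ?t D))" by (rule finite_verts[OF link_complex[OF C tD]])
    ultimately have "card (verts (link ?t ?D)) = 2" by simp
    then have "betti TYPE('f) 0 (link ?t ?D) = 2"
      using betti_discrete(1)[OF link_complex[OF CK tK] disc', where 'f = 'f] by simp
    then show ?thesis using b0 by (auto simp: sphere_homology_def point_homology_def)
  qed
  have full: "\<alpha> = insert x ?t" if "x \<in> \<alpha>" "\<alpha> - {x} \<subseteq> ?t" "?t - \<alpha> = {}" for \<alpha> using that by blast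
  have c4: "card (insert x ?t) = 4" using card_abc xdist by simp
  have status: "if \<alpha> = ?t \<or> \<alpha> = insert x ?t
      then sphere_homology TYPE('f) (3 - int (card \<alpha>)) (link \<alpha> ?D) \<and> \<not> point_homology TYPE('f) (link \<alpha> ?D)
      else if x \<in> \<alpha> \<or> \<alpha> \<subseteq> ?t then point_homology TYPE('f) (link \<alpha> ?D)
      else link \<alpha> ?D = link \<alpha> D"
    if a: "\<alpha> \<in> ?D" "\<alpha> \<noteq> {}" for \<alpha>
  proof (cases "x \<in> \<alpha>")
    case True
    have s: "\<alpha> - {x} \<subseteq> ?t" using a True K.cone_off_iff[of \<alpha>] by simp
    have ne: "\<alpha> \<noteq> ?t" using True xdist by auto
    have f: "finite (?t - \<alpha>)" by simp
    show ?thesis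
    proof (cases "?t - \<alpha> = {}")
      case e: True
      then have "\<alpha> = insert x ?t" using full True s by blast
      moreover have "card \<alpha> = 4" using calculation c4 by simp
      ultimately show ?thesis
        using sphere_homology_empty[where 'f = 'f] not_point_homology_empty[where 'f = 'f]
        unfolding lk_new[OF a(1) True] e by simp
    next
      case False
      then have "\<alpha> \<noteq> insert x ?t" by blast
      then show ?thesis using point_homology_simplex[OF f False, where 'f = 'f] True ne
        unfolding lk_new[OF a(1) True] by simp
    qed
  next
    case False
    then have aD: "\<alpha> \<in> D" using a K.cone_off_iff[of \<alpha>] by simp
    have ne: "\<alpha> \<noteq> insert x ?t" using False by blast
    show ?thesis
    proof (cases "\<alpha> \<subseteq> ?t")
      case True
      show ?thesis
      proof (cases "\<alpha> = ?t")
        case e: True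
        then have "3 - int (card \<alpha>) = 0" using card_abc by simp
        then show ?thesis using t0 e by simp
      next
        case ne': False
        then have "?t - \<alpha> \<noteq> {}" using True by blast
        then have "point_homology TYPE('f) (link \<alpha> ?D)"
          unfolding lk_on(1)[OF aD True]
          by (rule cone_over_face.point_homology_cone[OF lk_on(2)[OF aD True]]) (use tph[OF True a(2)] in blast)
        then show ?thesis using ne ne' True by simp
      qed
    next
      case nt: False
      then have "\<alpha> \<noteq> ?t" by blast
      then show ?thesis using lk_off[OF aD nt] False nt ne by simp
    qed
  qed
  have facesT: "\<alpha> \<in> faces_of T \<longleftrightarrow> (if x \<in> \<alpha> then \<alpha> - {x} \<subseteq> ?t \<and> \<alpha> \<noteq> insert x ?t else \<alpha> \<in> faces_of removed \<and> \<alpha> \<noteq> ?t)" for \<alpha>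
  proof (cases "x \<in> \<alpha>")
    case True
    have "\<alpha> \<in> faces_of T \<longleftrightarrow> \<alpha> \<subseteq> {x, a, b} \<or> \<alpha> \<subseteq> {x, b, c} \<or> \<alpha> \<subseteq> {x, c, a}"
    proof
      assume "\<alpha> \<in> faces_of T"
      then obtain t where t: "t \<in> T" "\<alpha> \<subseteq> t" unfolding faces_of_def by blast
      have "t = {x, a, b} \<or> t = {x, b, c} \<or> t = {x, c, a}"
        using star[OF t(1)] subsetD[OF t(2) True] by simp
      then show "\<alpha> \<subseteq> {x, a, b} \<or> \<alpha> \<subseteq> {x, b, c} \<or> \<alpha> \<subseteq> {x, c, a}"
        using t(2) by metis
    next
      assume "\<alpha> \<subseteq> {x, a, b} \<or> \<alpha> \<subseteq> {x, b, c} \<or> \<alpha> \<subseteq> {x, c, a}"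
      then show "\<alpha> \<in> faces_of T"
        unfolding faces_of_def mem_Collect_eq using triT by metis
    qed
    also have "\<dots> \<longleftrightarrow> \<alpha> - {x} \<subseteq> ?t \<and> \<not> ?t \<subseteq> \<alpha>"
      using xdist by auto
    also have "\<dots> \<longleftrightarrow> \<alpha> - {x} \<subseteq> ?t \<and> \<alpha> \<noteq> insert x ?t" using True by auto
    finally show ?thesis using True by simp
  next
    case False
    have "\<alpha> \<in> faces_of T \<and> \<alpha> \<noteq> ?t" if f: "\<alpha> \<in> faces_of removed" "\<alpha> \<noteq> ?t"
    proof -
      obtain t where t: "t \<in> removed" "\<alpha> \<subseteq> t" using f(1) by (auto simp: faces_of_def)
      show ?thesis
      proof (cases "t = ?t")
        case True
        then have "\<alpha> \<subseteq> {a, b} \<or> \<alpha> \<subseteq> {b, c} \<or> \<alpha> \<subseteq> {c, a}" using t(2) f(2) by auto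
        then have "\<alpha> \<subseteq> {x, a, b} \<or> \<alpha> \<subseteq> {x, b, c} \<or> \<alpha> \<subseteq> {x, c, a}" by auto
        then show ?thesis using triT f(2) unfolding faces_of_def by blast
      next
        case False
        then show ?thesis using t f(2) unfolding removed_def faces_of_def by blast
      qed
    qed
    moreover have "\<alpha> \<in> faces_of removed \<and> \<alpha> \<noteq> ?t" if f: "\<alpha> \<in> faces_of T"
    proof -
      obtain t where t: "t \<in> T" "\<alpha> \<subseteq> t" using f by (auto simp: faces_of_def)
      have "\<alpha> \<noteq> ?t"
      proof
        assume e: "\<alpha> = ?t"
        then have "t = ?t" using t card_subset_eq[OF triangle_finite[OF S t(1)] t(2)] closed_surfaceD(3)[OF S t(1)] card_abc by simp
        then show False using t(1) not_face by blast
      qed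
      moreover have "\<alpha> \<in> faces_of removed"
      proof (cases "x \<in> t")
        case True
        then have "\<alpha> \<subseteq> ?t" using star[OF t(1)] t(2) False by auto
        then show ?thesis by (rule tb)
      next
        case nx: False
        then show ?thesis using t unfolding removed_def faces_of_def by blast
      qed
      ultimately show ?thesis by blast
    qed
    ultimately show ?thesis using False by auto
  qed
  have "manifold_boundary TYPE('f) ?D = faces_of T"
  proof (intro set_eqI)
    fix \<alpha>
    show "\<alpha> \<in> manifold_boundary TYPE('f) ?D \<longleftrightarrow> \<alpha> \<in> faces_of T"
    proof (cases "\<alpha> = {}")
      case True
      then show ?thesis using closed_surfaceD(2)[OF S] by (auto simp: manifold_boundary_def faces_of_def)
    next
      case ne: False
      have 1: "\<alpha> \<in> manifold_boundary TYPE('f) ?D \<longleftrightarrow> \<alpha> \<in> ?D \<and> point_homology TYPE('f) (link \<alpha> ?D)"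
        using ne by (simp add: manifold_boundary_def)
      show ?thesis
      proof (cases "x \<in> \<alpha>")
        case True
        have D': "\<alpha> \<in> ?D \<longleftrightarrow> \<alpha> - {x} \<subseteq> ?t" using K.cone_off_iff[of \<alpha>] True by simp
        have nt: "\<alpha> \<noteq> ?t" using True xdist by auto
        have "point_homology TYPE('f) (link \<alpha> ?D) \<longleftrightarrow> \<alpha> \<noteq> insert x ?t" if "\<alpha> \<in> ?D"
          using status[OF that ne] nt True by (cases "\<alpha> = insert x ?t") simp_all
        then have "\<alpha> \<in> ?D \<and> point_homology TYPE('f) (link \<alpha> ?D) \<longleftrightarrow> \<alpha> \<in> ?D \<and> \<alpha> \<noteq> insert x ?t"
          by (rule conj_cong[OF refl])
        then show ?thesis unfolding 1 facesT if_P[OF True] D' .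
      next
        case False
        have xt: "\<alpha> \<noteq> insert x ?t" using False by blast
        have D': "\<alpha> \<in> ?D \<longleftrightarrow> \<alpha> \<in> D" using K.cone_off_iff[of \<alpha>] False by simp
        show ?thesis
        proof (cases "\<alpha> \<subseteq> ?t")
          case True
          then show ?thesis unfolding 1 facesT D'
            using status[OF _ ne] D' False xt tph[OF True ne] tb[OF True] by (cases "\<alpha> = ?t") simp_all
        next
          case nt: False
          then have "\<alpha> \<noteq> ?t" by blast
          then show ?thesis unfolding 1 facesT D' bdD using status[OF _ ne] D' False xt nt ne by auto
        qed
      qed
    qed
  qed
  moreover have "manifold_links TYPE('f) 3 ?D"
    unfolding manifold_links_def
  proof (intro conjI ballI impI CK)
    show "pure 3 ?D"
    proof (rule pureI[OF CK])
      fix \<alpha> assume a: "\<alpha> \<in> ?D"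
      have ft: "finite (insert x ?t)" by simp
      show "int (card \<alpha>) \<le> 3 + 1"
      proof (cases "x \<in> \<alpha>")
        case True
        then have "\<alpha> \<subseteq> insert x ?t" using a K.cone_off_iff[of \<alpha>] by auto
        then show ?thesis using card_mono[OF ft, of \<alpha>] c4 by simp
      next
        case False
        then have "\<alpha> \<in> D" using a K.cone_off_iff[of \<alpha>] by simp
        then show ?thesis using pure_faces(1)[OF C p] by blast
      qed
      show "\<exists>\<beta>\<in>?D. \<alpha> \<subseteq> \<beta> \<and> int (card \<beta>) = 3 + 1"
      proof (cases "x \<in> \<alpha>")
        case True
        then have "\<alpha> \<subseteq> insert x ?t" using a K.cone_off_iff[of \<alpha>] by auto
        moreover have "insert x ?t \<in> ?D" by (simp add: cone_off_def)
        ultimately show ?thesis using c4 by (intro bexI[of _ "insert x ?t"]) auto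
      next
        case False
        then have "\<alpha> \<in> D" using a K.cone_off_iff[of \<alpha>] by simp
        then obtain \<beta> where "\<beta> \<in> D" "\<alpha> \<subseteq> \<beta>" "int (card \<beta>) = 3 + 1" using pure_faces(2)[OF C p] by blast
        moreover then have "\<beta> \<in> ?D" by (simp add: cone_off_def)
        ultimately show ?thesis by blast
      qed
    qed
    fix \<alpha> assume a: "\<alpha> \<in> ?D" "\<alpha> \<noteq> {}"
    have "\<alpha> \<in> D" if "x \<notin> \<alpha>" using a(1) that K.cone_off_iff[of \<alpha>] by simp
    then show "sphere_homology TYPE('f) (3 - int (card \<alpha>)) (link \<alpha> ?D) \<or> point_homology TYPE('f) (link \<alpha> ?D)"
      using status[OF a] lkD[OF _ a(2)] by (auto split: if_splits)
  qed
  moreover have "\<alpha> \<in> faces_of T" if a: "\<alpha> \<in> ?D" "card \<alpha> \<le> 2" for \<alpha>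
  proof -
    have "\<alpha> \<noteq> insert x ?t" "\<alpha> \<noteq> ?t" using a(2) c4 card_abc by auto
    then show ?thesis unfolding facesT using a(1) K.cone_off_iff[of \<alpha>] low[OF _ a(2)] by auto
  qed
  ultimately show ?thesis using ph' by (simp add: fills_def)
qed

lemma degree_3_vertexI:
  assumes T: "two_sphere T" and big: "5 \<le> card (\<Union>T)" and x: "card (nbrs T x) = 3"
  obtains a b c where "degree_3_vertex T x a b c"
proof -
  have S: "closed_surface T" using T by (simp add: two_sphere_def)
  have "nbrs T x \<noteq> {}" using x by auto
  then have xV: "x \<in> \<Union>T" by (auto simp: nbrs_def adj_def)
  have le: "card (nbrs T x) \<le> 5" using x by simp
  show thesis
  proof (cases rule: link_cycle_cases[OF S xV le])
    case (1 a b c)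
    then have "degree_3_vertex T x a b c" by unfold_locales (use T big in auto)
    then show ?thesis by (rule that)
  next
    case (2 a b c d)
    then show ?thesis using x by simp
  next
    case (3 a b c d e)
    then show ?thesis using x by simp
  qed
qed

text \<open>
  \<open>sphere_bound\<close> provides a vertex of degree 3. Removing it lowers the expectation by exactly \<open>1/20\<close>, so
  the remaining sphere attains the bound too.
\<close>

theorem extremal_sphere_filled:
  assumes "two_sphere T" "sphere_avg T = (real (card (\<Union>T)) + 12) / 20"
  shows "\<exists>D. fills TYPE('f::field) T D"
  using assms
proof (induction "card (\<Union>T)" arbitrary: T rule: less_induct)
  case less
  note T = less.prems(1)
  have S: "closed_surface T" using T by (simp add: two_sphere_def)
  have ge4: "4 \<le> card (\<Union>T)" by (rule surface_card_verts[OF S])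
  show ?case
  proof (cases "card (\<Union>T) = 4")
    case True then show ?thesis using tetrahedron_fills[OF T] by blast
  next
    case False
    then have big: "5 \<le> card (\<Union>T)" using ge4 by simp
    then obtain x where "card (nbrs T x) = 3" using sphere_bound[OF T] less.prems(2) by blast
    then obtain a b c where d3: "degree_3_vertex T x a b c" using degree_3_vertexI[OF T big] by blast
    interpret degree_3_vertex T x a b c by (rule d3)
    have "x \<in> \<Union>T" using triT by blast
    then have cc: "Suc (card (\<Union>removed)) = card (\<Union>T)"
      unfolding verts_removed using card_Suc_Diff1[OF surface_finite_verts[OF S]] by blast
    then have "real (card (\<Union>T)) = real (card (\<Union>removed)) + 1" by linarith
    then have "sphere_avg removed = (real (card (\<Union>removed)) + 12) / 20"
      using avg_removed less.prems(2) unfolding sphere_avg_def by argo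
    then obtain D where "fills TYPE('f) removed D"
      using less.hyps[OF _ removed_sphere] cc by auto
    then show ?thesis using stack_fills by blast
  qed
qed

theorem bound_implies_stacked:
  assumes hs: "homology_sphere TYPE('f::field) 2 L"
    and eq: "sphere_avg (triangles L) = (real (card (verts L)) + 12) / 20"
  shows "stacked_sphere TYPE('f) 2 1 L"
proof -
  note sph = homology_2_sphere_surface[OF hs]
  have "\<Union>(triangles L) = verts L" using verts_faces_of[of "triangles L"] sph(2) by simp
  then obtain D where D: "fills TYPE('f) (triangles L) D"
    using extremal_sphere_filled[OF sph(1), where 'f = 'f] eq by auto
  have bd: "manifold_boundary TYPE('f) D = L" and ml: "manifold_links TYPE('f) 3 D"
    and ph: "point_homology TYPE('f) D" and low: "\<And>\<alpha>. \<alpha> \<in> D \<Longrightarrow> card \<alpha> \<le> 2 \<Longrightarrow> \<alpha> \<in> L"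
    using D sph(2) by (auto simp: fills_def)
  have C: "simplicial_complex D" using ml by (simp add: manifold_links_def)
  have cl: "closed_homology_manifold TYPE('f) 2 L" using hs by (simp add: homology_sphere_def)
  have "homology_ball TYPE('f) (2 + 1) D"
    using ml ph bd cl hs by (simp add: homology_ball_def homology_manifold_def)
  moreover have "skel (2 - 1) D = skel (2 - 1) L"
  proof -
    have "L \<subseteq> D" unfolding bd[symmetric] manifold_boundary_def using simplicial_complexD(2)[OF C] by blast
    then show ?thesis using low by (auto simp: skel_def face_dim_def)
  qed
  ultimately show ?thesis unfolding stacked_sphere_def using hs bd by auto
qed

section \<open>Closed homology 3-manifolds\<close>

lemma sigma_0_link:
  assumes hs: "homology_sphere TYPE('f::field) 2 L"
  shows "sigma TYPE('f) 0 L / (1 + real (face_num 0 L)) = sphere_avg (triangles L) - 1"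
    and "real (face_num 0 L) = real (card (verts L))"
proof -
  have CL: "simplicial_complex L" using hs
    by (auto simp: homology_sphere_def closed_homology_manifold_def manifold_links_def)
  note fT = homology_2_sphere_surface(2)[OF hs]
  have "\<Union>(triangles L) = verts L" "adj (triangles L) = adj L"
    using verts_faces_of[of "triangles L"] adj_faces_of[of "triangles L"] fT by simp_all
  then show "sigma TYPE('f) 0 L / (1 + real (face_num 0 L)) = sphere_avg (triangles L) - 1"
    unfolding sphere_avg_def by (simp add: sigma_0_eq_avg[OF CL])
  show "real (face_num 0 L) = real (card (verts L))"
    using face_num_eq_card_faces[of 0 L] card_faces_0[of L] by simp
qed

lemma sigma_0_bound:
  assumes hs: "homology_sphere TYPE('f::field) 2 L"
  shows "sigma TYPE('f) 0 L / (1 + real (face_num 0 L)) \<le> (real (face_num 0 L) - 8) / 20"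
    and "sigma TYPE('f) 0 L / (1 + real (face_num 0 L)) = (real (face_num 0 L) - 8) / 20
      \<longleftrightarrow> stacked_sphere TYPE('f) 2 1 L"
proof -
  note sph = homology_2_sphere_surface[OF hs]
  have V: "\<Union>(triangles L) = verts L" using verts_faces_of[of "triangles L"] sph(2) by simp
  note eq = sigma_0_link[OF hs]
  have "sphere_avg (triangles L) \<le> (real (card (verts L)) + 12) / 20"
    using sphere_bound[OF sph(1)] unfolding V by blast
  then show "sigma TYPE('f) 0 L / (1 + real (face_num 0 L)) \<le> (real (face_num 0 L) - 8) / 20"
    unfolding eq(1) unfolding eq(2) by argo
  have "sigma TYPE('f) 0 L / (1 + real (face_num 0 L)) = (real (face_num 0 L) - 8) / 20
      \<longleftrightarrow> sphere_avg (triangles L) = (real (card (verts L)) + 12) / 20"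
    unfolding eq(1) unfolding eq(2) by argo
  then show "sigma TYPE('f) 0 L / (1 + real (face_num 0 L)) = (real (face_num 0 L) - 8) / 20
      \<longleftrightarrow> stacked_sphere TYPE('f) 2 1 L"
    using stacked_attains_bound[where 'f = 'f, of L] bound_implies_stacked[OF hs] by argo
qed

lemma sum_vertex_degrees:
  assumes M: "simplicial_complex M"
  shows "(\<Sum>x\<in>verts M. card (verts (link {x} M))) = 2 * card (faces 1 M)"
proof -
  have "card (verts (link {x} M)) = card {e\<in>faces 1 M. x \<in> e}" for x
  proof -
    have "{e\<in>faces 1 M. x \<in> e} = (\<lambda>y. {x, y}) ` verts (link {x} M)"
    proof (intro set_eqI iffI)
      fix e assume "e \<in> {e\<in>faces 1 M. x \<in> e}"
      then have e: "e \<in> M" "card e = 2" "x \<in> e" by (auto simp: faces_def)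
      from e(2) obtain p q where "e = {p, q}" "p \<noteq> q" unfolding card_2_iff by blast
      then obtain y where "e = {x, y}" "y \<noteq> x" using e(3) by blast
      then show "e \<in> (\<lambda>y. {x, y}) ` verts (link {x} M)" using e(1) by (auto simp: verts_link insert_commute)
    next
      fix e assume "e \<in> (\<lambda>y. {x, y}) ` verts (link {x} M)"
      then show "e \<in> {e\<in>faces 1 M. x \<in> e}" by (auto simp: verts_link faces_def insert_commute)
    qed
    moreover have "inj_on (\<lambda>y. {x, y}) (verts (link {x} M))"
      by (auto simp: inj_on_def doubleton_eq_iff)
    ultimately show ?thesis by (simp add: card_image)
  qed
  then have "(\<Sum>x\<in>verts M. card (verts (link {x} M))) = (\<Sum>x\<in>verts M. card {e\<in>faces 1 M. x \<in> e})" by simp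
  also have "\<dots> = (\<Sum>e\<in>faces 1 M. card {x\<in>verts M. x \<in> e})"
    by (rule sum_multicount_gen) (use finite_verts[OF M] faces_finite[OF M] in auto)
  also have "\<dots> = (\<Sum>e\<in>faces 1 M. 2)"
  proof (rule sum.cong[OF refl])
    fix e assume e: "e \<in> faces 1 M"
    then have "{x\<in>verts M. x \<in> e} = e" using face_subset_verts[OF M, of e] by (auto simp: faces_def)
    then show "card {x\<in>verts M. x \<in> e} = 2" using e by (simp add: faces_def)
  qed
  finally show ?thesis by simp
qed

lemma g_2_eq:
  assumes M: "simplicial_complex M" and d: "complex_dim M = 3"
  shows "g_num 2 M = 10 - 4 * int (card (verts M)) + int (card (faces 1 M))"
proof -
  have "{\<alpha>\<in>M. face_dim \<alpha> = - 1} = {{}}"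
    using simplicial_complexD(2,3)[OF M] by (auto simp: face_dim_def)
  then have "face_num (- 1) M = 1" by (simp add: face_num_def)
  moreover have "face_num 0 M = card (verts M)" using face_num_eq_card_faces[of 0 M] card_faces_0[of M] by simp
  moreover have "face_num 1 M = card (faces 1 M)" using face_num_eq_card_faces[of 1 M] by simp
  moreover have "{- 1..int 2 - 1} = {- 1, 0, 1}" by auto
  moreover have "(5::nat) choose 2 = 10" by (simp add: numeral_eq_Suc)
  ultimately show ?thesis by (simp add: g_num_def d nat_add_distrib)
qed

theorem theorem1p10:
  fixes M :: "'a set set"
  assumes "closed_homology_manifold TYPE('f::field) 3 M"
  shows "mu TYPE('f) 1 M - mu TYPE('f) 0 M \<le> - 1 + 1 / 10 * real_of_int (g_num 2 M) \<and>
         (mu TYPE('f) 1 M - mu TYPE('f) 0 M = - 1 + 1 / 10 * real_of_int (g_num 2 M)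
            \<longleftrightarrow> locally_stacked TYPE('f) 3 1 M)"
proof -
  have C: "simplicial_complex M" and d: "complex_dim M = 3"
    using assms by (auto simp: closed_homology_manifold_def manifold_links_def pure_def)
  let ?n = "\<lambda>x. real (face_num 0 (link {x} M))"
  let ?s = "\<lambda>x. sigma TYPE('f) 0 (link {x} M) / (1 + ?n x)"
  let ?b = "\<lambda>x. (?n x - 8) / 20"
  have hs: "homology_sphere TYPE('f) 2 (link {x} M)" if "x \<in> verts M" for x
    by (rule vertex_link_sphere[OF assms that])
  have lhs: "mu TYPE('f) 1 M - mu TYPE('f) 0 M = (\<Sum>x\<in>verts M. ?s x)"
    by (simp add: mu_def sum_subtractf[symmetric] diff_divide_distrib[symmetric])
  have "(\<Sum>x\<in>verts M. ?n x) = real (\<Sum>x\<in>verts M. card (verts (link {x} M)))"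
    unfolding of_nat_sum by (rule sum.cong[OF refl]) (rule sigma_0_link(2)[OF hs])
  then have deg: "(\<Sum>x\<in>verts M. ?n x) = 2 * real (card (faces 1 M))"
    unfolding sum_vertex_degrees[OF C] by simp
  have "(\<Sum>x\<in>verts M. ?b x) = ((\<Sum>x\<in>verts M. ?n x) - 8 * real (card (verts M))) / 20"
    by (simp add: sum_divide_distrib[symmetric] sum_subtractf)
  moreover have "real_of_int (g_num 2 M) = 10 - 4 * real (card (verts M)) + real (card (faces 1 M))"
    unfolding g_2_eq[OF C d] by simp
  ultimately have rhs: "- 1 + 1 / 10 * real_of_int (g_num 2 M) = (\<Sum>x\<in>verts M. ?b x)"
    unfolding deg by argo
  have le: "?s x \<le> ?b x" if "x \<in> verts M" for x
    by (rule sigma_0_bound(1)[OF hs[OF that]])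
  have "(\<Sum>x\<in>verts M. ?s x) = (\<Sum>x\<in>verts M. ?b x) \<longleftrightarrow> (\<forall>x\<in>verts M. ?s x = ?b x)"
  proof
    assume eq: "(\<Sum>x\<in>verts M. ?s x) = (\<Sum>x\<in>verts M. ?b x)"
    show "\<forall>x\<in>verts M. ?s x = ?b x"
      using sum_mono_inv[OF eq le _ finite_verts[OF C]] by blast
  qed (rule sum.cong[OF refl], blast)
  also have "\<dots> \<longleftrightarrow> (\<forall>x\<in>verts M. stacked_sphere TYPE('f) 2 1 (link {x} M))"
    using sigma_0_bound(2)[OF hs] by blast
  also have "\<dots> \<longleftrightarrow> locally_stacked TYPE('f) 3 1 M"
    using assms by (simp add: locally_stacked_def homology_manifold_def closed_homology_manifold_def)
  finally have "(\<Sum>x\<in>verts M. ?s x) = (\<Sum>x\<in>verts M. ?b x) \<longleftrightarrow> locally_stacked TYPE('f) 3 1 M" .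
  moreover have "(\<Sum>x\<in>verts M. ?s x) \<le> (\<Sum>x\<in>verts M. ?b x)" by (rule sum_mono[OF le])
  ultimately show ?thesis unfolding lhs rhs by blast
qed

end
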